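(* Let $W$ be an irreducible Coxeter group in $\mathrm{GL}(V)$, $V\cong\mathbb{C}^\ell$, with homogeneous basic invariants $p_1,\dots,p_\ell$, ordered by increasing degree. Let $F$ be the ideal in $\mathbb{C}[V]=\mathbb{C}[x_1,\dots,x_\ell]$ generated by $p_1,\dots,p_\ell$. Then for each $j=1,\dots,\ell$ there exists an $\ell\times\ell$-matrix $A_j$ with entries in $\mathbb{C}[V]$ such that $$\left(\frac{\partial p_\ell}{\partial x_1},\dots,\frac{\partial p_\ell}{\partial x_\ell}\right)\equiv\left(\frac{\partial p_j}{\partial x_1},\dots,\frac{\partial p_j}{\partial x_\ell}\right)A_j\mod F\cdot(\mathbb{C}[V])^\ell .$$
   Context: A Coxeter group in $\mathrm{GL}(V)$, where $V=V_{\mathbb R}\otimes_{\mathbb R}\mathbb{C}$, is a finite group generated by reflections defined over $\mathbb{R}$. It is irreducible if $V$ is an irreducible representation. Basic invariants are algebraically independent homogeneous generators of the invariant ring $\mathbb{C}[V]^W$. *)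

theory Defs
  imports
    "HOL-Analysis.Analysis"
    "HOL-Library.Poly_Mapping"
    "HOL-Algebra.Generated_Groups"
begin

section \<open>Complex polynomials in variables indexed by a type\<close>

text \<open>
  A polynomial is a finitely supported map from exponent vectors to coefficients; addition and
  the (convolution) product are those of \<^theory>\<open>HOL-Library.Poly_Mapping\<close>.
  For a finite type \<open>'n\<close> of cardinality \<open>l\<close>, the type \<open>'n cpoly\<close> is the coordinate ring
  of \<open>complex ^ 'n\<close>, that is, the polynomial ring in \<open>l\<close> variables.
\<close>

type_synonym 'v cpoly = "('v \<Rightarrow>\<^sub>0 nat) \<Rightarrow>\<^sub>0 complex"

text \<open>Substitution of \<open>f i\<close> for the variable \<open>i\<close>, coefficients being mapped along \<open>c\<close>.\<close>

definition substitute ::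
  "(complex \<Rightarrow> 'b) \<Rightarrow> ('v \<Rightarrow> 'b) \<Rightarrow> 'v cpoly \<Rightarrow> 'b::comm_semiring_1" where
  "substitute c f q =
     (\<Sum>m\<in>Poly_Mapping.keys q. c (Poly_Mapping.lookup q m) *
        (\<Prod>i\<in>Poly_Mapping.keys m. f i ^ Poly_Mapping.lookup m i))"

definition cpoly_at :: "'n cpoly \<Rightarrow> complex ^ 'n::finite \<Rightarrow> complex" where
  "cpoly_at q v = substitute (\<lambda>a. a) (\<lambda>i. v $ i) q"

definition cpoly_subst :: "'v cpoly \<Rightarrow> ('v \<Rightarrow> 'n cpoly) \<Rightarrow> 'n cpoly" where
  "cpoly_subst q f = substitute (Poly_Mapping.single 0) f q"

definition cpoly_vars :: "'v cpoly \<Rightarrow> 'v set" where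
  "cpoly_vars q = (\<Union>m\<in>Poly_Mapping.keys q. Poly_Mapping.keys m)"

definition monom_degree :: "('v \<Rightarrow>\<^sub>0 nat) \<Rightarrow> nat" where
  "monom_degree m = (\<Sum>i\<in>Poly_Mapping.keys m. Poly_Mapping.lookup m i)"

definition total_degree :: "'v cpoly \<Rightarrow> nat" where
  "total_degree q = Max (insert 0 (monom_degree ` Poly_Mapping.keys q))"

definition homogeneous_cpoly :: "'v cpoly \<Rightarrow> bool" where
  "homogeneous_cpoly q \<longleftrightarrow> (\<exists>d. \<forall>m\<in>Poly_Mapping.keys q. monom_degree m = d)"

text \<open>
  The subtraction of exponent vectors truncates only for monomials not involving the
  variable \<open>i\<close>, and these have coefficient \<open>0\<close> in the sum below.
\<close>

definition partial_deriv :: "'n \<Rightarrow> 'n cpoly \<Rightarrow> 'n cpoly" where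
  "partial_deriv i q =
     (\<Sum>m\<in>Poly_Mapping.keys q. Poly_Mapping.single (m - Poly_Mapping.single i 1)
        (of_nat (Poly_Mapping.lookup m i) * Poly_Mapping.lookup q m))"

definition gradient :: "'n cpoly \<Rightarrow> 'n cpoly ^ 'n::finite" where
  "gradient q = (\<chi> i. partial_deriv i q)"

definition ideal_generated :: "'a::comm_ring_1 set \<Rightarrow> 'a set" where
  "ideal_generated B = module.span (*) B"

text \<open>The submodule \<open>F \<cdot> R\<^sup>n\<close> of \<open>R\<^sup>n\<close> for an ideal \<open>F\<close> of \<open>R\<close>.\<close>

definition ideal_times_free_module :: "'a::comm_ring_1 set \<Rightarrow> ('a ^ 'n::finite) set" where
  "ideal_times_free_module F = module.span (*s) {f *s v | f v. f \<in> F}"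

lemma module_times: "module ((*) :: 'a \<Rightarrow> 'a \<Rightarrow> 'a::comm_ring_1)"
  by unfold_locales (auto simp: algebra_simps)

lemma module_vector_scalar_mult:
  "module ((*s) :: 'a \<Rightarrow> 'a ^ 'n \<Rightarrow> 'a::comm_ring_1 ^ 'n::finite)"
  by unfold_locales (auto simp: vec_eq_iff algebra_simps)

lemma ideal_times_free_module_iff:
  "v \<in> ideal_times_free_module (ideal_generated B) \<longleftrightarrow> (\<forall>i. v $ i \<in> ideal_generated B)"
proof -
  interpret R: module "(*) :: 'a \<Rightarrow> 'a \<Rightarrow> 'a" by (rule module_times)
  interpret M: module "(*s) :: 'a \<Rightarrow> 'a ^ 'b \<Rightarrow> 'a ^ 'b" by (rule module_vector_scalar_mult)
  let ?F = "R.span B"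
  let ?S = "{f *s v | f v. f \<in> ?F} :: ('a ^ 'b) set"
  have "M.subspace {v. \<forall>i. v $ i \<in> ?F}"
    by (auto intro!: M.subspaceI R.span_zero R.span_add R.span_scale)
  moreover have "?S \<subseteq> {v. \<forall>i. v $ i \<in> ?F}"
  proof clarsimp
    fix f i and v :: "'a ^ 'b"
    assume "f \<in> ?F"
    then have "v $ i * f \<in> ?F" by (rule R.span_scale)
    then show "f * v $ i \<in> ?F" by (simp add: mult.commute)
  qed
  ultimately have 1: "M.span ?S \<subseteq> {v. \<forall>i. v $ i \<in> ?F}"
    by (simp add: M.span_minimal)
  have 2: "v \<in> M.span ?S" if "\<forall>i. v $ i \<in> ?F" for v
  proof -
    have "v = (\<Sum>i\<in>UNIV. v $ i *s axis i 1)"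
      by (simp add: vec_eq_iff axis_def if_distrib cong: if_cong)
    also have "\<dots> \<in> M.span ?S"
      using that by (intro M.span_sum M.span_base) blast
    finally show ?thesis .
  qed
  show ?thesis
    using 1 2 unfolding ideal_times_free_module_def ideal_generated_def by blast
qed

section \<open>Coxeter groups and basic invariants\<close>

definition general_linear_group :: "(complex ^ 'n ^ 'n::finite) monoid" where
  "general_linear_group = \<lparr>carrier = {A. invertible A}, monoid.mult = (**), one = mat 1\<rparr>"

text \<open>
  A real form is a real subspace \<open>V\<^sub>R\<close> such that the canonical map from its complexification
  to \<open>complex ^ 'n\<close> is an isomorphism.  The coordinates of \<open>complex ^ 'n\<close>
  are not required to be real on \<open>V\<^sub>R\<close>.
\<close>

definition real_form :: "(complex ^ 'n::finite) set \<Rightarrow> bool" where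
  "real_form V\<^sub>R \<longleftrightarrow>
     subspace V\<^sub>R \<and> (\<forall>v. \<exists>!(a, b). a \<in> V\<^sub>R \<and> b \<in> V\<^sub>R \<and> v = a + \<i> *s b)"

definition reflection :: "complex ^ 'n ^ 'n::finite \<Rightarrow> bool" where
  "reflection s \<longleftrightarrow>
     invertible s \<and> (\<exists>k>0. (((**) s) ^^ k) (mat 1) = mat 1) \<and>
     vec.dim {v. s *v v = v} = CARD('n) - 1 \<and> s \<noteq> mat 1"

definition defined_over :: "(complex ^ 'n::finite) set \<Rightarrow> complex ^ 'n ^ 'n \<Rightarrow> bool" where
  "defined_over V\<^sub>R s \<longleftrightarrow> (\<lambda>v. s *v v) ` V\<^sub>R \<subseteq> V\<^sub>R"

definition coxeter_group ::
  "(complex ^ 'n::finite) set \<Rightarrow> (complex ^ 'n ^ 'n) set \<Rightarrow> bool" where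
  "coxeter_group V\<^sub>R W \<longleftrightarrow>
     finite W \<and>
     (\<exists>S. (\<forall>s\<in>S. reflection s \<and> defined_over V\<^sub>R s) \<and> W = generate general_linear_group S)"

definition irreducible_rep :: "(complex ^ 'n ^ 'n::finite) set \<Rightarrow> bool" where
  "irreducible_rep W \<longleftrightarrow>
     (\<forall>U. vec.subspace U \<and> (\<forall>w\<in>W. \<forall>u\<in>U. w *v u \<in> U) \<longrightarrow> U = {0} \<or> U = UNIV)"

definition invariant_ring :: "(complex ^ 'n ^ 'n::finite) set \<Rightarrow> 'n cpoly set" where
  "invariant_ring W = {q. \<forall>w\<in>W. \<forall>v. cpoly_at q (w *v v) = cpoly_at q v}"

definition algebraically_independent :: "'v set \<Rightarrow> ('v \<Rightarrow> 'n cpoly) \<Rightarrow> bool" where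
  "algebraically_independent I p \<longleftrightarrow>
     (\<forall>q. cpoly_vars q \<subseteq> I \<and> cpoly_subst q p = 0 \<longrightarrow> q = 0)"

definition generated_algebra :: "'v set \<Rightarrow> ('v \<Rightarrow> 'n cpoly) \<Rightarrow> 'n cpoly set" where
  "generated_algebra I p = {cpoly_subst q p | q. cpoly_vars q \<subseteq> I}"

definition basic_invariants ::
  "(complex ^ 'n ^ 'n::finite) set \<Rightarrow> (nat \<Rightarrow> 'n cpoly) \<Rightarrow> bool" where
  "basic_invariants W p \<longleftrightarrow>
     (\<forall>k\<in>{1..CARD('n)}. homogeneous_cpoly (p k)) \<and>
     algebraically_independent {1..CARD('n)} p \<and>
     generated_algebra {1..CARD('n)} p = invariant_ring W"

end

theory Submission
  imports Defs "HOL-Computational_Algebra.Fundamental_Theorem_Algebra"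
begin

text \<open>
  In orthonormal coordinates on the real form, \<open>W\<close> is generated by orthogonal reflections with
  root system \<open>\<Phi>\<close>.  Let \<open>d\<^sub>i = deg p\<^sub>i\<close> and suppose that \<open>d\<^sub>j + d\<^sub>k = d\<^sub>l + 2\<close>.  The Hessian of
  \<open>p\<^sub>k\<close> applied to \<open>\<nabla>p\<^sub>j\<close> is an invariant 1-form of degree \<open>d\<^sub>l - 1\<close>, hence by Solomon's theorem
  equal to \<open>\<Sum>i. g\<^sub>i \<nabla>p\<^sub>i\<close> with invariant coefficients.  If \<open>d\<^sub>l\<close> is the unique highest degree, then
  \<open>g\<^sub>l\<close> is constant and the other \<open>g\<^sub>i\<close> lie in \<open>F\<close>, so it remains to see that \<open>g\<^sub>l \<noteq> 0\<close>.  Contraction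
  with the Euler field shows this at any \<open>z\<close> where only \<open>p\<^sub>l\<close> does not vanish and
  \<open>\<nabla>p\<^sub>j \<cdot> \<nabla>p\<^sub>k\<close> does not vanish either.

  Such a \<open>z\<close> is the regular eigenvector of a Coxeter element in the Coxeter plane, with eigenvalue a
  primitive \<open>m\<close>-th root of unity.  The matrix \<open>(\<nabla>p\<^sub>i \<cdot> \<nabla>p\<^sub>j)(z)\<close> is nonsingular and an entry can
  only be nonzero if \<open>m\<close> divides \<open>d\<^sub>i + d\<^sub>j - 2\<close>; a nonzero term of its determinant therefore
  pairs the degrees with \<open>d\<^sub>i + d\<^sub>j \<ge> m + 2\<close>.  Since the roots of the Jacobian on a generic real line
  are simple and the mirrors can be counted in the plane, \<open>2 \<Sum>i. (d\<^sub>i - 1) \<le> |\<Phi>| \<le> m n\<close>, which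
  forces equality, so that \<open>m\<close> is the highest degree.
\<close>

section \<open>Polynomial functions\<close>

text \<open>The link between the degrees, the roots and m has to come from two estimates that meet:
  mirrors counted along the rays of a plane, and zeros of the Jacobian counted along a line. Their
  meeting is used three times. The nonzero determinant term is a permutation \<pi>, so every j has a
  partner k = \<pi>(j) with d_j + d_k = m + 2. Also 2 \<Sum>(d_i - 1) = |\<Phi>|, so the Jacobian is
  a constant times the product of the positive roots, which Cramer's rule needs for Solomon's
  theorem. And the highest degree is unique: two invariants of degree m would have two partners of
  degree 2, whereas Schur's lemma allows only one. That the degree m occurs at all follows because
  \<nabla>p_j . \<nabla>p_k lies in F and is nonzero at z, so some p_i is nonzero at z; its degree
  is a multiple of m and at most m. The nonvanishing of the Jacobian at points with trivial
  stabilizer rests on invariants with a prescribed gradient, obtained by averaging a polynomial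
  bump. In rank one there is no Coxeter plane; there j = l and the identity matrix serves.\<close>

definition cdot :: "complex ^ 'n \<Rightarrow> complex ^ 'n::finite \<Rightarrow> complex" where
  "cdot x y = (\<Sum>i\<in>UNIV. x $ i * y $ i)"

lemma cdot_add_left: "cdot (x + y) z = cdot x z + cdot y z"
  and cdot_add_right: "cdot z (x + y) = cdot z x + cdot z y"
  and cdot_diff_left: "cdot (x - y) z = cdot x z - cdot y z"
  and cdot_diff_right: "cdot z (x - y) = cdot z x - cdot z y"
  and cdot_scale_left: "cdot (c *s x) z = c * cdot x z"
  and cdot_scale_right: "cdot z (c *s x) = c * cdot z x"
  and cdot_zero_left: "cdot 0 z = 0"
  and cdot_zero_right: "cdot z 0 = 0"
  and cdot_minus_left: "cdot (- x) z = - cdot x z"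
  and cdot_minus_right: "cdot z (- x) = - cdot z x"
  by (simp_all add: cdot_def algebra_simps sum.distrib sum_subtractf sum_distrib_left
      sum_negf)

lemmas cdot_simps = cdot_add_left cdot_add_right cdot_diff_left cdot_diff_right
  cdot_scale_left cdot_scale_right cdot_zero_left cdot_zero_right
  cdot_minus_left cdot_minus_right

lemma cdot_commute: "cdot x y = cdot y x"
  by (simp add: cdot_def mult.commute)

lemma cdot_sum_left: "cdot (\<Sum>k\<in>A. f k) z = (\<Sum>k\<in>A. cdot (f k) z)"
  by (induct A rule: infinite_finite_induct) (simp_all add: cdot_simps)

lemma cdot_axis: "cdot x (axis i 1) = x $ i" "cdot (axis i 1) x = x $ i"
  by (simp_all add: cdot_def axis_def if_distrib[of "\<lambda>c. c * _"] if_distrib[of "\<lambda>c. _ * c"] cong: if_cong)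

lemma cdot_matrix_left: "cdot (A *v x) y = cdot x (transpose A *v y)"
proof -
  have "cdot (A *v x) y = (\<Sum>i\<in>UNIV. \<Sum>j\<in>UNIV. A $ i $ j * x $ j * y $ i)"
    by (simp add: cdot_def matrix_vector_mult_def sum_distrib_right)
  also have "\<dots> = (\<Sum>j\<in>UNIV. \<Sum>i\<in>UNIV. A $ i $ j * x $ j * y $ i)"
    by (rule sum.swap)
  also have "\<dots> = cdot x (transpose A *v y)"
    by (simp add: cdot_def matrix_vector_mult_def transpose_def sum_distrib_left mult_ac)
  finally show ?thesis .
qed

lemma bounded_linear_cdot: "bounded_linear (cdot (x :: complex ^ 'n::finite))"
  by (rule linear_conv_bounded_linear[THEN iffD1])
    (simp add: cdot_def linear_iff algebra_simps sum.distrib scaleR_sum_right)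

text \<open>Polynomials are handled as functions: differentiation and linear changes of coordinates
  are then those of functions, and every closure property is an induction over these four rules.
  Formal polynomials return through \<open>cpoly_at\<close>.\<close>

inductive pfun :: "(complex ^ 'n::finite \<Rightarrow> complex) \<Rightarrow> bool" where
  const: "pfun (\<lambda>x. c)"
| coord: "pfun (\<lambda>x. x $ i)"
| add: "pfun f \<Longrightarrow> pfun g \<Longrightarrow> pfun (\<lambda>x. f x + g x)"
| mult: "pfun f \<Longrightarrow> pfun g \<Longrightarrow> pfun (\<lambda>x. f x * g x)"

lemma pfun_minus: "pfun f \<Longrightarrow> pfun (\<lambda>x. - f x)"
  using pfun.mult[OF pfun.const[of "-1"]] by simp

lemma pfun_diff: "pfun f \<Longrightarrow> pfun g \<Longrightarrow> pfun (\<lambda>x. f x - g x)"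
  using pfun.add[OF _ pfun_minus] by fastforce

lemma pfun_sum: "(\<And>k. k \<in> A \<Longrightarrow> pfun (f k)) \<Longrightarrow> pfun (\<lambda>x. \<Sum>k\<in>A. f k x)"
  by (induct A rule: infinite_finite_induct) (auto intro: pfun.intros)

lemma pfun_prod: "(\<And>k. k \<in> A \<Longrightarrow> pfun (f k)) \<Longrightarrow> pfun (\<lambda>x. \<Prod>k\<in>A. f k x)"
  by (induct A rule: infinite_finite_induct) (auto intro: pfun.intros)

lemma pfun_power: "pfun f \<Longrightarrow> pfun (\<lambda>x. f x ^ k)"
  by (induct k) (auto intro: pfun.intros)

lemma pfun_cdot: "(\<And>i. pfun (\<lambda>x. f x $ i)) \<Longrightarrow> (\<And>i. pfun (\<lambda>x. g x $ i)) \<Longrightarrow>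
    pfun (\<lambda>x. cdot (f x) (g x))"
  unfolding cdot_def by (intro pfun_sum pfun.mult)

lemma pfun_compose:
  assumes "pfun f" and "\<And>i. pfun (\<lambda>x. h x $ i)"
  shows "pfun (\<lambda>x. f (h x))"
  using assms(1) by induct (auto intro: pfun.intros assms(2))

lemma pfun_matrix_vector: "pfun (\<lambda>x. (A *v x) $ i)"
  by (simp add: matrix_vector_mult_def) (intro pfun_sum pfun.intros)

lemma pfun_det:
  assumes "\<And>i j. pfun (\<lambda>x. M x $ i $ j)"
  shows "pfun (\<lambda>x. det (M x :: complex ^ 'n::finite ^ 'n))"
  unfolding det_def by (intro pfun_sum pfun.mult pfun_prod pfun.const assms)

lemmas pfun_intros = pfun.intros pfun_minus pfun_diff pfun_sum pfun_prod pfun_power pfun_cdot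
  pfun_matrix_vector pfun_det

text \<open>\<open>frechet_derivative\<close> is only real linear here. For polynomial functions it
  is complex linear, and \<open>has_derivative_grad\<close> shows that its values on the coordinate
  axes determine it.\<close>

definition grad :: "(complex ^ 'n::finite \<Rightarrow> complex) \<Rightarrow> complex ^ 'n \<Rightarrow> complex ^ 'n" where
  "grad f x = (\<chi> i. frechet_derivative f (at x) (axis i 1))"

lemma grad_eqI: "(f has_derivative cdot g) (at x) \<Longrightarrow> grad f x = g"
  unfolding grad_def by (simp add: vec_eq_iff frechet_derivative_at[symmetric] cdot_axis)

text \<open>The derivative and the polynomiality of its coefficients are proved in one induction;
  \<open>grad_eqI\<close> then transfers both to \<open>grad\<close>.\<close>

lemma pfun_has_gradient:
  assumes "pfun f"
  shows "\<exists>g. (\<forall>i. pfun (\<lambda>x. g x $ i)) \<and> (\<forall>x. (f has_derivative cdot (g x)) (at x))"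
  using assms
proof induct
  case (const c)
  have "(\<lambda>y. 0) = cdot (0 :: complex ^ 'a)" by (simp add: cdot_simps fun_eq_iff)
  then show ?case
    by (intro exI[of _ "\<lambda>_. 0"]) (auto intro: pfun.intros simp flip: \<open>(\<lambda>y. 0) = cdot 0\<close>)
next
  case (coord i)
  have "((\<lambda>x. x $ i) has_derivative cdot (axis i 1)) (at x)" for x :: "complex ^ 'a"
    using bounded_linear_imp_has_derivative[OF bounded_linear_vec_nth, of i "at x"]
    by (simp add: cdot_axis[abs_def])
  then show ?case
    by (intro exI[of _ "\<lambda>_. axis i 1"]) (auto intro: pfun.intros)
next
  case (add f g)
  then obtain f' g' where
    "\<And>i. pfun (\<lambda>x. f' x $ i)" "\<And>x. (f has_derivative cdot (f' x)) (at x)"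
    "\<And>i. pfun (\<lambda>x. g' x $ i)" "\<And>x. (g has_derivative cdot (g' x)) (at x)" by blast
  moreover have "cdot (f' x + g' x) = (\<lambda>v. cdot (f' x) v + cdot (g' x) v)" for x
    by (simp add: cdot_simps fun_eq_iff)
  ultimately show ?case
    by (intro exI[of _ "\<lambda>x. f' x + g' x"]) (auto intro!: pfun.intros has_derivative_add)
next
  case (mult f g)
  then obtain f' g' where *:
    "\<And>i. pfun (\<lambda>x. f' x $ i)" "\<And>x. (f has_derivative cdot (f' x)) (at x)"
    "\<And>i. pfun (\<lambda>x. g' x $ i)" "\<And>x. (g has_derivative cdot (g' x)) (at x)" by blast
  have "cdot (f x *s g' x + g x *s f' x) = (\<lambda>v. f x * cdot (g' x) v + cdot (f' x) v * g x)" for x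
    by (simp add: cdot_simps fun_eq_iff)
  then have "((\<lambda>x. f x * g x) has_derivative cdot (f x *s g' x + g x *s f' x)) (at x)" for x
    using has_derivative_mult[OF *(2)[of x] *(4)[of x]] by simp
  then show ?case
    using * mult by (intro exI[of _ "\<lambda>x. f x *s g' x + g x *s f' x"]) (auto intro!: pfun.intros)
qed

lemma has_derivative_grad: "pfun f \<Longrightarrow> (f has_derivative cdot (grad f x)) (at x)"
  using pfun_has_gradient grad_eqI by metis

lemma pfun_grad: "pfun f \<Longrightarrow> pfun (\<lambda>x. grad f x $ i)"
proof -
  assume "pfun f"
  from pfun_has_gradient[OF this] obtain g where
    g: "\<forall>i. pfun (\<lambda>x. g x $ i)" "\<forall>x. (f has_derivative cdot (g x)) (at x)" by blast
  then have "grad f = g" by (simp add: fun_eq_iff grad_eqI)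
  with g show ?thesis by simp
qed

lemma grad_const: "grad (\<lambda>x. c) x = 0"
  by (rule grad_eqI) (simp add: cdot_simps[abs_def] has_derivative_const)

lemma grad_add: "pfun f \<Longrightarrow> pfun g \<Longrightarrow> grad (\<lambda>x. f x + g x) x = grad f x + grad g x"
proof (rule grad_eqI)
  assume "pfun f" "pfun g"
  have "cdot (grad f x + grad g x) = (\<lambda>v. cdot (grad f x) v + cdot (grad g x) v)"
    by (simp add: cdot_simps fun_eq_iff)
  then show "((\<lambda>x. f x + g x) has_derivative cdot (grad f x + grad g x)) (at x)"
    using has_derivative_add[OF has_derivative_grad has_derivative_grad, OF \<open>pfun f\<close> \<open>pfun g\<close>]
    by simp
qed

lemma grad_mult: "pfun f \<Longrightarrow> pfun g \<Longrightarrow>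
    grad (\<lambda>x. f x * g x) x = f x *s grad g x + g x *s grad f x"
proof (rule grad_eqI)
  assume "pfun f" "pfun g"
  have "cdot (f x *s grad g x + g x *s grad f x) =
      (\<lambda>v. f x * cdot (grad g x) v + cdot (grad f x) v * g x)"
    by (simp add: cdot_simps fun_eq_iff)
  then show "((\<lambda>x. f x * g x) has_derivative cdot (f x *s grad g x + g x *s grad f x)) (at x)"
    using has_derivative_mult[OF has_derivative_grad has_derivative_grad, OF \<open>pfun f\<close> \<open>pfun g\<close>]
    by simp
qed

lemma grad_cmult: "pfun f \<Longrightarrow> grad (\<lambda>x. c * f x) x = c *s grad f x"
  using grad_mult[OF pfun.const] by (simp add: grad_const)

lemma grad_sum: "(\<And>k. k \<in> A \<Longrightarrow> pfun (f k)) \<Longrightarrow>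
    grad (\<lambda>x. \<Sum>k\<in>A. f k x) x = (\<Sum>k\<in>A. grad (f k) x)"
  by (induct A rule: infinite_finite_induct) (simp_all add: grad_const grad_add pfun_sum)

lemma has_field_derivative_pfun_curve:
  assumes "pfun f" and "(c has_derivative (\<lambda>h. h *s v)) (at t)"
  shows "((\<lambda>t. f (c t)) has_field_derivative cdot (grad f (c t)) v) (at t)"
  unfolding has_field_derivative_def
  using has_derivative_compose[OF assms(2) has_derivative_grad[OF assms(1)]]
  by (simp add: cdot_simps mult.commute[of _ "cdot _ _"])

lemma bounded_linear_vector_scalar_mult: "bounded_linear (\<lambda>t. t *s (v :: complex ^ 'n::finite))"
  by (rule linear_conv_bounded_linear[THEN iffD1])
    (simp add: linear_iff vec_eq_iff algebra_simps)

lemma has_field_derivative_pfun_line: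
  "pfun f \<Longrightarrow> ((\<lambda>t. f (x + t *s v)) has_field_derivative cdot (grad f (x + t *s v)) v) (at t)"
  by (rule has_field_derivative_pfun_curve)
    (auto intro!: derivative_eq_intros bounded_linear_imp_has_derivative
      bounded_linear_vector_scalar_mult)

lemma matrix_vector_mult_bounded_linear_complex:
  "bounded_linear (\<lambda>x. A *v (x :: complex ^ 'n::finite) :: complex ^ 'm::finite)"
  by (rule linear_conv_bounded_linear[THEN iffD1])
    (simp add: linear_iff vec_eq_iff matrix_vector_mult_def algebra_simps sum.distrib
      scaleR_sum_right)

lemma grad_compose_linear:
  assumes "pfun f"
  shows "grad (\<lambda>x. f (A *v x)) x = transpose A *v grad f (A *v x)"
proof (rule grad_eqI)
  have "((\<lambda>x. f (A *v x)) has_derivative (\<lambda>v. cdot (grad f (A *v x)) (A *v v))) (at x)"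
    by (rule has_derivative_compose[OF
          bounded_linear_imp_has_derivative[OF matrix_vector_mult_bounded_linear_complex]
          has_derivative_grad[OF assms]])
  moreover have "cdot (grad f (A *v x)) (A *v v) = cdot (transpose A *v grad f (A *v x)) v" for v
    by (metis cdot_matrix_left cdot_commute)
  ultimately show "((\<lambda>x. f (A *v x)) has_derivative
      cdot (transpose A *v grad f (A *v x))) (at x)" by simp
qed

lemma grad_cdot_const: "grad (\<lambda>x. cdot a x) x = a"
  by (rule grad_eqI) (rule bounded_linear_imp_has_derivative[OF bounded_linear_cdot])

section \<open>Restriction to lines and division by linear forms\<close>

lemma pfun_line_poly:
  assumes "pfun f"
  shows "\<exists>P. \<forall>t. f (u + t *s v) = poly P t"
  using assms
proof induct
  case (const c) show ?case by (rule exI[of _ "[:c:]"]) simp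
next
  case (coord i) show ?case by (rule exI[of _ "[:u $ i, v $ i:]"]) simp
next
  case (add f g) then show ?case by (metis poly_add)
next
  case (mult f g) then show ?case by (metis poly_mult)
qed

text \<open>On the line joining \<open>x0\<close> to \<open>x\<close> both functions are univariate
  polynomials, and the first is not the zero polynomial.\<close>

lemma pfun_no_zero_divisors:
  assumes "pfun f" "pfun g" "\<And>x. f x * g x = 0" "f x0 \<noteq> 0"
  shows "g x = 0"
proof -
  obtain P Q where P: "\<And>t. f (x0 + t *s (x - x0)) = poly P t"
    and Q: "\<And>t. g (x0 + t *s (x - x0)) = poly Q t"
    using pfun_line_poly assms(1,2) by metis
  have "poly (P * Q) t = 0" for t using assms(3) P Q by (metis poly_mult)
  then have "P * Q = 0" using poly_all_0_iff_0 by blast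
  moreover have "P \<noteq> 0" using P[of 0] assms(4) by auto
  ultimately have "Q = 0" by simp
  then show ?thesis using Q[of 1] by simp
qed

text \<open>Used with the Jacobian as \<open>k\<close>: identities found where the gradients form a
  basis extend to all points.\<close>

lemma pfun_eqI_off_zeros:
  assumes "pfun f" "pfun g" "pfun k" "k x0 \<noteq> 0" "\<And>x. k x \<noteq> 0 \<Longrightarrow> f x = g x"
  shows "f x = g x"
proof -
  have "f x - g x = 0"
    by (rule pfun_no_zero_divisors[OF assms(3) pfun_diff[OF assms(1,2)] _ assms(4)])
      (use assms(5) in auto)
  then show ?thesis by simp
qed

text \<open>The shift along \<open>a\<close> is proportional to \<open>cdot b x\<close>. If
  \<open>cdot b a = 1\<close> it is the projection onto the hyperplane of \<open>b\<close>, so that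
  divisibility by a linear form can be treated without adapted coordinates.\<close>

lemma pfun_linear_factor:
  assumes "pfun f"
  shows "\<exists>g. pfun g \<and> (\<forall>x. f x - f (x - cdot b x *s a) = cdot b x * g x)"
  using assms
proof induct
  case (const c) show ?case by (rule exI[of _ "\<lambda>_. 0"]) (auto intro: pfun_intros)
next
  case (coord i) show ?case
    by (rule exI[of _ "\<lambda>_. a $ i"]) (auto intro: pfun_intros)
next
  case (add f g)
  then obtain f' g' where *: "pfun f'" "\<And>x. f x - f (x - cdot b x *s a) = cdot b x * f' x"
    "pfun g'" "\<And>x. g x - g (x - cdot b x *s a) = cdot b x * g' x" by blast
  show ?case
  proof (intro exI[of _ "\<lambda>x. f' x + g' x"] conjI allI pfun.add *(1,3))
    show "f x + g x - (f (x - cdot b x *s a) + g (x - cdot b x *s a)) =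
        cdot b x * (f' x + g' x)" for x
      unfolding distrib_left *(2,4)[symmetric] by simp
  qed
next
  case (mult f g)
  then obtain f' g' where *: "pfun f'" "\<And>x. f x - f (x - cdot b x *s a) = cdot b x * f' x"
    "pfun g'" "\<And>x. g x - g (x - cdot b x *s a) = cdot b x * g' x" by blast
  have "f x * g x - f (x - cdot b x *s a) * g (x - cdot b x *s a) =
      cdot b x * (f' x * g x + f (x - cdot b x *s a) * g' x)" for x
  proof -
    have "cdot b x * (f' x * g x + f (x - cdot b x *s a) * g' x) =
        (cdot b x * f' x) * g x + f (x - cdot b x *s a) * (cdot b x * g' x)"
      by (simp only: distrib_left mult_ac)
    then show ?thesis unfolding *(2,4)[symmetric] by (simp add: algebra_simps)
  qed
  moreover have "pfun (\<lambda>x. f (x - cdot b x *s a))"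
    by (rule pfun_compose[OF mult(1)]) (auto intro!: pfun_intros)
  ultimately show ?case
    using * mult by (intro exI[of _ "\<lambda>x. f' x * g x + f (x - cdot b x *s a) * g' x"])
      (auto intro!: pfun_intros)
qed

lemma pfun_hyperplane_factor:
  assumes "pfun f" and "\<And>x. cdot b x = 0 \<Longrightarrow> f x = 0" and "cdot b a = 1"
  shows "\<exists>g. pfun g \<and> (\<forall>x. f x = cdot b x * g x)"
proof -
  obtain g where "pfun g" "\<And>x. f x - f (x - cdot b x *s a) = cdot b x * g x"
    using pfun_linear_factor[OF assms(1)] by metis
  moreover have "f (x - cdot b x *s a) = 0" for x
    by (rule assms(2)) (simp add: cdot_simps assms(3))
  ultimately show ?thesis by force
qed

section \<open>Reflection groups and simple systems\<close>

declare transpose_matrix_vector [simp del]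

lemma matrix_vector_mult_minus_right: "(M :: 'a::ring_1 ^ 'n ^ 'm) *v (- x) = - (M *v x)"
  by (simp add: matrix_vector_mult_def vec_eq_iff sum_negf)

text \<open>An orthogonal reflection only for \<open>norm a = 1\<close>; this is why roots are
  normalised to unit length.\<close>

definition refl :: "real ^ 'n::finite \<Rightarrow> real ^ 'n ^ 'n" where
  "refl a = (\<chi> i j. (if i = j then 1 else 0) - 2 * a $ i * a $ j)"

lemma refl_vector: "refl a *v x = x - (2 * (a \<bullet> x)) *\<^sub>R a"
  by (simp add: refl_def vec_eq_iff matrix_vector_mult_def inner_vec_def left_diff_distrib
      sum_subtractf sum_distrib_left sum_distrib_right if_distrib[of "\<lambda>c. c * _"] cong: if_cong)
    (simp add: mult_ac)

lemma transpose_refl: "transpose (refl a) = refl a"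
  by (simp add: refl_def transpose_def vec_eq_iff mult_ac)

lemma refl_uminus: "refl (- a) = refl a"
  by (simp add: refl_def vec_eq_iff)

lemma refl_refl: "norm a = 1 \<Longrightarrow> refl a ** refl a = mat 1"
proof (rule matrix_eq[THEN iffD2], rule allI)
  fix x assume "norm a = 1"
  then have "a \<bullet> a = 1" by (simp add: norm_eq_1)
  then show "(refl a ** refl a) *v x = mat 1 *v x"
    by (simp add: matrix_vector_mul_assoc[symmetric] refl_vector inner_diff_right vec_eq_iff
        algebra_simps)
qed

lemma orthogonal_matrix_refl: "norm a = 1 \<Longrightarrow> orthogonal_matrix (refl a)"
  by (simp add: orthogonal_matrix_def transpose_refl refl_refl)

lemma inner_matrix_transpose: "((M :: real ^ 'n ^ 'm) *v x) \<bullet> y = x \<bullet> (transpose M *v y)"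
  by (metis dot_lmul_matrix inner_commute transpose_matrix_vector)

lemma orthogonal_matrix_inner:
  "orthogonal_matrix (w :: real ^ 'n ^ 'n) \<Longrightarrow> (w *v x) \<bullet> (w *v y) = x \<bullet> y"
  by (simp add: inner_matrix_transpose matrix_vector_mul_assoc orthogonal_matrix_def)

lemma refl_conjugate:
  assumes "orthogonal_matrix w"
  shows "refl (w *v a) = w ** refl a ** transpose w"
proof (rule matrix_eq[THEN iffD2], rule allI)
  fix x
  have *: "w *v (transpose w *v x) = x" "(w *v a) \<bullet> x = a \<bullet> (transpose w *v x)"
    using assms orthogonal_matrix_inner[OF assms, of a "transpose w *v x"]
    by (simp_all add: orthogonal_matrix_def matrix_vector_mul_assoc)
  show "refl (w *v a) *v x = (w ** refl a ** transpose w) *v x"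
    by (simp add: matrix_vector_mul_assoc[symmetric] refl_vector * matrix_vector_mult_diff_distrib
        matrix_vector_mult_scaleR)
qed

text \<open>Reflections are involutions, so the monoid that they generate is a group; building words
  from the left leaves a single induction step.\<close>

inductive_set refl_prods :: "(real ^ 'n::finite) set \<Rightarrow> (real ^ 'n ^ 'n) set" for A where
  one: "mat 1 \<in> refl_prods A"
| step: "a \<in> A \<Longrightarrow> w \<in> refl_prods A \<Longrightarrow> refl a ** w \<in> refl_prods A"

lemma refl_prods_refl: "a \<in> A \<Longrightarrow> refl a \<in> refl_prods A"
  using refl_prods.step[OF _ refl_prods.one] by fastforce

lemma refl_prods_mult: "v \<in> refl_prods A \<Longrightarrow> w \<in> refl_prods A \<Longrightarrow> v ** w \<in> refl_prods A"
  by (induct rule: refl_prods.induct)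
    (auto simp: matrix_mul_assoc[symmetric] intro: refl_prods.step)

lemma refl_prods_transpose: "w \<in> refl_prods A \<Longrightarrow> transpose w \<in> refl_prods A"
  by (induct rule: refl_prods.induct)
    (auto simp: matrix_transpose_mul transpose_refl transpose_mat
      intro: refl_prods.one refl_prods_mult refl_prods_refl)

lemma exists_nonorthogonal:
  fixes V :: "'a::real_inner set"
  assumes "finite V" "0 \<notin> V"
  shows "\<exists>x. \<forall>v\<in>V. v \<bullet> x \<noteq> 0"
  using assms
proof induct
  case empty then show ?case by simp
next
  case (insert v V)
  then obtain x where x: "\<forall>u\<in>V. u \<bullet> x \<noteq> 0" by auto
  \<comment> \<open>Moving \<open>x\<close> along \<open>v\<close> spoils the condition for
    \<open>u\<close> at one value of \<open>t\<close> if \<open>u\<close> and \<open>v\<close> are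
    not orthogonal, and never otherwise.\<close>
  have "finite (insert (- (v \<bullet> x) / (v \<bullet> v)) ((\<lambda>u. - (u \<bullet> x) / (u \<bullet> v)) ` V))"
    using insert by simp
  then obtain t where t: "t \<notin> insert (- (v \<bullet> x) / (v \<bullet> v)) ((\<lambda>u. - (u \<bullet> x) / (u \<bullet> v)) ` V)"
    using ex_new_if_finite infinite_UNIV_char_0 by blast
  have "u \<bullet> (x + t *\<^sub>R v) \<noteq> 0" if "u \<in> insert v V" for u
  proof
    assume 0: "u \<bullet> (x + t *\<^sub>R v) = 0"
    show False
    proof (cases "u \<bullet> v = 0")
      case True
      then have "u \<noteq> v" using insert by auto
      then show False using 0 True x that by (simp add: inner_add_right)
    next
      case False
      then have "t = - (u \<bullet> x) / (u \<bullet> v)"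
        using 0 by (simp add: inner_add_right field_simps add_eq_0_iff)
      then show False using t that by auto
    qed
  qed
  then show ?case by blast
qed

text \<open>\<open>A\<close> consists of unit normals of generating reflections. The bound on the
  rank makes the simple roots split into two nonempty classes, which the Coxeter plane
  requires.\<close>

locale reflection_group =
  fixes A :: "(real ^ 'n::finite) set"
  assumes norm_A: "a \<in> A \<Longrightarrow> norm a = 1"
    and finite_W: "finite (refl_prods A)"
    and irreducible:
      "subspace U \<Longrightarrow> (\<And>a u. a \<in> A \<Longrightarrow> u \<in> U \<Longrightarrow> refl a *v u \<in> U) \<Longrightarrow> U = {0} \<or> U = UNIV"
    and dim_ge_2: "CARD('n) \<ge> 2"
begin

abbreviation "W \<equiv> refl_prods A"

text \<open>Both unit normals of every mirror belong to \<open>\<Phi>\<close>, so its cardinality is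
  twice the number of mirrors.\<close>

definition "\<Phi> = {a. norm a = 1 \<and> refl a \<in> W}"

lemma orthogonal_W: "w \<in> W \<Longrightarrow> orthogonal_matrix w"
  by (induct rule: refl_prods.induct)
    (auto simp: orthogonal_matrix_id intro: orthogonal_matrix_mul orthogonal_matrix_refl norm_A)

lemma W_inner: "w \<in> W \<Longrightarrow> (w *v x) \<bullet> (w *v y) = x \<bullet> y"
  by (rule orthogonal_matrix_inner[OF orthogonal_W])

lemma W_transpose: "w \<in> W \<Longrightarrow> transpose w ** w = mat 1" "w \<in> W \<Longrightarrow> w ** transpose w = mat 1"
  using orthogonal_W by (simp_all add: orthogonal_matrix_def)

lemma root_norm: "a \<in> \<Phi> \<Longrightarrow> norm a = 1" and root_inner: "a \<in> \<Phi> \<Longrightarrow> a \<bullet> a = 1"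
  and root_refl: "a \<in> \<Phi> \<Longrightarrow> refl a \<in> W" and root_nonzero: "a \<in> \<Phi> \<Longrightarrow> a \<noteq> 0"
  by (auto simp: \<Phi>_def norm_eq_1)

lemma A_roots: "A \<subseteq> \<Phi>"
  by (auto simp: \<Phi>_def norm_A intro: refl_prods_refl)

lemma root_uminus: "a \<in> \<Phi> \<Longrightarrow> - a \<in> \<Phi>"
  by (simp add: \<Phi>_def refl_uminus)

lemma W_root: "w \<in> W \<Longrightarrow> a \<in> \<Phi> \<Longrightarrow> w *v a \<in> \<Phi>"
  using W_inner[of w a a]
  by (auto simp: \<Phi>_def norm_eq_1 refl_conjugate orthogonal_W
      intro!: refl_prods_mult refl_prods_transpose)

lemma refl_root: "a \<in> \<Phi> \<Longrightarrow> b \<in> \<Phi> \<Longrightarrow> b - (2 * (a \<bullet> b)) *\<^sub>R a \<in> \<Phi>"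
  using W_root[OF root_refl] by (simp add: refl_vector)

lemma roots_parallel:
  assumes "a \<in> \<Phi>" "b \<in> \<Phi>" "b = c *\<^sub>R a"
  shows "b = a \<or> b = - a"
proof -
  have "\<bar>c\<bar> = 1" using root_norm assms by (metis mult.right_neutral norm_scaleR)
  then show ?thesis using assms(3) by (auto simp: abs_if split: if_splits)
qed

lemma refl_eq_imp_roots:
  assumes "a \<in> \<Phi>" "b \<in> \<Phi>" "refl a = refl b"
  shows "b = a \<or> b = - a"
proof -
  have *: "b - (2 * (a \<bullet> b)) *\<^sub>R a = - b"
    using refl_vector[of a b] refl_vector[of b b] assms by (simp add: root_inner scaleR_2)
  have "b $ i = ((a \<bullet> b) *\<^sub>R a) $ i" for i
    using arg_cong[OF *, of "\<lambda>v. v $ i"] by simp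
  then have "b = (a \<bullet> b) *\<^sub>R a" by (simp add: vec_eq_iff)
  then show ?thesis using roots_parallel assms by blast
qed

lemma finite_roots: "finite \<Phi>"
proof -
  have "finite (\<Phi> \<inter> refl -` {w})" for w
  proof (cases "\<exists>a. a \<in> \<Phi> \<inter> refl -` {w}")
    case True
    then obtain a where "a \<in> \<Phi> \<inter> refl -` {w}" by blast
    then have "\<Phi> \<inter> refl -` {w} \<subseteq> {a, - a}" using refl_eq_imp_roots by fastforce
    then show ?thesis using finite_subset by blast
  qed (metis ex_in_conv finite.emptyI)
  moreover have "\<Phi> \<subseteq> (\<Union>w\<in>W. \<Phi> \<inter> refl -` {w})" using root_refl by auto
  ultimately show ?thesis using finite_W by (meson finite_UN finite_subset)
qed

lemma span_roots: "span \<Phi> = UNIV"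
proof -
  have "span A = {0} \<or> span A = UNIV"
  proof (rule irreducible)
    fix a u assume "a \<in> A" "u \<in> span A"
    then show "refl a *v u \<in> span A"
      by (simp add: refl_vector span_diff span_scale span_base)
  qed (rule subspace_span)
  moreover have "span A \<noteq> {0}"
  proof
    assume *: "span A = {0}"
    have "A = {}"
    proof (rule equals0I)
      fix a assume a: "a \<in> A"
      from span_base[OF a] have "a = 0" unfolding * by simp
      then show False using norm_A[OF a] by simp
    qed
    \<comment> \<open>Without generators every line is invariant, against irreducibility in
      dimension at least 2.\<close>
    define v :: "real ^ 'n" where "v = axis undefined 1"
    have "v \<noteq> 0" by (simp add: v_def axis_eq_0_iff)
    then have "span {v} \<noteq> {0}" using span_base[of v "{v}"] by auto
    moreover have "span {v} = {0} \<or> span {v} = UNIV"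
      by (rule irreducible) (simp_all add: \<open>A = {}\<close>)
    ultimately have "span {v} = UNIV" by blast
    then have "dim (UNIV :: (real ^ 'n) set) \<le> card {v}"
      by (metis dim_span dim_le_card' finite.emptyI finite.insertI)
    then show False using dim_ge_2 by simp
  qed
  ultimately have "span A = UNIV" by blast
  then show ?thesis using A_roots span_mono by blast
qed

definition "regular x \<longleftrightarrow> (\<forall>a\<in>\<Phi>. a \<bullet> x \<noteq> 0)"

definition "Pos x = {a \<in> \<Phi>. a \<bullet> x > 0}"

lemma exists_regular: "\<exists>x. regular x"
  using exists_nonorthogonal[OF finite_roots] root_nonzero unfolding regular_def by blast

lemma finite_Pos: "finite (Pos x)"
  using finite_roots by (simp add: Pos_def)

lemma root_Pos_cases: "regular x \<Longrightarrow> a \<in> \<Phi> \<Longrightarrow> a \<in> Pos x \<or> - a \<in> Pos x"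
  by (auto simp: Pos_def regular_def root_uminus neq_iff)

end

text \<open>The cone condition and obtuseness are what minimality of a generating set of the
  positive roots yields directly; linear independence of \<open>D\<close> follows from them in
  \<open>D_independent\<close>.\<close>

locale simple_system = reflection_group A for A :: "(real ^ 'n::finite) set" +
  fixes x0 :: "real ^ 'n" and D :: "(real ^ 'n) set"
  assumes regular_x0: "regular x0"
    and D_Pos: "D \<subseteq> Pos x0"
    and Pos_cone: "b \<in> Pos x0 \<Longrightarrow> \<exists>c. (\<forall>d\<in>D. c d \<ge> 0) \<and> b = (\<Sum>d\<in>D. c d *\<^sub>R d)"
    and obtuse: "a \<in> D \<Longrightarrow> b \<in> D \<Longrightarrow> a \<noteq> b \<Longrightarrow> a \<bullet> b \<le> 0"

context reflection_group begin

text \<open>Take a set of positive roots of least cardinality whose nonnegative combinations contain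
  all positive roots. An acute pair would make one of its members expressible by the others.\<close>

lemma exists_simple_system:
  assumes "regular x0"
  shows "\<exists>D. simple_system A x0 D"
proof -
  define C where "C D \<longleftrightarrow> D \<subseteq> Pos x0 \<and>
    (\<forall>b\<in>Pos x0. \<exists>c. (\<forall>d\<in>D. c d \<ge> 0) \<and> b = (\<Sum>d\<in>D. c d *\<^sub>R d))" for D
  have "C (Pos x0)"
    unfolding C_def
  proof (intro conjI ballI)
    fix b assume "b \<in> Pos x0"
    then have "b = (\<Sum>d\<in>Pos x0. (if d = b then 1 else 0) *\<^sub>R d)"
      by (simp add: if_distrib[of "\<lambda>c. c *\<^sub>R _"] finite_Pos cong: if_cong)
    then show "\<exists>c. (\<forall>d\<in>Pos x0. c d \<ge> 0) \<and> b = (\<Sum>d\<in>Pos x0. c d *\<^sub>R d)"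
      by (intro exI[of _ "\<lambda>d. if d = b then 1 else 0"]) auto
  qed simp
  then obtain D where D: "C D" "\<And>D'. C D' \<Longrightarrow> card D \<le> card D'"
    using ex_has_least_nat[of C _ card] by blast
  have finD: "finite D" using D finite_Pos finite_subset unfolding C_def by blast
  have posD: "d \<bullet> x0 > 0" if "d \<in> D" for d using that D unfolding C_def Pos_def by blast
  have redundant: False if d: "d \<in> D" and r: "r *\<^sub>R d = (\<Sum>e\<in>D. c e *\<^sub>R e)"
    and c: "\<And>e. e \<in> D \<Longrightarrow> c e \<ge> 0" and e: "e \<in> D" "e \<noteq> d" "c e > 0" for d r c e
  proof -
    have s: "(r - c d) *\<^sub>R d = (\<Sum>e\<in>D - {d}. c e *\<^sub>R e)"
      using r sum.remove[OF finD d, of "\<lambda>e. c e *\<^sub>R e"] by (simp add: algebra_simps)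
    have "0 < (\<Sum>e\<in>D - {d}. c e * (e \<bullet> x0))"
      using finD c e posD by (intro sum_pos2[of _ e]) (auto intro: mult_nonneg_nonneg less_imp_le)
    also have "\<dots> = (r - c d) * (d \<bullet> x0)"
      using arg_cong[OF s, of "\<lambda>v. v \<bullet> x0"] by (simp add: inner_sum_left)
    finally have rc: "r - c d > 0" using posD[OF d] by (simp add: zero_less_mult_iff)
    define k where "k = (\<lambda>e. c e / (r - c d))"
    have k: "d = (\<Sum>e\<in>D - {d}. k e *\<^sub>R e)"
    proof -
      have "d = (1 / (r - c d)) *\<^sub>R (r - c d) *\<^sub>R d" using rc by simp
      also have "\<dots> = (\<Sum>e\<in>D - {d}. k e *\<^sub>R e)" unfolding s k_def scaleR_sum_right by simp
      finally show ?thesis .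
    qed
    have "C (D - {d})"
      unfolding C_def
    proof (intro conjI ballI)
      show "D - {d} \<subseteq> Pos x0" using D unfolding C_def by blast
      fix b assume "b \<in> Pos x0"
      then obtain c' where c': "\<forall>d\<in>D. c' d \<ge> 0" "b = (\<Sum>d\<in>D. c' d *\<^sub>R d)"
        using D unfolding C_def by blast
      have "b = c' d *\<^sub>R (\<Sum>e\<in>D - {d}. k e *\<^sub>R e) + (\<Sum>e\<in>D - {d}. c' e *\<^sub>R e)"
        using c'(2) sum.remove[OF finD d, of "\<lambda>e. c' e *\<^sub>R e"] k by simp
      also have "\<dots> = (\<Sum>e\<in>D - {d}. (c' d * k e + c' e) *\<^sub>R e)"
        by (simp add: scaleR_sum_right scaleR_add_left sum.distrib)
      finally show "\<exists>c. (\<forall>d\<in>D - {d}. c d \<ge> 0) \<and> b = (\<Sum>d\<in>D - {d}. c d *\<^sub>R d)"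
        using c'(1) c rc d unfolding k_def
        by (intro exI[of _ "\<lambda>e. c' d * k e + c' e"]) (auto simp: k_def)
    qed
    from D(2)[OF this] show False using card_Diff1_less[OF finD d] by simp
  qed
  have "a \<bullet> b \<le> 0" if ab: "a \<in> D" "b \<in> D" "a \<noteq> b" for a b
  proof (rule ccontr)
    assume "\<not> a \<bullet> b \<le> 0"
    then have pos: "a \<bullet> b > 0" by simp
    have roots: "a \<in> \<Phi>" "b \<in> \<Phi>" using ab D unfolding C_def Pos_def by auto
    have pick: "(\<Sum>e\<in>D. (c e + (if e = d then q else 0)) *\<^sub>R e) = (\<Sum>e\<in>D. c e *\<^sub>R e) + q *\<^sub>R d"
      if "d \<in> D" for c d q
      using that finD by (simp add: scaleR_add_left sum.distrib if_distrib[of "\<lambda>c. c *\<^sub>R _"] cong: if_cong)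
    let ?g = "b - (2 * (a \<bullet> b)) *\<^sub>R a"
    \<comment> \<open>A positive \<open>?g\<close> gives \<open>b\<close> as a combination that
      involves \<open>a\<close>; a positive \<open>- ?g\<close> gives a multiple of \<open>a\<close>
      as one that involves \<open>b\<close>.\<close>
    from root_Pos_cases[OF assms refl_root[OF roots]] show False
    proof
      assume "?g \<in> Pos x0"
      then obtain c where c: "\<forall>d\<in>D. c d \<ge> 0" "?g = (\<Sum>d\<in>D. c d *\<^sub>R d)"
        using D unfolding C_def by blast
      have "1 *\<^sub>R b = (\<Sum>e\<in>D. (c e + (if e = a then 2 * (a \<bullet> b) else 0)) *\<^sub>R e)"
        using pick[OF ab(1)] c(2) by (simp add: algebra_simps)
      from redundant[OF ab(2) this _ ab(1) ab(3)] show False using c(1) pos ab(1) by auto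
    next
      assume "- ?g \<in> Pos x0"
      then obtain c where c: "\<forall>d\<in>D. c d \<ge> 0" "- ?g = (\<Sum>d\<in>D. c d *\<^sub>R d)"
        using D unfolding C_def by blast
      have "(2 * (a \<bullet> b)) *\<^sub>R a = (\<Sum>e\<in>D. (c e + (if e = b then 1 else 0)) *\<^sub>R e)"
        using pick[OF ab(2)] c(2)[symmetric] by (simp add: algebra_simps)
      from redundant[OF ab(1) this _ ab(2) ab(3)[symmetric]] show False using c(1) ab(2) by auto
    qed
  qed
  then have "simple_system A x0 D"
    using assms D(1) unfolding C_def by unfold_locales blast+
  then show ?thesis ..
qed

end

section \<open>Simple roots: independence, positivity, generation of the group\<close>

context simple_system begin

lemma finite_D: "finite D"
  using D_Pos finite_Pos finite_subset by blast

lemma D_roots: "d \<in> D \<Longrightarrow> d \<in> \<Phi>" and D_pos: "d \<in> D \<Longrightarrow> d \<bullet> x0 > 0"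
  using D_Pos by (auto simp: Pos_def)

text \<open>Separate the positive from the negative coefficients: both parts equal the same vector
  \<open>v\<close>, obtuseness gives \<open>v \<bullet> v \<le> 0\<close>, and pairing
  \<open>v = 0\<close> with \<open>x0\<close> kills every coefficient.\<close>

lemma D_independent:
  assumes "(\<Sum>d\<in>D. c d *\<^sub>R d) = 0" "d \<in> D"
  shows "c d = 0"
proof -
  define v where "v = (\<Sum>d\<in>D. max (c d) 0 *\<^sub>R d)"
  have split: "max r 0 - max (- r) 0 = r" for r :: real by (auto simp: max_def)
  have "v - (\<Sum>d\<in>D. max (- c d) 0 *\<^sub>R d) = (\<Sum>d\<in>D. c d *\<^sub>R d)"
    unfolding v_def sum_subtractf[symmetric] scaleR_diff_left[symmetric] split ..
  then have v': "v = (\<Sum>d\<in>D. max (- c d) 0 *\<^sub>R d)" using assms(1) by simp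
  have "v \<bullet> v = (\<Sum>d\<in>D. \<Sum>e\<in>D. max (- c d) 0 * (max (c e) 0 * (e \<bullet> d)))"
    by (subst (2) v') (simp add: v_def inner_sum_left inner_sum_right sum_distrib_left)
  also have "\<dots> \<le> 0"
  proof (intro sum_nonpos)
    fix d e assume "d \<in> D" "e \<in> D"
    show "max (- c d) 0 * (max (c e) 0 * (e \<bullet> d)) \<le> 0"
    proof (cases "e = d")
      case False
      then have "e \<bullet> d \<le> 0" using obtuse \<open>d \<in> D\<close> \<open>e \<in> D\<close> by blast
      then show ?thesis by (simp add: mult_nonneg_nonpos)
    qed (auto simp: max_def)
  qed
  finally have "v = 0" by (metis inner_ge_zero inner_eq_zero_iff antisym)
  have zero: "k d = 0" if "(\<Sum>d\<in>D. k d *\<^sub>R d) = 0" "\<And>d. k d \<ge> 0" for k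
  proof -
    have "(\<Sum>d\<in>D. k d * (d \<bullet> x0)) = 0"
      using arg_cong[OF that(1), of "\<lambda>v. v \<bullet> x0"] by (simp add: inner_sum_left)
    then have "k d * (d \<bullet> x0) = 0"
      using finite_D assms(2) D_pos that(2)
      by (subst (asm) sum_nonneg_eq_0_iff) (auto intro: mult_nonneg_nonneg less_imp_le)
    then show ?thesis using D_pos[OF assms(2)] by simp
  qed
  have "max (c d) 0 = 0" "max (- c d) 0 = 0"
    using zero[of "\<lambda>d. max (c d) 0"] zero[of "\<lambda>d. max (- c d) 0"] \<open>v = 0\<close> v' v_def by auto
  then show ?thesis by (auto simp: max_def split: if_splits)
qed

lemma D_coeff_unique:
  assumes "(\<Sum>d\<in>D. c d *\<^sub>R d) = (\<Sum>d\<in>D. c' d *\<^sub>R d)" "d \<in> D"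
  shows "c d = c' d"
  using D_independent[of "\<lambda>d. c d - c' d"] assms
  by (simp add: scaleR_diff_left sum_subtractf)

text \<open>The nonnegative expansion of the root or of its negative is the only expansion.\<close>

lemma D_mixed_signs:
  assumes "(\<Sum>d\<in>D. c d *\<^sub>R d) \<in> \<Phi>" "d \<in> D" "c d > 0" "e \<in> D"
  shows "c e \<ge> 0"
  using root_Pos_cases[OF regular_x0 assms(1)]
proof
  assume "(\<Sum>d\<in>D. c d *\<^sub>R d) \<in> Pos x0"
  from Pos_cone[OF this] obtain c' where c': "\<forall>d\<in>D. c' d \<ge> 0"
    "(\<Sum>d\<in>D. c d *\<^sub>R d) = (\<Sum>d\<in>D. c' d *\<^sub>R d)" by blast
  then show ?thesis using D_coeff_unique[OF c'(2) assms(4)] assms(4) by simp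
next
  assume "- (\<Sum>d\<in>D. c d *\<^sub>R d) \<in> Pos x0"
  from Pos_cone[OF this] obtain c' where c': "\<forall>d\<in>D. c' d \<ge> 0"
    "- (\<Sum>d\<in>D. c d *\<^sub>R d) = (\<Sum>d\<in>D. c' d *\<^sub>R d)" by blast
  then have "- c d = c' d"
    using D_coeff_unique[of "\<lambda>d. - c d" c' d] assms(2) by (simp add: sum_negf)
  then show ?thesis using c' assms by auto
qed

lemma cone_root_Pos:
  assumes "(\<Sum>d\<in>D. c d *\<^sub>R d) \<in> \<Phi>" "d \<in> D" "c d > 0"
  shows "(\<Sum>d\<in>D. c d *\<^sub>R d) \<in> Pos x0"
proof -
  have "0 < (\<Sum>d\<in>D. c d * (d \<bullet> x0))"
    using D_mixed_signs[OF assms] D_pos assms finite_D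
    by (intro sum_pos2[of _ d]) (auto intro: mult_nonneg_nonneg less_imp_le)
  then show ?thesis using assms(1) by (simp add: Pos_def inner_sum_left)
qed

lemma sum_D_update:
  "d \<in> D \<Longrightarrow> (\<Sum>e\<in>D. (c e + (if e = d then q else 0)) *\<^sub>R e) = (\<Sum>e\<in>D. c e *\<^sub>R e) + q *\<^sub>R d"
  using finite_D by (simp add: scaleR_add_left sum.distrib if_distrib[of "\<lambda>c. c *\<^sub>R _"] cong: if_cong)

text \<open>Only the coordinate at \<open>d\<close> changes, and a positive root other than
  \<open>d\<close> has a further positive coordinate, whose sign decides.\<close>

lemma simple_refl_Pos:
  assumes "d \<in> D" "b \<in> Pos x0" "b \<noteq> d"
  shows "refl d *v b \<in> Pos x0"
proof -
  from Pos_cone[OF assms(2)] obtain c where c: "\<forall>d\<in>D. c d \<ge> 0" "b = (\<Sum>d\<in>D. c d *\<^sub>R d)"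
    by blast
  have b: "b \<in> \<Phi>" using assms(2) by (simp add: Pos_def)
  have "\<exists>e\<in>D. e \<noteq> d \<and> c e > 0"
  proof (rule ccontr)
    assume "\<not> ?thesis"
    then have "c e = 0" if "e \<in> D - {d}" for e using that c(1) by (force simp: not_less intro: antisym)
    then have *: "b = c d *\<^sub>R d" using c(2) sum.remove[OF finite_D assms(1), of "\<lambda>e. c e *\<^sub>R e"] by simp
    from roots_parallel[OF D_roots[OF assms(1)] b this] assms(3) have "b = - d" by blast
    then show False using assms(2) D_pos[OF assms(1)] by (simp add: Pos_def)
  qed
  then obtain e where e: "e \<in> D" "e \<noteq> d" "c e > 0" by blast
  define q where "q = - 2 * (d \<bullet> b)"
  have *: "refl d *v b = (\<Sum>e\<in>D. (c e + (if e = d then q else 0)) *\<^sub>R e)"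
    unfolding sum_D_update[OF assms(1)] c(2)[symmetric] by (simp add: refl_vector q_def)
  show ?thesis
    unfolding *
    by (rule cone_root_Pos[OF _ e(1)])
      (use e W_root[OF root_refl[OF D_roots[OF assms(1)]] b] in \<open>auto simp flip: *\<close>)
qed

lemma refl_prods_D_subset: "refl_prods D \<subseteq> W"
proof
  show "w \<in> W" if "w \<in> refl_prods D" for w
    using that by induct (auto intro: refl_prods.one refl_prods_mult root_refl D_roots)
qed

text \<open>Among the positive roots of the orbit take \<open>g\<close> of least
  \<open>g \<bullet> x0\<close>. Since \<open>g \<bullet> g > 0\<close>, some simple
  \<open>d\<close> has \<open>d \<bullet> g > 0\<close>; reflecting in \<open>d\<close> would lower
  the height unless \<open>g = d\<close>.\<close>

lemma Pos_conjugate_simple: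
  assumes "b \<in> Pos x0"
  shows "\<exists>w\<in>refl_prods D. \<exists>d\<in>D. b = w *v d"
proof -
  let ?O = "{w *v b | w. w \<in> refl_prods D} \<inter> Pos x0"
  have "mat 1 *v b \<in> {w *v b | w. w \<in> refl_prods D}" using refl_prods.one by blast
  then have fin: "finite ((\<lambda>g. g \<bullet> x0) ` ?O)" "(\<lambda>g. g \<bullet> x0) ` ?O \<noteq> {}"
    using finite_Pos assms by auto
  from Min_in[OF this] obtain g where g: "g \<in> ?O" "g \<bullet> x0 = Min ((\<lambda>g. g \<bullet> x0) ` ?O)"
    by (metis (no_types, lifting) imageE)
  have g_min: "g \<bullet> x0 \<le> g' \<bullet> x0" if "g' \<in> ?O" for g'
    unfolding g(2) using that fin by (intro Min_le) auto
  from g(1) obtain w where w: "w \<in> refl_prods D" "g = w *v b" by blast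
  have gP: "g \<in> Pos x0" using g by blast
  from Pos_cone[OF this] obtain c where c: "\<forall>d\<in>D. c d \<ge> 0" "g = (\<Sum>d\<in>D. c d *\<^sub>R d)" by blast
  have "g \<bullet> g = (\<Sum>d\<in>D. c d * (d \<bullet> g))" by (subst c(2)) (simp add: inner_sum_left)
  moreover have "g \<bullet> g = 1" using gP root_inner by (simp add: Pos_def)
  moreover have "(\<Sum>d\<in>D. c d * (d \<bullet> g)) \<le> 0" if "\<not> (\<exists>d\<in>D. c d * (d \<bullet> g) > 0)"
    using that by (intro sum_nonpos) (simp add: not_less)
  ultimately have "\<exists>d\<in>D. c d * (d \<bullet> g) > 0" by fastforce
  then obtain d where d: "d \<in> D" "d \<bullet> g > 0" using c(1) by (auto simp: zero_less_mult_iff)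
  have "g = d"
  proof (rule ccontr)
    assume "g \<noteq> d"
    then have "refl d *v g \<in> Pos x0" by (rule simple_refl_Pos[OF d(1) gP])
    moreover have "refl d *v g = (refl d ** w) *v b" by (simp add: w matrix_vector_mul_assoc)
    ultimately have "refl d *v g \<in> ?O" using refl_prods.step[OF d(1) w(1)] by auto
    from g_min[OF this] show False
      using d(2) D_pos[OF d(1)] by (simp add: refl_vector inner_diff_left mult_le_0_iff)
  qed
  then have "b = transpose w *v d"
    using w W_transpose(1)[of w] refl_prods_D_subset by (auto simp: matrix_vector_mul_assoc)
  then show ?thesis using refl_prods_transpose[OF w(1)] d(1) by blast
qed

lemma root_conjugate_simple:
  assumes "b \<in> \<Phi>"
  shows "\<exists>w\<in>refl_prods D. \<exists>d\<in>D. b = w *v d"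
  using root_Pos_cases[OF regular_x0 assms]
proof
  assume "- b \<in> Pos x0"
  then obtain w d where w: "w \<in> refl_prods D" "d \<in> D" "- b = w *v d"
    using Pos_conjugate_simple by blast
  have "refl d *v d = - d" using root_inner[OF D_roots[OF w(2)]] by (simp add: refl_vector scaleR_2)
  then have "b = (w ** refl d) *v d"
    by (simp add: matrix_vector_mul_assoc[symmetric] matrix_vector_mult_minus_right flip: w(3))
  then show ?thesis using refl_prods_mult[OF w(1) refl_prods_refl[OF w(2)]] w(2) by blast
qed (rule Pos_conjugate_simple)

lemma refl_prods_D: "refl_prods D = W"
proof
  show "W \<subseteq> refl_prods D"
  proof
    show "w \<in> refl_prods D" if "w \<in> W" for w
      using that
    proof induct
      case (step a w)
      obtain v d where v: "v \<in> refl_prods D" "d \<in> D" "a = v *v d"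
        using root_conjugate_simple step(1) A_roots by blast
      then have "refl a = v ** refl d ** transpose v"
        using refl_prods_D_subset by (auto intro: refl_conjugate orthogonal_W)
      then have "refl a \<in> refl_prods D"
        using refl_prods_mult[OF refl_prods_mult[OF v(1) refl_prods_refl[OF v(2)]]
            refl_prods_transpose[OF v(1)]] by simp
      then show ?case using step(3) by (rule refl_prods_mult)
    qed (rule refl_prods.one)
  qed
qed (rule refl_prods_D_subset)

section \<open>Words in the simple reflections\<close>

primrec word :: "(real ^ 'n) list \<Rightarrow> real ^ 'n ^ 'n" where
  "word [] = mat 1"
| "word (d # ds) = refl d ** word ds"

lemma word_in_W: "set ds \<subseteq> D \<Longrightarrow> word ds \<in> W"
  by (induct ds) (auto intro: refl_prods.one refl_prods_mult root_refl D_roots)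

lemma W_word: "w \<in> W \<Longrightarrow> \<exists>ds. set ds \<subseteq> D \<and> w = word ds"
  unfolding refl_prods_D[symmetric]
proof (induct rule: refl_prods.induct)
  case one show ?case by (rule exI[of _ "[]"]) simp
next
  case (step a w)
  then obtain ds where "set ds \<subseteq> D \<and> w = word ds" by blast
  then show ?case using step(1) by (intro exI[of _ "a # ds"]) simp
qed

text \<open>Exchange condition. Some letter \<open>e\<close> takes the image of \<open>d\<close> out
  of the positive roots; by \<open>simple_refl_Pos\<close> the image before this letter was
  \<open>e\<close> itself, so the letter cancels against \<open>refl d\<close>.\<close>

lemma word_exchange:
  assumes "set ds \<subseteq> D" "d \<in> D" "word ds *v d \<notin> Pos x0"
  shows "\<exists>es. set es \<subseteq> D \<and> length es < length ds \<and> word ds ** refl d = word es"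
  using assms(1,3)
proof (induct ds)
  case Nil then show ?case using assms(2) D_Pos by auto
next
  case (Cons e es)
  show ?case
  proof (cases "word es *v d \<in> Pos x0")
    case True
    have "word (e # es) *v d = refl e *v (word es *v d)"
      by (simp add: matrix_vector_mul_assoc)
    then have e: "word es *v d = e" using simple_refl_Pos[of e "word es *v d"] Cons True by auto
    have orth: "orthogonal_matrix (word es)" using word_in_W[of es] Cons(2) orthogonal_W by auto
    have "refl e = word es ** refl d ** transpose (word es)"
      using refl_conjugate[OF orth, of d] e by simp
    then have "word (e # es) ** refl d = (word es ** refl d ** (transpose (word es) ** word es)) ** refl d"
      by (simp add: matrix_mul_assoc)
    also have "\<dots> = word es ** (refl d ** refl d)"
      using orth by (simp add: orthogonal_matrix_def matrix_mul_assoc)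
    also have "\<dots> = word es" by (simp add: refl_refl root_norm D_roots assms(2))
    finally show ?thesis using Cons(2) by (intro exI[of _ es]) auto
  next
    case False
    then obtain es' where es': "set es' \<subseteq> D" "length es' < length es" "word es ** refl d = word es'"
      using Cons by auto
    then have "word (e # es) ** refl d = word (e # es')" by (simp add: matrix_mul_assoc[symmetric])
    then show ?thesis using es' Cons(2) by (intro exI[of _ "e # es'"]) auto
  qed
qed

text \<open>If the last letter of a word is \<open>d\<close>, the preceding letters send
  \<open>d\<close> to a negative root, so the exchange condition shortens the word; this ends only
  with the empty word.\<close>

lemma Pos_preserving_trivial:
  assumes "w \<in> W" "\<And>b. b \<in> Pos x0 \<Longrightarrow> w *v b \<in> Pos x0"
  shows "w = mat 1"
proof -
  have "word ds = mat 1" if "set ds \<subseteq> D" "\<And>b. b \<in> Pos x0 \<Longrightarrow> word ds *v b \<in> Pos x0" for ds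
    using that
  proof (induct "length ds" arbitrary: ds rule: less_induct)
    case less
    show ?case
    proof (cases ds rule: rev_cases)
      case (snoc ds' d)
      have word_snoc: "word (xs @ [d]) = word xs ** refl d" for xs
        by (induct xs) (simp_all add: matrix_mul_assoc)
      have d: "d \<in> D" "set ds' \<subseteq> D" using less(2) snoc by auto
      have "refl d *v d = - d" using root_inner[OF D_roots[OF d(1)]] by (simp add: refl_vector scaleR_2)
      then have "word ds *v d = - (word ds' *v d)"
        by (simp add: snoc word_snoc matrix_vector_mul_assoc[symmetric] matrix_vector_mult_minus_right)
      then have "- (word ds' *v d) \<in> Pos x0" using less(3)[of d] d D_Pos by auto
      then have "word ds' *v d \<notin> Pos x0" by (auto simp: Pos_def)
      from word_exchange[OF d(2,1) this] obtain es where
        es: "set es \<subseteq> D" "length es < length ds'" "word ds = word es"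
        by (auto simp: snoc word_snoc)
      then show ?thesis using less(1)[of es] less(3) snoc by auto
    qed simp
  qed
  then show ?thesis using W_word[OF assms(1)] assms(2) by blast
qed

end

section \<open>Stabilizers of regular points and of generic points of a mirror\<close>

context reflection_group begin

lemma chamber_stabilizer_trivial:
  assumes "w \<in> W" "regular x" "\<And>b. b \<in> Pos x \<Longrightarrow> w *v b \<in> Pos x"
  shows "w = mat 1"
proof -
  from exists_simple_system[OF assms(2)] obtain D where "simple_system A x D" ..
  then interpret simple_system A x D .
  show ?thesis using Pos_preserving_trivial assms by blast
qed

lemma stabilizer_regular:
  assumes "w \<in> W" "regular x" "w *v x = x"
  shows "w = mat 1"
proof (rule chamber_stabilizer_trivial[OF assms(1,2)])
  fix b assume "b \<in> Pos x"
  then show "w *v b \<in> Pos x"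
    using W_inner[OF assms(1), of b x] W_root[OF assms(1), of b] by (simp add: Pos_def assms(3))
qed

text \<open>Here \<open>y\<close> is generic on the mirror of \<open>a\<close>. An element that also
  fixes \<open>a\<close> preserves the chamber of a nearby regular point
  \<open>y + e *\<^sub>R a\<close> and is trivial; any other element sends \<open>a\<close> to
  \<open>- a\<close>, and composing with \<open>refl a\<close> reduces to the first case.\<close>

lemma stabilizer_hyperplane:
  assumes w: "w \<in> W" "w *v y = y" and a: "a \<in> \<Phi>"
    and y: "\<And>b. b \<in> \<Phi> \<Longrightarrow> b \<bullet> y = 0 \<longleftrightarrow> b = a \<or> b = - a"
  shows "w = mat 1 \<or> w = refl a"
proof -
  have fix_a: "v = mat 1" if v: "v \<in> W" "v *v y = y" "v *v a = a" for v
  proof -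
    have "finite ((\<lambda>b. \<bar>b \<bullet> y\<bar>) ` \<Phi> - {0})" using finite_roots by simp
    then obtain e where e: "e > 0" "\<And>b. b \<in> \<Phi> \<Longrightarrow> b \<bullet> y \<noteq> 0 \<Longrightarrow> e < \<bar>b \<bullet> y\<bar>"
    proof -
      assume *: "\<And>e. e > 0 \<Longrightarrow> (\<And>b. b \<in> \<Phi> \<Longrightarrow> b \<bullet> y \<noteq> 0 \<Longrightarrow> e < \<bar>b \<bullet> y\<bar>) \<Longrightarrow> thesis"
      \<comment> \<open>The element 1 keeps the set nonempty, and half of the minimum makes the
        inequality strict.\<close>
      let ?S = "insert 1 ((\<lambda>b. \<bar>b \<bullet> y\<bar>) ` \<Phi> - {0})"
      have fin: "finite ?S" using finite_roots by simp
      have "Min ?S > 0" using fin by (subst Min_gr_iff) auto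
      moreover have "Min ?S \<le> \<bar>b \<bullet> y\<bar>" if "b \<in> \<Phi>" "b \<bullet> y \<noteq> 0" for b
        using fin that by (intro Min_le) auto
      ultimately show thesis by (intro *[of "Min ?S / 2"]) force+
    qed
    define x where "x = y + e *\<^sub>R a"
    have bound: "\<bar>b \<bullet> a\<bar> \<le> 1" if "b \<in> \<Phi>" for b
      using Cauchy_Schwarz_ineq2[of b a] root_norm that a by simp
    have sgn: "b \<bullet> x > 0 \<longleftrightarrow> b \<bullet> y > 0" "b \<bullet> x \<noteq> 0" if b: "b \<in> \<Phi>" "b \<bullet> y \<noteq> 0" for b
    proof -
      have "\<bar>e * (b \<bullet> a)\<bar> \<le> e" using bound[OF b(1)] e(1) by (simp add: abs_mult)
      then show "b \<bullet> x > 0 \<longleftrightarrow> b \<bullet> y > 0" "b \<bullet> x \<noteq> 0"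
        using e(2)[OF b] by (auto simp: x_def inner_add_right)
    qed
    have ax: "a \<bullet> x = e" using y[OF a] a root_inner by (simp add: x_def inner_add_right)
    have "regular x"
      unfolding regular_def
    proof
      fix b assume "b \<in> \<Phi>"
      then show "b \<bullet> x \<noteq> 0" using sgn(2) y ax e(1) by (cases "b \<bullet> y = 0") auto
    qed
    then show ?thesis
    proof (rule chamber_stabilizer_trivial[OF v(1)])
      fix b assume b: "b \<in> Pos x"
      then have "b \<in> \<Phi>" "b \<bullet> x > 0" by (auto simp: Pos_def)
      moreover have "(v *v b) \<bullet> y = b \<bullet> y" using W_inner[OF v(1), of b y] v(2) by simp
      moreover have "v *v b = b" if "b \<bullet> y = 0"
        using y[OF \<open>b \<in> \<Phi>\<close>] that v(3) by (auto simp: matrix_vector_mult_minus_right)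
      ultimately show "v *v b \<in> Pos x"
        using sgn W_root[OF v(1)] b by (cases "b \<bullet> y = 0") (auto simp: Pos_def)
    qed
  qed
  have "(w *v a) \<bullet> y = 0" using W_inner[OF w(1), of a y] w(2) y[OF a] by simp
  then have "w *v a = a \<or> w *v a = - a" using y[OF W_root[OF w(1) a]] by simp
  then show ?thesis
  proof
    assume "w *v a = - a"
    moreover have "refl a *v y = y" "refl a *v (- a) = a"
      using y[OF a] root_inner[OF a] by (simp_all add: refl_vector scaleR_2)
    ultimately have "refl a ** w = mat 1"
      using w by (intro fix_a) (auto intro: refl_prods_mult root_refl a
          simp: matrix_vector_mul_assoc[symmetric])
    then have "refl a ** refl a ** w = refl a" by (simp add: matrix_mul_assoc[symmetric])
    then show ?thesis by (simp add: refl_refl root_norm a)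
  qed (use fix_a w in blast)
qed

end

section \<open>The Coxeter plane\<close>

lemma inner_double_sum:
  "(\<Sum>s\<in>I. c s *\<^sub>R s) \<bullet> (\<Sum>t\<in>J. d t *\<^sub>R t) = (\<Sum>s\<in>I. \<Sum>t\<in>J. c s * d t * (s \<bullet> t))"
  by (simp only: inner_sum_left) (simp add: inner_sum_right sum_distrib_left mult_ac)

definition orthonormal :: "'a::real_inner set \<Rightarrow> bool" where
  "orthonormal S \<longleftrightarrow> finite S \<and> (\<forall>s\<in>S. \<forall>t\<in>S. s \<bullet> t = (if s = t then 1 else 0))"

lemma orthonormal_expansion:
  assumes "orthonormal S"
  shows "t \<in> S \<Longrightarrow> (\<Sum>s\<in>S. c s *\<^sub>R s) \<bullet> t = c t"
    and "x \<in> span S \<Longrightarrow> x = (\<Sum>s\<in>S. (x \<bullet> s) *\<^sub>R s)"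
proof -
  show *: "(\<Sum>s\<in>S. c s *\<^sub>R s) \<bullet> t = c t" if "t \<in> S" for t c
  proof -
    have "(\<Sum>s\<in>S. c s *\<^sub>R s) \<bullet> t = (\<Sum>s\<in>S. if s = t then c t else 0)"
      unfolding inner_sum_left using assms that by (intro sum.cong) (auto simp: orthonormal_def)
    then show ?thesis using that assms by (simp add: orthonormal_def)
  qed
  assume "x \<in> span S"
  then obtain c where "x = (\<Sum>s\<in>S. c s *\<^sub>R s)"
    using span_finite[of S] assms unfolding orthonormal_def by blast
  then show "x = (\<Sum>s\<in>S. (x \<bullet> s) *\<^sub>R s)" by (simp add: *)
qed

text \<open>Comparing \<open>u\<close> with the normalised negative of the projection
  \<open>q\<close> of \<open>v\<close> onto the span gives
  \<open>norm q \<le> - (u \<bullet> v)\<close>. Then \<open>q - (u \<bullet> v) *\<^sub>R u\<close>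
  has nonpositive square, so \<open>q\<close> is a multiple of \<open>u\<close>. This is the
  Lagrange condition for the constrained minimum.\<close>

lemma orthonormal_minimizer:
  assumes "orthonormal S"
    and u: "u \<in> span S" "norm u = 1"
    and min: "\<And>u'. u' \<in> span S \<Longrightarrow> norm u' = 1 \<Longrightarrow> u \<bullet> v \<le> u' \<bullet> v"
    and s: "s \<in> S"
  shows "v \<bullet> s = (u \<bullet> v) * (u \<bullet> s)"
proof -
  note expand = orthonormal_expansion[OF assms(1)]
  define q where "q = (\<Sum>s\<in>S. (v \<bullet> s) *\<^sub>R s)"
  have q: "q \<in> span S" unfolding q_def by (intro span_sum span_scale span_base)
  have qs: "q \<bullet> s = v \<bullet> s" if "s \<in> S" for s unfolding q_def by (rule expand(1)[OF that])
  have qx: "q \<bullet> x = v \<bullet> x" if "x \<in> span S" for x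
  proof -
    have "q \<bullet> x = (\<Sum>s\<in>S. (x \<bullet> s) * (q \<bullet> s))"
      by (subst expand(2)[OF that]) (simp add: inner_sum_right)
    also have "\<dots> = (\<Sum>s\<in>S. (x \<bullet> s) * (v \<bullet> s))" by (simp add: qs)
    also have "\<dots> = v \<bullet> x" by (subst (2) expand(2)[OF that]) (simp add: inner_sum_right)
    finally show ?thesis .
  qed
  define l where "l = - (u \<bullet> v)"
  have norm_q: "norm q \<le> l"
  proof (cases "q = 0")
    case True
    then have "l = 0" using qx[OF u(1)] by (simp add: l_def inner_commute)
    then show ?thesis using True by simp
  next
    case False
    have "u \<bullet> v \<le> ((- 1 / norm q) *\<^sub>R q) \<bullet> v"
      using False q by (intro min span_scale) simp_all
    also have "\<dots> = - (q \<bullet> q) / norm q" using qx[OF q] by (simp add: inner_commute)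
    also have "\<dots> = - norm q" using False by (simp add: dot_square_norm power2_eq_square)
    finally show ?thesis by (simp add: l_def)
  qed
  have "(q + l *\<^sub>R u) \<bullet> (q + l *\<^sub>R u) = (norm q)\<^sup>2 + 2 * l * (q \<bullet> u) + l\<^sup>2 * (norm u)\<^sup>2"
    by (simp add: inner_add_left inner_add_right inner_commute power2_norm_eq_inner
        power2_eq_square[of l])
  also have "q \<bullet> u = - l" using qx[OF u(1)] by (simp add: l_def inner_commute)
  finally have "(q + l *\<^sub>R u) \<bullet> (q + l *\<^sub>R u) = (norm q)\<^sup>2 - l\<^sup>2"
    by (simp add: u(2) power2_eq_square)
  also have "\<dots> \<le> 0" using norm_q by (simp add: power_mono)
  finally have "q + l *\<^sub>R u = 0" by (metis inner_ge_zero inner_eq_zero_iff antisym)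
  then have "q = (- l) *\<^sub>R u" by (simp add: add_eq_0_iff)
  then show ?thesis using qs[OF s] by (simp add: l_def)
qed

section \<open>The Coxeter graph: a connected forest with two colour classes\<close>

context simple_system begin

lemma D_inner: "d \<in> D \<Longrightarrow> d \<bullet> d = 1"
  by (rule root_inner[OF D_roots])

text \<open>If \<open>a \<bullet> b\<close> lay strictly between -1/2 and 0, the root
  \<open>refl b *v (refl a *v b)\<close> would have the coordinates
  \<open>- 2 * (a \<bullet> b) > 0\<close> and \<open>4 * (a \<bullet> b)\<^sup>2 - 1 < 0\<close>,
  of opposite signs.\<close>

lemma simple_inner_gap:
  assumes "a \<in> D" "b \<in> D" "a \<noteq> b"
  shows "a \<bullet> b = 0 \<or> a \<bullet> b \<le> - 1 / 2"
proof (rule ccontr)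
  assume "\<not> ?thesis"
  then have ab: "- 1 / 2 < a \<bullet> b" "a \<bullet> b < 0" using obtuse[OF assms] by auto
  define c where "c e = (if e = a then - 2 * (a \<bullet> b) else if e = b then 4 * (a \<bullet> b)\<^sup>2 - 1 else 0)" for e
  have "(\<Sum>e\<in>D. c e *\<^sub>R e) = (\<Sum>e\<in>{a, b}. c e *\<^sub>R e)"
    using assms finite_D by (intro sum.mono_neutral_right) (auto simp: c_def)
  also have "\<dots> = (- 2 * (a \<bullet> b)) *\<^sub>R a + (4 * (a \<bullet> b)\<^sup>2 - 1) *\<^sub>R b"
    using assms(3) by (simp add: c_def)
  also have "\<dots> = refl b *v (refl a *v b)"
    using D_inner assms
    by (simp add: refl_vector inner_diff_right inner_commute[of b a] vec_eq_iff power2_eq_square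
        algebra_simps)
  finally have "(\<Sum>e\<in>D. c e *\<^sub>R e) \<in> \<Phi>"
    using W_root[OF root_refl W_root[OF root_refl]] D_roots assms by simp
  from D_mixed_signs[OF this assms(1) _ assms(2)] have "c b \<ge> 0" using ab by (simp add: c_def)
  then have "(1 / 2)\<^sup>2 \<le> (- (a \<bullet> b))\<^sup>2" using assms(3) by (simp add: c_def power2_eq_square split: if_splits)
  then have "1 / 2 \<le> - (a \<bullet> b)" by (rule power2_le_imp_le) (use ab in simp)
  then show False using ab by simp
qed

text \<open>Two neighbours of a vertex contribute at most -1 to its row of the Gram matrix. If every
  vertex of \<open>S\<close> had two in \<open>S\<close>, all row sums would be nonpositive, so
  \<open>\<Sum>S\<close> would have square at most 0 although it is positive on \<open>x0\<close>.
  Thus the Coxeter graph is a forest.\<close>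

lemma few_neighbours:
  assumes "S \<subseteq> D" "S \<noteq> {}"
  shows "\<exists>i\<in>S. \<forall>j\<in>S - {i}. \<forall>k\<in>S - {i}. i \<bullet> j \<noteq> 0 \<longrightarrow> i \<bullet> k \<noteq> 0 \<longrightarrow> j = k"
proof (rule ccontr)
  assume contra: "\<not> ?thesis"
  have fin: "finite S" using assms finite_D finite_subset by blast
  have nonpos: "i \<bullet> j \<le> 0" if "i \<in> S" "j \<in> S - {i}" for i j using that obtuse assms by blast
  have le: "(\<Sum>j\<in>S. i \<bullet> j) \<le> 0" if i: "i \<in> S" for i
  proof -
    obtain j k where jk: "j \<in> S - {i}" "k \<in> S - {i}" "i \<bullet> j \<noteq> 0" "i \<bullet> k \<noteq> 0" "j \<noteq> k"
      using contra i by blast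
    have "(\<Sum>j\<in>S - {i}. i \<bullet> j) \<le> (\<Sum>j\<in>{j, k}. i \<bullet> j)"
      using fin jk nonpos[OF i]
      by (subst sum.subset_diff[of "{j, k}"]) (auto intro!: sum_nonpos)
    also have "\<dots> \<le> - 1"
    proof -
      have "i \<in> D" "j \<in> D" "k \<in> D" using jk i assms by auto
      then show ?thesis using simple_inner_gap[of i j] simple_inner_gap[of i k] jk by auto
    qed
    finally have "(\<Sum>j\<in>S - {i}. i \<bullet> j) \<le> - 1" .
    moreover have "i \<bullet> i = 1" using D_inner i assms(1) by blast
    ultimately show ?thesis unfolding sum.remove[OF fin i] by linarith
  qed
  have "(\<Sum>S) \<bullet> (\<Sum>S) = (\<Sum>i\<in>S. \<Sum>j\<in>S. i \<bullet> j)"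
    by (simp only: inner_sum_left inner_sum_right) (rule sum.swap)
  also have "\<dots> \<le> 0" by (rule sum_nonpos[OF le])
  finally have "\<Sum>S = 0" by (metis inner_ge_zero inner_eq_zero_iff antisym)
  moreover have "(\<Sum>S) \<bullet> x0 > 0"
    unfolding inner_sum_left using fin assms D_pos by (intro sum_pos) auto
  ultimately show False by simp
qed

text \<open>Remove a vertex with at most one neighbour and colour the rest; the vertex then joins a
  class that does not contain this neighbour.\<close>

lemma bipartition:
  assumes "S \<subseteq> D"
  shows "\<exists>I J. I \<union> J = S \<and> I \<inter> J = {} \<and> (\<forall>i\<in>I. \<forall>j\<in>I. i \<noteq> j \<longrightarrow> i \<bullet> j = 0) \<and>
    (\<forall>i\<in>J. \<forall>j\<in>J. i \<noteq> j \<longrightarrow> i \<bullet> j = 0)"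
proof -
  have "finite S" using assms finite_D finite_subset by blast
  then show ?thesis using assms
  proof (induct S rule: finite_psubset_induct)
    case (psubset S)
    show ?case
    proof (cases "S = {}")
      case False
      obtain i where i: "i \<in> S"
        "\<And>j k. j \<in> S - {i} \<Longrightarrow> k \<in> S - {i} \<Longrightarrow> i \<bullet> j \<noteq> 0 \<Longrightarrow> i \<bullet> k \<noteq> 0 \<Longrightarrow> j = k"
        using few_neighbours[OF psubset(3) False] by blast
      obtain I J where IJ: "I \<union> J = S - {i}" "I \<inter> J = {}"
        "\<forall>i\<in>I. \<forall>j\<in>I. i \<noteq> j \<longrightarrow> i \<bullet> j = 0" "\<forall>i\<in>J. \<forall>j\<in>J. i \<noteq> j \<longrightarrow> i \<bullet> j = 0"
        using psubset(2)[of "S - {i}"] psubset(3) i(1) by blast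
      show ?thesis
      proof (cases "\<exists>j\<in>I. i \<bullet> j \<noteq> 0")
        case True
        then have *: "i \<bullet> k = 0" if "k \<in> J" for k using that i(2) IJ by blast
        have "\<forall>a\<in>insert i J. \<forall>b\<in>insert i J. a \<noteq> b \<longrightarrow> a \<bullet> b = 0"
          using IJ(4) * inner_commute[of i] by (metis insert_iff)
        moreover have "I \<union> insert i J = S" "I \<inter> insert i J = {}" using IJ i(1) by blast+
        ultimately show ?thesis using IJ(3) by blast
      next
        case False
        then have "\<forall>a\<in>insert i I. \<forall>b\<in>insert i I. a \<noteq> b \<longrightarrow> a \<bullet> b = 0"
          using IJ(3) inner_commute[of i] by (metis insert_iff)
        moreover have "insert i I \<union> J = S" "insert i I \<inter> J = {}" using IJ i(1) by blast+
        ultimately show ?thesis using IJ(4) by blast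
      qed
    qed auto
  qed
qed

text \<open>A set of simple roots orthogonal to the remaining ones spans a subspace invariant under
  \<open>W\<close>, so irreducibility forces the Coxeter graph to be connected.\<close>

lemma connected_D:
  assumes "Z \<subseteq> D" "\<And>a b. a \<in> Z \<Longrightarrow> b \<in> D - Z \<Longrightarrow> a \<bullet> b = 0"
  shows "Z = {} \<or> Z = D"
proof -
  have orth: "b \<bullet> u = 0" if "b \<in> D - Z" "u \<in> span Z" for b u
    using orthogonal_to_span[OF that(2), of b] assms(2) that(1)
    by (auto simp: orthogonal_def inner_commute)
  have inv: "refl b *v u \<in> span Z" if "b \<in> D" "u \<in> span Z" for b u
    using that orth[of b u] by (cases "b \<in> Z") (auto simp: refl_vector intro: span_diff span_scale span_base)
  have invW: "w *v u \<in> span Z" if "w \<in> W" "u \<in> span Z" for w u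
    using that(1) unfolding refl_prods_D[symmetric]
    by induct (use that(2) inv in \<open>auto simp: matrix_vector_mul_assoc[symmetric]\<close>)
  have "span Z = {0} \<or> span Z = UNIV"
    by (rule irreducible) (use invW refl_prods_refl in auto)
  then show ?thesis
  proof
    assume "span Z = {0}"
    then show ?thesis using span_base[of _ Z] root_nonzero[OF D_roots] assms(1) by blast
  next
    assume "span Z = UNIV"
    then have "b \<notin> D - Z" for b using orth[of b b] D_inner by force
    then show ?thesis using assms(1) by blast
  qed
qed

lemma span_D: "span D = UNIV"
proof -
  have "b \<in> span D" if b: "b \<in> Pos x0" for b
  proof -
    obtain c where "b = (\<Sum>d\<in>D. c d *\<^sub>R d)" using Pos_cone[OF b] by blast
    then show ?thesis by (auto intro: span_sum span_scale span_base)
  qed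
  then have "\<Phi> \<subseteq> span D"
    using root_Pos_cases[OF regular_x0] span_neg by (metis minus_minus subsetI)
  then show ?thesis using span_roots span_mono span_span by (metis top.extremum_uniqueI)
qed

lemma card_D: "card D = CARD('n)"
proof -
  have "independent D"
    using D_independent finite_D by (auto simp: dependent_finite)
  then have "card D = dim (span D)" by (simp add: dim_eq_card_independent)
  then show ?thesis by (simp add: span_D)
qed

text \<open>The witness is the product of the commuting reflections in \<open>S\<close>. For the two
  colour classes these products are the factors of a Coxeter element.\<close>

lemma orthogonal_product:
  assumes "S \<subseteq> D" "\<And>s t. s \<in> S \<Longrightarrow> t \<in> S \<Longrightarrow> s \<noteq> t \<Longrightarrow> s \<bullet> t = 0"
  shows "\<exists>w\<in>W. \<forall>x\<in>span S. \<forall>y. (\<forall>s\<in>S. s \<bullet> y = 0) \<longrightarrow> w *v (x + y) = - x + y"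
proof -
  have "finite S" using assms(1) finite_D finite_subset by blast
  then have "\<exists>w\<in>W. (\<forall>s\<in>S. w *v s = - s) \<and> (\<forall>y. (\<forall>s\<in>S. s \<bullet> y = 0) \<longrightarrow> w *v y = y)"
    using assms
  proof induct
    case empty then show ?case by (intro bexI[of _ "mat 1"]) (auto intro: refl_prods.one)
  next
    case (insert a S)
    then obtain w where w: "w \<in> W" "\<And>s. s \<in> S \<Longrightarrow> w *v s = - s"
      "\<And>y. (\<forall>s\<in>S. s \<bullet> y = 0) \<Longrightarrow> w *v y = y" by auto
    have a: "a \<in> D" using insert by blast
    have "w *v a = a" using insert by (intro w(3)) auto
    moreover have "refl a *v s = s" if "s \<in> S" for s
      using that insert.hyps(2) insert.prems(2)[of a s] by (auto simp: refl_vector)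
    ultimately show ?case
      using w(2,3) D_inner[OF a] insert
      by (intro bexI[of _ "refl a ** w"] refl_prods_mult w(1) root_refl D_roots a)
        (auto simp: matrix_vector_mul_assoc[symmetric] refl_vector matrix_vector_mult_minus_right scaleR_2)
  qed
  then obtain w where w: "w \<in> W" "\<forall>s\<in>S. w *v s = - s" "\<forall>y. (\<forall>s\<in>S. s \<bullet> y = 0) \<longrightarrow> w *v y = y"
    by blast
  have "w *v x = - x" if "x \<in> span S" for x
    using linear_eq_on[of "(*v) w" uminus x S] w(2) that by (auto simp: linear_iff matrix_vector_right_distrib
        matrix_vector_mult_scaleR)
  then show ?thesis using w by (intro bexI[of _ w]) (auto simp: matrix_vector_right_distrib)
qed

lemma D_orthonormal:
  assumes "S \<subseteq> D" "\<And>s t. s \<in> S \<Longrightarrow> t \<in> S \<Longrightarrow> s \<noteq> t \<Longrightarrow> s \<bullet> t = 0"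
  shows "orthonormal S"
proof -
  have "finite S" using assms(1) finite_D finite_subset by blast
  moreover have "s \<bullet> t = (if s = t then 1 else 0)" if "s \<in> S" "t \<in> S" for s t
    using assms that D_inner by auto
  ultimately show ?thesis unfolding orthonormal_def by blast
qed

lemma span_positive_part:
  assumes "orthonormal S" "u \<in> span S" "norm u = 1"
  defines "u' \<equiv> \<Sum>s\<in>S. \<bar>u \<bullet> s\<bar> *\<^sub>R s"
  shows "u' \<in> span S" "norm u' = 1" "\<And>s. s \<in> S \<Longrightarrow> u' \<bullet> s = \<bar>u \<bullet> s\<bar>"
proof -
  note expand = orthonormal_expansion[OF assms(1)]
  show u': "u' \<in> span S" unfolding u'_def by (intro span_sum span_scale span_base)
  show *: "u' \<bullet> s = \<bar>u \<bullet> s\<bar>" if "s \<in> S" for s unfolding u'_def by (rule expand(1)[OF that])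
  have "u' \<bullet> u' = (\<Sum>s\<in>S. \<bar>u \<bullet> s\<bar> * (u' \<bullet> s))"
    by (subst (2) u'_def) (simp add: inner_sum_right)
  also have "\<dots> = (\<Sum>s\<in>S. (u \<bullet> s) * (u \<bullet> s))" by (simp add: *)
  also have "\<dots> = u \<bullet> (\<Sum>s\<in>S. (u \<bullet> s) *\<^sub>R s)" by (simp add: inner_sum_right)
  also have "\<dots> = u \<bullet> u" unfolding expand(2)[OF assms(2), symmetric] ..
  finally show "norm u' = 1" using assms(3) by (simp add: norm_eq_1)
qed

text \<open>A pair of unit vectors in the spans of \<open>I\<close> and \<open>J\<close> with least inner product takes the place
  of a Perron--Frobenius eigenvector: its coordinates may be taken nonnegative because \<open>D\<close> is
  obtuse, and they are positive because the Coxeter graph is connected.\<close>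

lemma minimal_angle:
  assumes "orthonormal I" "orthonormal J" "I \<noteq> {}" "J \<noteq> {}" "I \<subseteq> D" "J \<subseteq> D" "I \<inter> J = {}"
  shows "\<exists>u v. u \<in> span I \<and> norm u = 1 \<and> v \<in> span J \<and> norm v = 1 \<and>
    (\<forall>s\<in>I. u \<bullet> s \<ge> 0) \<and> (\<forall>s\<in>J. v \<bullet> s \<ge> 0) \<and>
    (\<forall>u'\<in>span I. \<forall>v'\<in>span J. norm u' = 1 \<longrightarrow> norm v' = 1 \<longrightarrow> u \<bullet> v \<le> u' \<bullet> v')"
proof -
  define X :: "(real ^ 'n) set \<Rightarrow> (real ^ 'n) set" where "X S = span S \<inter> sphere 0 1" for S
  have compact: "compact (X S)" for S
    unfolding X_def by (intro closed_Int_compact closed_subspace subspace_span compact_sphere)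
  have ne: "X S \<noteq> {}" if S: "S \<noteq> {}" "S \<subseteq> D" for S
  proof -
    obtain s where "s \<in> S" using S(1) by blast
    then have "s \<in> X S" using S(2) root_norm D_roots span_base[of s S] by (auto simp: X_def)
    then show ?thesis by blast
  qed
  have "X I \<times> X J \<noteq> {}"
    using ne[OF assms(3,5)] ne[OF assms(4,6)] by (simp only: Times_empty simp_thms)
  moreover have "continuous_on (X I \<times> X J) (\<lambda>p. fst p \<bullet> snd p)"
    by (intro continuous_intros)
  ultimately have "\<exists>p\<in>X I \<times> X J. \<forall>q\<in>X I \<times> X J. fst p \<bullet> snd p \<le> fst q \<bullet> snd q"
    by (rule continuous_attains_inf[OF compact_Times[OF compact compact]])
  then obtain p where p: "p \<in> X I \<times> X J"
    "\<And>q. q \<in> X I \<times> X J \<Longrightarrow> fst p \<bullet> snd p \<le> fst q \<bullet> snd q"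
    by blast
  define a b where "a = fst p" and "b = snd p"
  have ab: "a \<in> span I" "norm a = 1" "b \<in> span J" "norm b = 1" using p(1) by (auto simp: a_def b_def X_def)
  define u v where "u = (\<Sum>s\<in>I. \<bar>a \<bullet> s\<bar> *\<^sub>R s)" and "v = (\<Sum>s\<in>J. \<bar>b \<bullet> s\<bar> *\<^sub>R s)"
  note u = span_positive_part[OF assms(1) ab(1,2), folded u_def]
  note v = span_positive_part[OF assms(2) ab(3,4), folded v_def]
  have "u \<bullet> v = (\<Sum>s\<in>I. \<Sum>t\<in>J. \<bar>a \<bullet> s\<bar> * \<bar>b \<bullet> t\<bar> * (s \<bullet> t))"
    unfolding u_def v_def by (rule inner_double_sum)
  also have "\<dots> \<le> (\<Sum>s\<in>I. \<Sum>t\<in>J. (a \<bullet> s) * (b \<bullet> t) * (s \<bullet> t))"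
  proof (intro sum_mono)
    fix s t assume st: "s \<in> I" "t \<in> J"
    have "s \<bullet> t \<le> 0" using obtuse st assms(5-7) by blast
    moreover have "(a \<bullet> s) * (b \<bullet> t) \<le> \<bar>a \<bullet> s\<bar> * \<bar>b \<bullet> t\<bar>" by (simp flip: abs_mult)
    ultimately show "\<bar>a \<bullet> s\<bar> * \<bar>b \<bullet> t\<bar> * (s \<bullet> t) \<le> (a \<bullet> s) * (b \<bullet> t) * (s \<bullet> t)"
      by (rule mult_right_mono_neg[rotated])
  qed
  also have "\<dots> = a \<bullet> b"
    unfolding inner_double_sum[symmetric] orthonormal_expansion(2)[OF assms(1) ab(1), symmetric]
      orthonormal_expansion(2)[OF assms(2) ab(3), symmetric] ..
  finally have "u \<bullet> v \<le> fst p \<bullet> snd p" by (simp add: a_def b_def)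
  then have min: "u \<bullet> v \<le> u' \<bullet> v'" if "u' \<in> span I" "norm u' = 1" "v' \<in> span J" "norm v' = 1" for u' v'
    using p(2)[of "(u', v')"] that by (simp add: X_def)
  show ?thesis
    by (rule exI[of _ u], rule exI[of _ v]) (use u v min in simp)
qed

lemma nonneg_combination_zero:
  assumes "finite S" "(\<Sum>s\<in>S. c s * b s) = 0" "\<And>s. s \<in> S \<Longrightarrow> c s \<ge> 0" "\<And>s. s \<in> S \<Longrightarrow> b s \<le> (0::real)"
    and "s \<in> S" "c s \<noteq> 0"
  shows "b s = 0"
proof -
  have 1: "(\<Sum>s\<in>S. c s * (- b s)) = 0" using assms(2) by (simp add: sum_negf)
  have 2: "c s * (- b s) \<ge> 0" if "s \<in> S" for s
    using that assms(3,4) by (intro mult_nonneg_nonneg) auto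
  have "c s * (- b s) = 0"
    using sum_nonneg_eq_0_iff[OF assms(1) 2, THEN iffD1, OF _ 1] assms(5) by blast
  then show ?thesis using assms(6) by simp
qed

end

text \<open>By \<open>v_I\<close> and \<open>u_J\<close> the plane of \<open>u\<close> and
  \<open>v\<close> contains a vector \<open>v + l *\<^sub>R u\<close> orthogonal to \<open>I\<close>
  and a vector \<open>u + l *\<^sub>R v\<close> orthogonal to \<open>J\<close>, hence is stable
  under the reflection products of both classes. \<open>l\<close> is the cosine of the angle between
  these two directions.\<close>

locale coxeter_plane = simple_system A x0 D
  for A :: "(real ^ 'n::finite) set" and x0 :: "real ^ 'n" and D :: "(real ^ 'n) set" +
  fixes I J :: "(real ^ 'n) set" and u v :: "real ^ 'n" and l :: real
  assumes I_Un_J: "I \<union> J = D" and I_Int_J: "I \<inter> J = {}"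
    and orthonormal_I: "orthonormal I" and orthonormal_J: "orthonormal J"
    and I_nonempty: "I \<noteq> {}" and J_nonempty: "J \<noteq> {}"
    and u_span: "u \<in> span I" and v_span: "v \<in> span J"
    and u_pos: "i \<in> I \<Longrightarrow> u \<bullet> i > 0" and v_pos: "i \<in> J \<Longrightarrow> v \<bullet> i > 0"
    and v_I: "i \<in> I \<Longrightarrow> v \<bullet> i = - l * (u \<bullet> i)" and u_J: "i \<in> J \<Longrightarrow> u \<bullet> i = - l * (v \<bullet> i)"
    and l_bounds: "- 1 < l" "l < 1"

context simple_system begin

lemma exists_coxeter_plane: "\<exists>I J u v l. coxeter_plane A x0 D I J u v l"
proof -
  from bipartition[OF subset_refl] obtain I J where IJ: "I \<union> J = D" "I \<inter> J = {}"
    and IJ': "\<forall>i\<in>I. \<forall>j\<in>I. i \<noteq> j \<longrightarrow> i \<bullet> j = 0" "\<forall>i\<in>J. \<forall>j\<in>J. i \<noteq> j \<longrightarrow> i \<bullet> j = 0"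
    by (elim exE conjE)
  have IJ0: "\<And>i j. i \<in> I \<Longrightarrow> j \<in> I \<Longrightarrow> i \<noteq> j \<Longrightarrow> i \<bullet> j = 0"
    "\<And>i j. i \<in> J \<Longrightarrow> j \<in> J \<Longrightarrow> i \<noteq> j \<Longrightarrow> i \<bullet> j = 0"
    using IJ' by simp_all
  have sub: "I \<subseteq> D" "J \<subseteq> D" using IJ by auto
  have ortho: "orthonormal I" "orthonormal J"
    by (rule D_orthonormal[OF sub(1) IJ0(1)], assumption+) (rule D_orthonormal[OF sub(2) IJ0(2)], assumption+)
  \<comment> \<open>If one class were all of \<open>D\<close>, no two simple roots would be joined,
    and connectedness would leave a single root.\<close>
  have ne: "S \<noteq> D" if S: "\<And>i j. i \<in> S \<Longrightarrow> j \<in> S \<Longrightarrow> i \<noteq> j \<Longrightarrow> i \<bullet> j = 0" for S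
  proof
    assume "S = D"
    have "D \<noteq> {}" using card_D dim_ge_2 by auto
    then obtain d where d: "d \<in> D" by blast
    have "{d} = {} \<or> {d} = D" using d S unfolding \<open>S = D\<close> by (intro connected_D) auto
    then have "D = {d}" by simp
    then have "card D = 1" by simp
    then show False using card_D dim_ge_2 by simp
  qed
  have "I \<noteq> {}" "J \<noteq> {}" using ne[OF IJ0(1)] ne[OF IJ0(2)] IJ by auto
  from minimal_angle[OF ortho \<open>I \<noteq> {}\<close> \<open>J \<noteq> {}\<close> sub IJ(2)] obtain u v
    where uv: "u \<in> span I" "norm u = 1" "v \<in> span J" "norm v = 1"
      and nonneg': "\<forall>s\<in>I. u \<bullet> s \<ge> 0" "\<forall>s\<in>J. v \<bullet> s \<ge> 0"
      and min': "\<forall>u'\<in>span I. \<forall>v'\<in>span J. norm u' = 1 \<longrightarrow> norm v' = 1 \<longrightarrow> u \<bullet> v \<le> u' \<bullet> v'"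
    by (elim exE conjE)
  have nonneg: "\<And>s. s \<in> I \<Longrightarrow> u \<bullet> s \<ge> 0" "\<And>s. s \<in> J \<Longrightarrow> v \<bullet> s \<ge> 0"
    and min: "\<And>u' v'. u' \<in> span I \<Longrightarrow> norm u' = 1 \<Longrightarrow> v' \<in> span J \<Longrightarrow> norm v' = 1 \<Longrightarrow> u \<bullet> v \<le> u' \<bullet> v'"
    using nonneg' min' by simp_all
  define l where "l = - (u \<bullet> v)"
  have vi: "v \<bullet> i = - l * (u \<bullet> i)" if "i \<in> I" for i
    using orthonormal_minimizer[OF ortho(1) uv(1,2) min[OF _ _ uv(3,4)] that] by (simp add: l_def)
  have uj: "u \<bullet> j = - l * (v \<bullet> j)" if "j \<in> J" for j
    using orthonormal_minimizer[OF ortho(2) uv(3,4) _ that, of u] min[OF uv(1,2)]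
    by (simp add: l_def inner_commute)
  have cross: "i \<bullet> j \<le> 0" if "i \<in> I" "j \<in> J" for i j using obtuse that IJ by blast
  have fin: "finite I" "finite J" using ortho by (auto simp: orthonormal_def)
  \<comment> \<open>All summands \<open>(v \<bullet> s) * (i \<bullet> s)\<close> of
    \<open>v \<bullet> i = 0\<close> are nonpositive, so each of them vanishes.\<close>
  have zI: "i \<bullet> j = 0" if ij: "i \<in> I" "j \<in> J" "u \<bullet> i = 0" "v \<bullet> j \<noteq> 0" for i j
  proof (rule nonneg_combination_zero[of J "\<lambda>s. v \<bullet> s" "\<lambda>s. i \<bullet> s"])
    have "v \<bullet> i = (\<Sum>s\<in>J. (v \<bullet> s) * (i \<bullet> s))"
      by (subst orthonormal_expansion(2)[OF ortho(2) uv(3)])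
        (simp add: inner_sum_left inner_commute[of i])
    then show "(\<Sum>s\<in>J. (v \<bullet> s) * (i \<bullet> s)) = 0" using vi[OF ij(1)] ij(3) by simp
  qed (use fin nonneg cross ij in simp_all)
  have zJ: "i \<bullet> j = 0" if ij: "i \<in> I" "j \<in> J" "v \<bullet> j = 0" "u \<bullet> i \<noteq> 0" for i j
  proof (rule nonneg_combination_zero[of I "\<lambda>s. u \<bullet> s" "\<lambda>s. s \<bullet> j"])
    have "u \<bullet> j = (\<Sum>s\<in>I. (u \<bullet> s) * (s \<bullet> j))"
      by (subst orthonormal_expansion(2)[OF ortho(1) uv(1)]) (simp add: inner_sum_left)
    then show "(\<Sum>s\<in>I. (u \<bullet> s) * (s \<bullet> j)) = 0" using uj[OF ij(2)] ij(3) by simp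
  qed (use fin nonneg cross ij in simp_all)
  \<comment> \<open>Vanishing and nonvanishing coordinates are never joined by an edge, so
    \<open>Z\<close> is a union of components; it is not all of \<open>D\<close> because
    \<open>u\<close> is not zero.\<close>
  define Z where "Z = {i \<in> I. u \<bullet> i = 0} \<union> {j \<in> J. v \<bullet> j = 0}"
  have "Z = {} \<or> Z = D"
  proof (rule connected_D)
    show "Z \<subseteq> D" using sub by (auto simp: Z_def)
    fix a b assume a: "a \<in> Z" and b: "b \<in> D - Z"
    show "a \<bullet> b = 0"
    proof (cases "a \<in> I")
      case True
      then have "u \<bullet> a = 0" using a IJ(2) by (auto simp: Z_def)
      then show ?thesis using zI[OF True, of b] IJ0(1)[OF True, of b] b IJ a by (auto simp: Z_def)
    next
      case False
      then have "a \<in> J" "v \<bullet> a = 0" using a IJ by (auto simp: Z_def)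
      then show ?thesis using zJ[of b a] IJ0(2)[of a b] b IJ a by (auto simp: Z_def inner_commute)
    qed
  qed
  moreover have "Z \<noteq> D"
  proof
    assume "Z = D"
    then have "u \<bullet> i = 0" if "i \<in> I" for i using that IJ by (auto simp: Z_def)
    then have "u = 0" by (subst orthonormal_expansion(2)[OF ortho(1) uv(1)]) simp
    then show False using uv by simp
  qed
  ultimately have "Z = {}" by blast
  then have pos: "i \<in> I \<Longrightarrow> u \<bullet> i > 0" "i \<in> J \<Longrightarrow> v \<bullet> i > 0" for i
    using nonneg by (force simp: Z_def order_less_le)+
  have abs_l: "\<bar>l\<bar> \<le> 1" using Cauchy_Schwarz_ineq2[of u v] uv by (simp add: l_def)
  \<comment> \<open>For \<open>l = 1\<close> or \<open>l = - 1\<close> equality in Cauchy-Schwarz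
    would put \<open>u\<close> into both spans.\<close>
  have disj: "x = 0" if "x \<in> span I" "x \<in> span J" for x
  proof -
    have x: "x = (\<Sum>s\<in>I. (x \<bullet> s) *\<^sub>R s)" "x = (\<Sum>s\<in>J. (x \<bullet> s) *\<^sub>R s)"
      using orthonormal_expansion(2) ortho that by blast+
    have "(\<Sum>s\<in>D. (if s \<in> I then x \<bullet> s else - (x \<bullet> s)) *\<^sub>R s) =
        (\<Sum>s\<in>I. (x \<bullet> s) *\<^sub>R s) + (\<Sum>s\<in>J. - (x \<bullet> s) *\<^sub>R s)"
      unfolding IJ(1)[symmetric] sum.union_disjoint[OF fin IJ(2)]
      by (intro arg_cong2[of _ _ _ _ "(+)"] sum.cong) (use IJ(2) in auto)
    also have "\<dots> = 0" using x by (simp add: sum_negf)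
    finally have *: "(\<Sum>s\<in>D. (if s \<in> I then x \<bullet> s else - (x \<bullet> s)) *\<^sub>R s) = 0" .
    have "x \<bullet> s = 0" if "s \<in> I" for s using D_independent[OF *, of s] that sub by auto
    then show ?thesis by (subst x(1)) simp
  qed
  have "l \<noteq> 1"
  proof
    assume "l = 1"
    then have "(u + v) \<bullet> (u + v) = 0"
      using uv by (simp add: l_def inner_add_left inner_add_right inner_commute norm_eq_1)
    then have "u = - v" by (simp add: eq_neg_iff_add_eq_0)
    then have "u \<in> span J" using uv(3) by (simp add: span_neg)
    then show False using disj uv by force
  qed
  moreover have "l \<noteq> - 1"
  proof
    assume "l = - 1"
    then have "(u - v) \<bullet> (u - v) = 0"
      using uv by (simp add: l_def inner_diff_left inner_diff_right inner_commute norm_eq_1)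
    then show False using disj[of u] uv by auto
  qed
  ultimately have "- 1 < l" "l < 1" using abs_l by auto
  then have "coxeter_plane A x0 D I J u v l"
    by unfold_locales (use IJ ortho \<open>I \<noteq> {}\<close> \<open>J \<noteq> {}\<close> uv pos vi uj in simp_all)
  then show ?thesis by blast
qed

end

section \<open>Rays of the plane, singular angles and the count of the roots\<close>

context coxeter_plane begin

definition "\<phi> = arccos l"

lemma cos_phi: "cos \<phi> = l"
  using l_bounds by (simp add: \<phi>_def)

lemma phi_bounds: "0 < \<phi>" "\<phi> < pi"
  using arccos_lt_bounded[OF l_bounds] by (simp_all add: \<phi>_def)

lemma sin_phi: "sin \<phi> > 0"
  using phi_bounds by (rule sin_gt_zero)

text \<open>The direction of the plane orthogonal to \<open>I\<close>. With the factor
  \<open>1 / sin \<phi>\<close> the rays take the form \<open>r_alt\<close>, the same description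
  seen from \<open>J\<close>.\<close>

definition "f = (1 / sin \<phi>) *\<^sub>R (v + l *\<^sub>R u)"

text \<open>At angle 0 the ray lies on the mirrors of \<open>I\<close>, at angle
  \<open>\<phi>\<close> on those of \<open>J\<close>; the rays between them lie in the fundamental
  chamber.\<close>

definition "r \<theta> = cos \<theta> *\<^sub>R f + sin \<theta> *\<^sub>R u"

lemma r_pi: "r (\<theta> + pi) = - r \<theta>"
  by (simp add: r_def)

lemma f_inner_I: "i \<in> I \<Longrightarrow> i \<bullet> f = 0"
  using v_I[of i] by (simp add: f_def inner_add_right inner_commute)

lemma r_inner_I: "i \<in> I \<Longrightarrow> i \<bullet> r \<theta> = (u \<bullet> i) * sin \<theta>"
  by (simp add: r_def inner_add_right f_inner_I) (simp add: inner_commute)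

lemma r_alt: "r \<theta> = sin (\<phi> - \<theta>) *\<^sub>R v + (cos (\<phi> - \<theta>) / sin \<phi>) *\<^sub>R (u + l *\<^sub>R v)"
proof -
  have 1: "cos \<theta> * l / sin \<phi> + sin \<theta> = cos (\<phi> - \<theta>) / sin \<phi>"
    using sin_phi by (simp add: cos_diff cos_phi field_simps)
  have "cos \<theta> = cos (\<phi> - (\<phi> - \<theta>))" by simp
  also have "\<dots> = l * cos (\<phi> - \<theta>) + sin \<phi> * sin (\<phi> - \<theta>)" unfolding cos_diff[of \<phi> "\<phi> - \<theta>"] cos_phi ..
  finally have 2: "cos \<theta> / sin \<phi> = sin (\<phi> - \<theta>) + cos (\<phi> - \<theta>) / sin \<phi> * l"
    using sin_phi by (simp add: field_simps)
  have "r \<theta> = (cos \<theta> / sin \<phi>) *\<^sub>R v + (cos \<theta> * l / sin \<phi> + sin \<theta>) *\<^sub>R u"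
    by (simp add: r_def f_def scaleR_add_right scaleR_add_left)
  also have "\<dots> = sin (\<phi> - \<theta>) *\<^sub>R v + (cos (\<phi> - \<theta>) / sin \<phi>) *\<^sub>R (u + l *\<^sub>R v)"
    unfolding 1 2 by (simp add: scaleR_add_right scaleR_add_left)
  finally show ?thesis .
qed

lemma u_v_inner_J: "i \<in> J \<Longrightarrow> i \<bullet> (u + l *\<^sub>R v) = 0"
  using u_J[of i] by (simp add: inner_add_right inner_commute)

lemma r_inner_J: "i \<in> J \<Longrightarrow> i \<bullet> r \<theta> = (v \<bullet> i) * sin (\<phi> - \<theta>)"
  by (subst r_alt) (simp add: inner_add_right[of i "_ *\<^sub>R v"] u_v_inner_J inner_commute[of i v])

lemma exists_reflection_I: "\<exists>w\<in>W. \<forall>\<theta>. w *v r \<theta> = r (- \<theta>)"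
proof -
  have "I \<subseteq> D" "\<And>s t. s \<in> I \<Longrightarrow> t \<in> I \<Longrightarrow> s \<noteq> t \<Longrightarrow> s \<bullet> t = 0"
    using I_Un_J orthonormal_I by (auto simp: orthonormal_def)
  from orthogonal_product[OF this] obtain w where w: "w \<in> W"
    "\<And>x y. x \<in> span I \<Longrightarrow> (\<forall>s\<in>I. s \<bullet> y = 0) \<Longrightarrow> w *v (x + y) = - x + y" by blast
  have "w *v r \<theta> = r (- \<theta>)" for \<theta>
  proof -
    have "w *v (sin \<theta> *\<^sub>R u + cos \<theta> *\<^sub>R f) = - (sin \<theta> *\<^sub>R u) + cos \<theta> *\<^sub>R f"
      by (rule w(2)) (simp_all add: span_scale u_span f_inner_I)
    then show ?thesis by (simp add: r_def add.commute)
  qed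
  then show ?thesis using w(1) by blast
qed

lemma exists_reflection_J: "\<exists>w\<in>W. \<forall>\<theta>. w *v r \<theta> = r (2 * \<phi> - \<theta>)"
proof -
  have "J \<subseteq> D" "\<And>s t. s \<in> J \<Longrightarrow> t \<in> J \<Longrightarrow> s \<noteq> t \<Longrightarrow> s \<bullet> t = 0"
    using I_Un_J orthonormal_J by (auto simp: orthonormal_def)
  from orthogonal_product[OF this] obtain w where w: "w \<in> W"
    "\<And>x y. x \<in> span J \<Longrightarrow> (\<forall>s\<in>J. s \<bullet> y = 0) \<Longrightarrow> w *v (x + y) = - x + y" by blast
  have "w *v r \<theta> = r (2 * \<phi> - \<theta>)" for \<theta>
  proof -
    have "w *v (sin (\<phi> - \<theta>) *\<^sub>R v + (cos (\<phi> - \<theta>) / sin \<phi>) *\<^sub>R (u + l *\<^sub>R v)) =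
        - (sin (\<phi> - \<theta>) *\<^sub>R v) + (cos (\<phi> - \<theta>) / sin \<phi>) *\<^sub>R (u + l *\<^sub>R v)"
      by (rule w(2)) (simp_all add: span_scale v_span u_v_inner_J del: inner_add_right inner_add_left)
    also have "\<dots> = r (2 * \<phi> - \<theta>)"
    proof -
      have *: "\<phi> - (2 * \<phi> - \<theta>) = - (\<phi> - \<theta>)" by simp
      show ?thesis
        unfolding r_alt[of "2 * \<phi> - \<theta>"] * by (simp only: sin_minus cos_minus scaleR_minus_left)
    qed
    finally show ?thesis unfolding r_alt[of \<theta>] .
  qed
  then show ?thesis using w(1) by blast
qed

text \<open>A Coxeter element: reflections in two lines of the plane at angle \<open>\<phi>\<close>
  compose to the rotation by \<open>2 * \<phi>\<close>.\<close>

lemma exists_rotation: "\<exists>w\<in>W. \<forall>\<theta>. w *v r \<theta> = r (2 * \<phi> + \<theta>)"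
proof -
  from exists_reflection_I obtain w1 where w1: "w1 \<in> W" "\<forall>\<theta>. w1 *v r \<theta> = r (- \<theta>)" by blast
  from exists_reflection_J obtain w2 where w2: "w2 \<in> W" "\<forall>\<theta>. w2 *v r \<theta> = r (2 * \<phi> - \<theta>)" by blast
  show ?thesis
    by (rule bexI[of _ "w2 ** w1"])
      (use w1 w2 in \<open>simp_all add: matrix_vector_mul_assoc[symmetric] refl_prods_mult\<close>)
qed

lemma Pos_r:
  assumes "b \<in> Pos x0"
  obtains c where "\<And>d. d \<in> D \<Longrightarrow> c d \<ge> 0" "b = (\<Sum>d\<in>D. c d *\<^sub>R d)"
    "\<And>\<theta>. b \<bullet> r \<theta> = (\<Sum>i\<in>I. c i * (u \<bullet> i)) * sin \<theta> + (\<Sum>j\<in>J. c j * (v \<bullet> j)) * sin (\<phi> - \<theta>)"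
proof -
  from Pos_cone[OF assms] obtain c where c: "\<forall>d\<in>D. c d \<ge> 0" "b = (\<Sum>d\<in>D. c d *\<^sub>R d)" by blast
  have fin: "finite I" "finite J" using orthonormal_I orthonormal_J by (auto simp: orthonormal_def)
  have "b \<bullet> r \<theta> = (\<Sum>i\<in>I. c i * (u \<bullet> i)) * sin \<theta> + (\<Sum>j\<in>J. c j * (v \<bullet> j)) * sin (\<phi> - \<theta>)" for \<theta>
    unfolding c(2) I_Un_J[symmetric] sum.union_disjoint[OF fin I_Int_J] inner_add_left inner_sum_left
    by (simp add: r_inner_I r_inner_J sum_distrib_right mult.assoc)
  then show thesis using that c by blast
qed

lemma nonneg_sum_zero_imp:
  assumes "orthonormal S" "S \<subseteq> D" "\<And>d. d \<in> D \<Longrightarrow> c d \<ge> 0" "\<And>s. s \<in> S \<Longrightarrow> y s > 0"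
    and "(\<Sum>s\<in>S. c s * y s) \<le> (0::real)" "s \<in> S"
  shows "c s = 0"
proof (rule ccontr)
  assume "c s \<noteq> 0"
  then have "c s > 0" using assms(2,3,6) by (metis order_less_le subsetD)
  moreover have "finite S" using assms(1) by (simp add: orthonormal_def)
  ultimately have "(\<Sum>s\<in>S. c s * y s) > 0"
    using assms by (intro sum_pos2[of _ s]) (auto intro!: mult_nonneg_nonneg less_imp_le[OF assms(4)])
  then show False using assms(5) by simp
qed

text \<open>Both sines in \<open>Pos_r\<close> are positive inside the sector, so a positive root
  can vanish there only if all of its coordinates do. The plane therefore meets the open
  chamber.\<close>

lemma sector_regular:
  assumes "0 < \<theta>" "\<theta> < \<phi>" "b \<in> \<Phi>"
  shows "b \<bullet> r \<theta> \<noteq> 0"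
proof -
  have pos: "b \<bullet> r \<theta> > 0" if b: "b \<in> Pos x0" for b
  proof (rule ccontr)
    assume not_pos: "\<not> b \<bullet> r \<theta> > 0"
    obtain c where c: "\<And>d. d \<in> D \<Longrightarrow> c d \<ge> 0" "b = (\<Sum>d\<in>D. c d *\<^sub>R d)"
      "\<And>\<theta>. b \<bullet> r \<theta> = (\<Sum>i\<in>I. c i * (u \<bullet> i)) * sin \<theta> + (\<Sum>j\<in>J. c j * (v \<bullet> j)) * sin (\<phi> - \<theta>)"
      using Pos_r[OF b] by blast
    have s: "sin \<theta> > 0" "sin (\<phi> - \<theta>) > 0" using assms phi_bounds by (auto intro!: sin_gt_zero)
    have sub: "I \<subseteq> D" "J \<subseteq> D" using I_Un_J by auto
    have nn: "(\<Sum>i\<in>I. c i * (u \<bullet> i)) \<ge> 0" "(\<Sum>j\<in>J. c j * (v \<bullet> j)) \<ge> 0"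
      by (intro sum_nonneg mult_nonneg_nonneg c(1) less_imp_le[OF u_pos] less_imp_le[OF v_pos]
          sub[THEN subsetD]; assumption)+
    have "(\<Sum>i\<in>I. c i * (u \<bullet> i)) * sin \<theta> \<ge> 0" "(\<Sum>j\<in>J. c j * (v \<bullet> j)) * sin (\<phi> - \<theta>) \<ge> 0"
      using nn s by simp_all
    then have "(\<Sum>i\<in>I. c i * (u \<bullet> i)) * sin \<theta> \<le> 0" "(\<Sum>j\<in>J. c j * (v \<bullet> j)) * sin (\<phi> - \<theta>) \<le> 0"
      using not_pos unfolding c(3) by linarith+
    then have le: "(\<Sum>i\<in>I. c i * (u \<bullet> i)) \<le> 0" "(\<Sum>j\<in>J. c j * (v \<bullet> j)) \<le> 0"
      using s by (simp_all add: mult_le_0_iff)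
    have "c d = 0" if "d \<in> D" for d
      using nonneg_sum_zero_imp[OF orthonormal_I sub(1) c(1) u_pos le(1)]
        nonneg_sum_zero_imp[OF orthonormal_J sub(2) c(1) v_pos le(2)] that I_Un_J by blast
    then have "b = 0" unfolding c(2) by simp
    then show False using b root_nonzero by (auto simp: Pos_def)
  qed
  show ?thesis using root_Pos_cases[OF regular_x0 assms(3)] pos[of b] pos[of "- b"] by auto
qed

definition "\<Theta> = {\<theta>. \<exists>b\<in>\<Phi>. b \<bullet> r \<theta> = 0}"

lemma Theta_image:
  assumes "w \<in> W" "w *v r \<theta> = r \<theta>'" "\<theta> \<in> \<Theta>"
  shows "\<theta>' \<in> \<Theta>"
proof -
  obtain b where b: "b \<in> \<Phi>" "b \<bullet> r \<theta> = 0" using assms(3) by (auto simp: \<Theta>_def)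
  have "(w *v b) \<bullet> r \<theta>' = 0" using W_inner[OF assms(1), of b "r \<theta>"] assms(2) b by simp
  then show ?thesis using W_root[OF assms(1) b(1)] by (auto simp: \<Theta>_def)
qed

lemma Theta_neg: "\<theta> \<in> \<Theta> \<Longrightarrow> - \<theta> \<in> \<Theta>"
  using exists_reflection_I Theta_image by blast

lemma Theta_rotate: "\<theta> \<in> \<Theta> \<Longrightarrow> 2 * \<phi> + \<theta> \<in> \<Theta>"
  using exists_rotation Theta_image by blast

lemma Theta_pi: "\<theta> \<in> \<Theta> \<Longrightarrow> \<theta> + pi \<in> \<Theta>"
  by (auto simp: \<Theta>_def r_pi)

lemma Theta_sector: "0 < \<theta> \<Longrightarrow> \<theta> < \<phi> \<Longrightarrow> \<theta> \<notin> \<Theta>"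
  using sector_regular by (auto simp: \<Theta>_def)

lemma Theta_multiples: "real k * \<phi> \<in> \<Theta>"
proof (induct k rule: induct_nat_012)
  case 0
  obtain i where "i \<in> I" using I_nonempty by blast
  then show ?case using r_inner_I[of i 0] I_Un_J D_roots by (auto simp: \<Theta>_def)
next
  case 1
  obtain j where "j \<in> J" using J_nonempty by blast
  then show ?case using r_inner_J[of j \<phi>] I_Un_J D_roots by (auto simp: \<Theta>_def)
next
  case (ge2 k)
  then show ?case using Theta_rotate[of "real k * \<phi>"] by (simp add: algebra_simps)
qed

lemma Theta_reduce: "\<theta> + real k * (2 * \<phi>) \<in> \<Theta> \<Longrightarrow> \<theta> \<in> \<Theta>"
proof (induct k arbitrary: \<theta>)
  case (Suc k)
  have "- (\<theta> + real k * (2 * \<phi>)) \<in> \<Theta>"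
    using Theta_rotate[OF Theta_neg[OF Suc(2)]] by (simp add: algebra_simps)
  from Theta_neg[OF this] have "\<theta> + real k * (2 * \<phi>) \<in> \<Theta>" by (simp only: minus_minus)
  then show ?case by (rule Suc(1))
qed simp

text \<open>Rotation by \<open>2 * \<phi>\<close> and reflection fold every angle into the sector
  from 0 to \<open>\<phi>\<close>, whose interior contains no singular angle.\<close>

lemma Theta_eq_multiple:
  assumes "\<theta> \<in> \<Theta>" "\<theta> \<ge> 0"
  shows "\<exists>k::nat. \<theta> = real k * \<phi>"
proof -
  define k where "k = nat \<lfloor>\<theta> / \<phi>\<rfloor>"
  define \<delta> where "\<delta> = \<theta> - real k * \<phi>"
  have "real k = of_int \<lfloor>\<theta> / \<phi>\<rfloor>" using assms(2) phi_bounds by (simp add: k_def)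
  then have "real k \<le> \<theta> / \<phi>" "\<theta> / \<phi> < real k + 1" by linarith+
  then have \<delta>: "0 \<le> \<delta>" "\<delta> < \<phi>" using phi_bounds by (simp_all add: \<delta>_def field_simps)
  have "\<delta> = 0"
  proof (cases "even k")
    case True
    then obtain n where "k = 2 * n" by blast
    then have "\<delta> + real n * (2 * \<phi>) \<in> \<Theta>" using assms(1) by (simp add: \<delta>_def algebra_simps)
    then show ?thesis using Theta_reduce Theta_sector[of \<delta>] \<delta> by fastforce
  next
    case False
    then obtain n where "k = 2 * n + 1" by (elim oddE)
    then have "- (\<phi> - \<delta>) + real (n + 1) * (2 * \<phi>) \<in> \<Theta>" using assms(1) by (simp add: \<delta>_def algebra_simps)
    from Theta_neg[OF Theta_reduce[OF this]] have "\<phi> - \<delta> \<in> \<Theta>" by (simp only: minus_minus)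
    then show ?thesis using Theta_sector[of "\<phi> - \<delta>"] \<delta> by force
  qed
  then show ?thesis by (auto simp: \<delta>_def)
qed

definition "m = nat \<lfloor>pi / \<phi>\<rfloor>"

text \<open>The angle \<open>pi\<close> is singular because opposite rays lie on the same mirrors.
  So it is a multiple of \<open>\<phi>\<close>, and the floor in \<open>m\<close> is exact.\<close>

lemma m_phi: "real m * \<phi> = pi"
proof -
  have "pi \<in> \<Theta>" using Theta_pi[OF Theta_multiples[of 0]] by simp
  then obtain k :: nat where k: "pi = real k * \<phi>" using Theta_eq_multiple[of pi] by auto
  then have "pi / \<phi> = real k" using phi_bounds by (simp add: field_simps)
  then have "m = k" by (simp add: m_def)
  then show ?thesis using k by simp
qed

lemma m_pos: "m > 0"
  using m_phi by (metis mult_zero_left of_nat_0 pi_neq_zero gr0I)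

definition "vanishing \<theta> = {b \<in> \<Phi>. b \<bullet> r \<theta> = 0}"

lemma finite_vanishing: "finite (vanishing \<theta>)"
  using finite_roots by (simp add: vanishing_def)

lemma card_vanishing_rotate: "card (vanishing (2 * \<phi> + \<theta>)) \<le> card (vanishing \<theta>)"
proof -
  from exists_rotation obtain w where w: "w \<in> W" "\<forall>\<theta>. w *v r \<theta> = r (2 * \<phi> + \<theta>)" by blast
  have wt: "transpose w \<in> W" using refl_prods_transpose[OF w(1)] .
  show ?thesis
  proof (rule card_inj_on_le[OF _ _ finite_vanishing])
    show "inj_on ((*v) (transpose w)) (vanishing (2 * \<phi> + \<theta>))"
    proof (rule inj_onI)
      fix x y assume "transpose w *v x = transpose w *v y"
      then have "(w ** transpose w) *v x = (w ** transpose w) *v y"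
        by (simp add: matrix_vector_mul_assoc[symmetric])
      then show "x = y" using W_transpose(2)[OF w(1)] by simp
    qed
    show "(*v) (transpose w) ` vanishing (2 * \<phi> + \<theta>) \<subseteq> vanishing \<theta>"
    proof (rule image_subsetI)
      fix b assume b: "b \<in> vanishing (2 * \<phi> + \<theta>)"
      have "(transpose w *v b) \<bullet> r \<theta> = b \<bullet> (w *v r \<theta>)"
        by (simp add: inner_matrix_transpose)
      then show "transpose w *v b \<in> vanishing \<theta>"
        using b w(2) W_root[OF wt] by (simp add: vanishing_def)
    qed
  qed
qed

text \<open>Orthogonality of \<open>S\<close> makes \<open>refl s\<close> turn the coordinate
  \<open>c s\<close> into \<open>- c s\<close>, while \<open>simple_refl_Pos\<close> keeps every
  positive root other than \<open>s\<close> positive.\<close>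

lemma orthonormal_combination_simple:
  assumes "orthonormal S" "S \<subseteq> D" "\<And>s. s \<in> S \<Longrightarrow> c s \<ge> 0" "(\<Sum>s\<in>S. c s *\<^sub>R s) \<in> Pos x0"
  shows "(\<Sum>s\<in>S. c s *\<^sub>R s) \<in> S"
proof -
  define b where "b = (\<Sum>s\<in>S. c s *\<^sub>R s)"
  have b: "b \<in> Pos x0" using assms(4) by (simp add: b_def)
  then have "b \<noteq> 0" using root_nonzero by (auto simp: Pos_def)
  then obtain s where s: "s \<in> S" "c s \<noteq> 0" unfolding b_def by (metis (no_types, lifting) scale_zero_left sum.neutral)
  then have cs: "c s > 0" using assms(3) by (simp add: order_less_le)
  have sD: "s \<in> D" using s assms(2) by blast
  have "b = s"
  proof (rule ccontr)
    assume "b \<noteq> s"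
    from Pos_cone[OF simple_refl_Pos[OF sD b this]] obtain c'
      where c': "\<forall>d\<in>D. c' d \<ge> 0" "refl s *v b = (\<Sum>d\<in>D. c' d *\<^sub>R d)" by blast
    have sb: "s \<bullet> b = c s"
      unfolding b_def inner_commute[of s] by (rule orthonormal_expansion(1)[OF assms(1) s(1)])
    have b_sum: "b = (\<Sum>d\<in>D. (if d \<in> S then c d else 0) *\<^sub>R d)"
      unfolding b_def using assms(2) finite_D
      by (intro sum.mono_neutral_cong_left) auto
    have "refl s *v b = (\<Sum>d\<in>D. ((if d \<in> S then c d else 0) + (if d = s then - (2 * c s) else 0)) *\<^sub>R d)"
      unfolding sum_D_update[OF sD] b_sum[symmetric] by (simp add: refl_vector sb)
    from D_coeff_unique[OF trans[OF c'(2)[symmetric] this] sD] have "c' s = - c s" using s by simp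
    then show False using c'(1) sD cs by force
  qed
  then show ?thesis using s(1) by (simp add: b_def)
qed

text \<open>On the ray at angle 0 only the coordinates in \<open>J\<close> contribute, so they
  vanish; at angle \<open>\<phi>\<close> the same holds for those in \<open>I\<close>. A positive
  root supported on one class is simple.\<close>

lemma Pos_vanishing:
  assumes "b \<in> Pos x0"
  shows "b \<bullet> r 0 = 0 \<Longrightarrow> b \<in> I" and "b \<bullet> r \<phi> = 0 \<Longrightarrow> b \<in> J"
proof -
  obtain c where c: "\<And>d. d \<in> D \<Longrightarrow> c d \<ge> 0" "b = (\<Sum>d\<in>D. c d *\<^sub>R d)"
    "\<And>\<theta>. b \<bullet> r \<theta> = (\<Sum>i\<in>I. c i * (u \<bullet> i)) * sin \<theta> + (\<Sum>j\<in>J. c j * (v \<bullet> j)) * sin (\<phi> - \<theta>)"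
    using Pos_r[OF assms] by blast
  have sub: "I \<subseteq> D" "J \<subseteq> D" using I_Un_J by auto
  have fin: "finite I" "finite J" using orthonormal_I orthonormal_J by (auto simp: orthonormal_def)
  have split: "b = (\<Sum>i\<in>I. c i *\<^sub>R i) + (\<Sum>j\<in>J. c j *\<^sub>R j)"
    unfolding c(2) I_Un_J[symmetric] sum.union_disjoint[OF fin I_Int_J] ..
  have simple: "b \<in> S" if S: "orthonormal S" "S \<subseteq> D" "b = (\<Sum>s\<in>S. c s *\<^sub>R s)" for S
    using orthonormal_combination_simple[OF S(1,2), of c] c(1) S(2) assms unfolding S(3)[symmetric]
    by blast
  show "b \<in> I" if "b \<bullet> r 0 = 0"
  proof -
    have le: "(\<Sum>j\<in>J. c j * (v \<bullet> j)) \<le> 0" using c(3)[of 0] that sin_phi by simp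
    have "c j = 0" if "j \<in> J" for j
      using nonneg_sum_zero_imp[OF orthonormal_J sub(2) c(1) v_pos le that] .
    then show ?thesis using split by (intro simple[OF orthonormal_I sub(1)]) simp
  qed
  show "b \<in> J" if "b \<bullet> r \<phi> = 0"
  proof -
    have le: "(\<Sum>i\<in>I. c i * (u \<bullet> i)) \<le> 0" using c(3)[of \<phi>] that sin_phi by simp
    have "c i = 0" if "i \<in> I" for i
      using nonneg_sum_zero_imp[OF orthonormal_I sub(1) c(1) u_pos le that] .
    then show ?thesis using split by (intro simple[OF orthonormal_J sub(2)]) simp
  qed
qed

lemma card_vanishing_le:
  assumes "finite S" "\<And>b. b \<in> Pos x0 \<Longrightarrow> b \<bullet> r \<theta> = 0 \<Longrightarrow> b \<in> S"
  shows "card (vanishing \<theta>) \<le> 2 * card S"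
proof -
  have "vanishing \<theta> \<subseteq> S \<union> uminus ` S"
  proof
    fix b assume b: "b \<in> vanishing \<theta>"
    then have "b \<in> Pos x0 \<or> - b \<in> Pos x0" using root_Pos_cases[OF regular_x0] by (simp add: vanishing_def)
    then have "b \<in> S \<or> - b \<in> S" using assms(2)[of b] assms(2)[of "- b"] b by (auto simp: vanishing_def)
    then show "b \<in> S \<union> uminus ` S" by (metis UnI1 UnI2 image_eqI minus_minus)
  qed
  then have "card (vanishing \<theta>) \<le> card (S \<union> uminus ` S)" using assms(1) by (intro card_mono) auto
  also have "\<dots> \<le> card S + card (uminus ` S)" by (rule card_Un_le)
  also have "\<dots> \<le> 2 * card S" using card_image_le[OF assms(1), of uminus] by simp
  finally show ?thesis .
qed

text \<open>Rays whose indices differ by 2 correspond under the Coxeter element, so only the two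
  walls of the fundamental sector have to be inspected.\<close>

lemma card_vanishing_multiple:
  "card (vanishing (real k * \<phi>)) \<le> (if even k then 2 * card I else 2 * card J)"
proof (induct k rule: induct_nat_012)
  case 0
  show ?case using card_vanishing_le[of I 0] Pos_vanishing(1) orthonormal_I by (simp add: orthonormal_def)
next
  case 1
  show ?case using card_vanishing_le[of J \<phi>] Pos_vanishing(2) orthonormal_J by (simp add: orthonormal_def)
next
  case (ge2 k)
  have "real (Suc (Suc k)) * \<phi> = 2 * \<phi> + real k * \<phi>" by (simp add: algebra_simps)
  then show ?case using card_vanishing_rotate[of "real k * \<phi>"] ge2(1) by auto
qed

text \<open>The value on the rays changes sign over a half turn, so the root vanishes at one
  multiple of \<open>\<phi>\<close> below \<open>pi\<close> and again at the opposite ray.\<close>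

lemma root_vanishes_twice:
  assumes "b \<in> \<Phi>"
  shows "2 \<le> card {k \<in> {..<2 * m}. b \<bullet> r (real k * \<phi>) = 0}"
proof -
  have cont: "continuous_on {0..pi} (\<lambda>\<theta>. b \<bullet> r \<theta>)"
    unfolding r_def by (intro continuous_intros)
  have rpi: "b \<bullet> r pi = - (b \<bullet> r 0)" using r_pi[of 0] by simp
  have "\<exists>\<theta>. 0 \<le> \<theta> \<and> \<theta> \<le> pi \<and> b \<bullet> r \<theta> = 0"
  proof (cases "b \<bullet> r 0 \<le> 0")
    case True
    then show ?thesis using IVT'[of "\<lambda>\<theta>. b \<bullet> r \<theta>" 0 0 pi] rpi cont by auto
  next
    case False
    then show ?thesis using IVT2'[of "\<lambda>\<theta>. b \<bullet> r \<theta>" pi 0 0] rpi cont by auto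
  qed
  then obtain \<theta>' where \<theta>': "0 \<le> \<theta>'" "\<theta>' \<le> pi" "b \<bullet> r \<theta>' = 0" by blast
  \<comment> \<open>A zero at \<open>pi\<close> is moved to 0, so that the index stays below
    \<open>m\<close>.\<close>
  define \<theta> where "\<theta> = (if \<theta>' = pi then 0 else \<theta>')"
  have \<theta>: "0 \<le> \<theta>" "\<theta> < pi" "b \<bullet> r \<theta> = 0" using \<theta>' rpi by (auto simp: \<theta>_def)
  then have "\<theta> \<in> \<Theta>" using assms by (auto simp: \<Theta>_def)
  then obtain k :: nat where k: "\<theta> = real k * \<phi>" using Theta_eq_multiple \<theta>(1) by blast
  have "real k * \<phi> < real m * \<phi>" using \<theta>(2) k m_phi by simp
  then have km: "k < m" using phi_bounds by simp
  have "real (k + m) * \<phi> = \<theta> + pi" using k m_phi by (simp add: algebra_simps)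
  then have "{k, k + m} \<subseteq> {k \<in> {..<2 * m}. b \<bullet> r (real k * \<phi>) = 0}"
    using km \<theta>(3) k by (simp add: r_pi)
  then have "card {k, k + m} \<le> card {k \<in> {..<2 * m}. b \<bullet> r (real k * \<phi>) = 0}"
    by (intro card_mono) auto
  then show ?thesis using m_pos by simp
qed

text \<open>Count the pairs of a root and one of the \<open>2 * m\<close> rays on which it vanishes:
  each root occurs at least twice, and each ray carries at most twice the size of its colour
  class.\<close>

lemma card_roots_le: "card \<Phi> \<le> m * CARD('n)"
proof -
  have card_filter: "card {x \<in> X. P x} = (\<Sum>x\<in>X. if P x then 1 else 0)" if "finite X"
    for X :: "'z set" and P using that by (simp add: sum.If_cases Int_def)
  have alternate: "(\<Sum>k<2 * n. if even k then a else b) = n * (a + b)" for n a b :: nat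
    by (induct n) (simp_all add: algebra_simps)
  have "2 * card \<Phi> = (\<Sum>b\<in>\<Phi>. 2)" by simp
  also have "\<dots> \<le> (\<Sum>b\<in>\<Phi>. card {k \<in> {..<2 * m}. b \<bullet> r (real k * \<phi>) = 0})"
    by (intro sum_mono root_vanishes_twice)
  also have "\<dots> = (\<Sum>b\<in>\<Phi>. \<Sum>k<2 * m. if b \<bullet> r (real k * \<phi>) = 0 then 1 else 0)"
    by (intro sum.cong[OF refl] card_filter) simp
  also have "\<dots> = (\<Sum>k<2 * m. \<Sum>b\<in>\<Phi>. if b \<bullet> r (real k * \<phi>) = 0 then 1 else 0)" by (rule sum.swap)
  also have "\<dots> = (\<Sum>k<2 * m. card (vanishing (real k * \<phi>)))"
    unfolding vanishing_def by (intro sum.cong[OF refl] card_filter[symmetric] finite_roots)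
  also have "\<dots> \<le> (\<Sum>k<2 * m. if even k then 2 * card I else 2 * card J)"
    by (intro sum_mono card_vanishing_multiple)
  also have "\<dots> = m * (2 * card I + 2 * card J)"
    by (rule alternate)
  also have "card I + card J = CARD('n)"
    using card_Un_disjoint[OF _ _ I_Int_J] orthonormal_I orthonormal_J card_D
    by (simp add: I_Un_J orthonormal_def)
  then have "m * (2 * card I + 2 * card J) = 2 * (m * CARD('n))" by (simp add: algebra_simps flip: distrib_left)
  finally show ?thesis by simp
qed

end

section \<open>Complexification of real vectors and matrices\<close>

definition emb :: "real ^ 'n \<Rightarrow> complex ^ 'n::finite" where
  "emb x = (\<chi> i. complex_of_real (x $ i))"

definition cmat :: "real ^ 'n ^ 'm \<Rightarrow> complex ^ 'n::finite ^ 'm::finite" where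
  "cmat M = (\<chi> i j. complex_of_real (M $ i $ j))"

lemma emb_add: "emb (x + y) = emb x + emb y" and emb_scaleR: "emb (c *\<^sub>R x) = complex_of_real c *s emb x"
  and emb_uminus: "emb (- x) = - emb x" and emb_diff: "emb (x - y) = emb x - emb y"
  by (simp_all add: emb_def vec_eq_iff)

lemma emb_eq_iff: "emb x = emb y \<longleftrightarrow> x = y"
  by (simp add: emb_def vec_eq_iff)

lemma emb_eq_0_iff: "emb x = 0 \<longleftrightarrow> x = 0"
  by (simp add: emb_def vec_eq_iff)

lemma cmat_mult_emb: "cmat M *v emb x = emb (M *v x)"
  by (simp add: emb_def cmat_def vec_eq_iff matrix_vector_mult_def)

lemma cmat_mult: "cmat (M ** N) = cmat M ** cmat N"
  by (simp add: cmat_def vec_eq_iff matrix_matrix_mult_def)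

lemma cmat_one: "cmat (mat 1) = mat 1"
  by (simp add: cmat_def vec_eq_iff mat_def)

lemma cmat_transpose: "cmat (transpose M) = transpose (cmat M)"
  by (simp add: cmat_def vec_eq_iff transpose_def)

lemma cdot_emb: "cdot (emb x) (emb y) = complex_of_real (x \<bullet> y)"
  by (simp add: cdot_def emb_def inner_vec_def)

lemma emb_complex_eq_iff: "emb x + \<i> *s emb y = emb x' + \<i> *s emb y' \<longleftrightarrow> x = x' \<and> y = y'"
  by (auto simp: emb_def vec_eq_iff complex_eq_iff)

lemma real_imag_parts:
  obtains p q where "x = emb p + \<i> *s emb q"
proof -
  have "x = emb (\<chi> i. Re (x $ i)) + \<i> *s emb (\<chi> i. Im (x $ i))"
    by (simp add: emb_def vec_eq_iff complex_eq_iff)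
  then show thesis by (rule that)
qed

lemma cmat_mult_complex:
  "cmat M *v (emb x + \<i> *s emb y) = emb (M *v x) + \<i> *s emb (M *v y)"
  by (simp add: matrix_vector_right_distrib vector_scalar_commute cmat_mult_emb)

context reflection_group begin

text \<open>\<open>f + \<i> u\<close> diagonalises the rotation of the plane; the minus sign in the
  exponent comes from this choice rather than the conjugate vector. An element fixing it fixes
  \<open>f\<close> and \<open>u\<close>, hence the regular ray in the middle of the sector.\<close>

lemma exists_regular_eigenvector:
  "\<exists>z m c. m > 0 \<and> c \<in> W \<and> cmat c *v z = cis (- 2 * pi / real m) *s z \<and>
    (\<forall>w\<in>W. cmat w *v z = z \<longrightarrow> w = mat 1) \<and> card \<Phi> \<le> m * CARD('n)"
proof -
  obtain x0 where "regular x0" using exists_regular by blast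
  then obtain D where "simple_system A x0 D" using exists_simple_system by blast
  then interpret simple_system A x0 D .
  obtain I J u v l where "coxeter_plane A x0 D I J u v l" using exists_coxeter_plane by blast
  then interpret coxeter_plane A x0 D I J u v l .
  define z where "z = emb f + \<i> *s emb u"
  obtain c where c: "c \<in> W" "\<And>\<theta>. c *v r \<theta> = r (2 * \<phi> + \<theta>)" using exists_rotation by blast
  have f: "f = r 0" and u: "u = r (pi / 2)" by (simp_all add: r_def)
  have "c *v f = r (2 * \<phi>)" using c(2)[of 0] f by simp
  moreover have "c *v u = cos (2 * \<phi>) *\<^sub>R u - sin (2 * \<phi>) *\<^sub>R f"
    using c(2)[of "pi / 2"] u by (simp add: r_def cos_add sin_add)
  ultimately have "cmat c *v z = cis (- (2 * \<phi>)) *s z"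
    unfolding z_def cmat_mult_complex
    by (simp add: r_def emb_add emb_diff emb_scaleR emb_def vec_eq_iff cis.ctr complex_eq_iff)
  moreover have "2 * \<phi> = 2 * pi / real m" using m_phi m_pos by (simp add: field_simps)
  moreover have "w = mat 1" if w: "w \<in> W" "cmat w *v z = z" for w
  proof -
    have "w *v f = f" "w *v u = u"
      using w(2) unfolding z_def cmat_mult_complex emb_complex_eq_iff by blast+
    then have "w *v r (\<phi> / 2) = r (\<phi> / 2)"
      by (simp add: r_def matrix_vector_right_distrib matrix_vector_mult_scaleR)
    moreover have "regular (r (\<phi> / 2))"
      using sector_regular[of "\<phi> / 2"] phi_bounds by (simp add: regular_def)
    ultimately show ?thesis using stabilizer_regular w(1) by blast
  qed
  ultimately show ?thesis using c(1) m_pos card_roots_le by (auto intro!: exI[of _ z])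
qed

end

section \<open>Invariants and their Jacobian\<close>

text \<open>The generated algebra at the level of functions, given by rules, so that the chain rule
  and the reduction modulo the generators become inductions.\<close>

inductive_set alg_gen :: "(complex ^ 'n::finite \<Rightarrow> complex) set \<Rightarrow> (complex ^ 'n \<Rightarrow> complex) set"
  for B where
  const: "(\<lambda>x. c) \<in> alg_gen B"
| gen: "f \<in> B \<Longrightarrow> f \<in> alg_gen B"
| add: "f \<in> alg_gen B \<Longrightarrow> g \<in> alg_gen B \<Longrightarrow> (\<lambda>x. f x + g x) \<in> alg_gen B"
| mult: "f \<in> alg_gen B \<Longrightarrow> g \<in> alg_gen B \<Longrightarrow> (\<lambda>x. f x * g x) \<in> alg_gen B"

lemma det_zero_iff_kernel:
  fixes M :: "'a::field ^ 'n ^ 'n"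
  shows "det M \<noteq> 0 \<longleftrightarrow> (\<forall>x. M *v x = 0 \<longrightarrow> x = 0)"
  unfolding invertible_det_nz[symmetric] invertible_left_inverse matrix_left_invertible_ker ..

lemma det_nonzero_spanning_rows:
  fixes M :: "'a::field ^ 'n ^ 'n"
  assumes "\<And>v. \<exists>g. v = (\<Sum>k\<in>UNIV. g k *s M $ k)"
  shows "det M \<noteq> 0"
proof -
  have "surj ((*v) (transpose M))"
    unfolding surj_def
  proof
    fix v
    obtain g where "v = (\<Sum>k\<in>UNIV. g k *s M $ k)" using assms by blast
    then have "transpose M *v (\<chi> k. g k) = v"
      by (simp add: vec_eq_iff matrix_vector_mult_def transpose_def mult.commute)
    then show "\<exists>x. v = transpose M *v x" by metis
  qed
  then have "invertible (transpose M)"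
    unfolding invertible_right_inverse matrix_right_invertible_surjective .
  then show ?thesis unfolding invertible_det_nz by simp
qed

lemma matrix_rows_mult:
  fixes M :: "'a::comm_ring_1 ^ 'n ^ 'm"
  shows "(\<chi> i. \<Sum>k\<in>UNIV. g i k *s M $ k) = (\<chi> i k. g i k) ** M"
  by (simp add: vec_eq_iff matrix_matrix_mult_def)

lemma alg_gen_pfun:
  assumes "\<And>f. f \<in> B \<Longrightarrow> pfun f"
  shows "q \<in> alg_gen B \<Longrightarrow> pfun q"
  by (induct rule: alg_gen.induct) (auto intro: pfun.intros assms)

text \<open>Chain rule with unnamed coefficients: they are the partial derivatives of an expression
  of \<open>q\<close> in the generators.\<close>

lemma alg_gen_gradient:
  assumes P: "\<And>k. pfun (P k)"
  assumes "q \<in> alg_gen (range (P :: 'n::finite \<Rightarrow> complex ^ 'n \<Rightarrow> complex))"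
  shows "\<exists>g. (\<forall>k. pfun (g k)) \<and> (\<forall>x. grad q x = (\<Sum>k\<in>UNIV. g k x *s grad (P k) x))"
  using assms(2)
proof induct
  case (const c)
  show ?case by (rule exI[of _ "\<lambda>_ _. 0"]) (simp add: grad_const pfun.const)
next
  case (gen f)
  then obtain k where "f = P k" by blast
  have "(\<Sum>i\<in>UNIV. (if i = k then 1 else 0) *s grad (P i) x) = grad f x" for x
    by (simp add: \<open>f = P k\<close> if_distrib[of "\<lambda>c. c *s _"] cong: if_cong)
  then show ?case
    by (intro exI[of _ "\<lambda>i x. if i = k then 1 else 0"]) (auto intro: pfun.const)
next
  case (add f g)
  then obtain f' g' where *: "\<forall>k. pfun (f' k)" "\<And>x. grad f x = (\<Sum>k\<in>UNIV. f' k x *s grad (P k) x)"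
    "\<forall>k. pfun (g' k)" "\<And>x. grad g x = (\<Sum>k\<in>UNIV. g' k x *s grad (P k) x)" by blast
  have "pfun f" "pfun g" by (rule alg_gen_pfun[of "range P"]; use add P in auto)+
  then have "grad (\<lambda>x. f x + g x) x = (\<Sum>k\<in>UNIV. (f' k x + g' k x) *s grad (P k) x)" for x
    by (simp add: grad_add * vec.scale_left_distrib sum.distrib)
  then show ?case using *(1,3)
    by (intro exI[of _ "\<lambda>k x. f' k x + g' k x"]) (auto intro: pfun.add)
next
  case (mult f g)
  then obtain f' g' where *: "\<forall>k. pfun (f' k)" "\<And>x. grad f x = (\<Sum>k\<in>UNIV. f' k x *s grad (P k) x)"
    "\<forall>k. pfun (g' k)" "\<And>x. grad g x = (\<Sum>k\<in>UNIV. g' k x *s grad (P k) x)" by blast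
  have fg: "pfun f" "pfun g" by (rule alg_gen_pfun[of "range P"]; use mult P in auto)+
  then have "grad (\<lambda>x. f x * g x) x = (\<Sum>k\<in>UNIV. (f x * g' k x + g x * f' k x) *s grad (P k) x)" for x
    by (simp add: grad_mult * vec.scale_left_distrib sum.distrib vec.scale_sum_right)
  then show ?case using *(1,3) fg
    by (intro exI[of _ "\<lambda>k x. f x * g' k x + g x * f' k x"]) (auto intro!: pfun.add pfun.mult)
qed

text \<open>Modulo the functions \<open>P k - P k 0\<close> every element of the algebra is
  congruent to its value at 0. For \<open>P k\<close> of positive degree this puts the invariants
  vanishing at 0 into the ideal of the \<open>P k\<close>.\<close>

lemma alg_gen_ideal:
  assumes P: "\<And>k. pfun (P k)"
  assumes "q \<in> alg_gen (range (P :: 'n::finite \<Rightarrow> complex ^ 'n \<Rightarrow> complex))"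
  shows "\<exists>g. (\<forall>k. pfun (g k)) \<and> (\<forall>x. q x - q 0 = (\<Sum>k\<in>UNIV. g k x * (P k x - P k 0)))"
  using assms(2)
proof induct
  case (const c)
  show ?case by (rule exI[of _ "\<lambda>_ _. 0"]) (simp add: pfun.const)
next
  case (gen f)
  then obtain k where "f = P k" by blast
  have "(\<Sum>i\<in>UNIV. (if i = k then 1 else 0) * (P i x - P i 0)) = f x - f 0" for x
    by (simp add: \<open>f = P k\<close> if_distrib[of "\<lambda>c. c * _"] cong: if_cong)
  then show ?case
    by (intro exI[of _ "\<lambda>i x. if i = k then 1 else 0"]) (auto intro: pfun.const)
next
  case (add f g)
  then obtain f' g' where *: "\<forall>k. pfun (f' k)" "\<And>x. f x - f 0 = (\<Sum>k\<in>UNIV. f' k x * (P k x - P k 0))"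
    "\<forall>k. pfun (g' k)" "\<And>x. g x - g 0 = (\<Sum>k\<in>UNIV. g' k x * (P k x - P k 0))" by blast
  have "f x + g x - (f 0 + g 0) = (\<Sum>k\<in>UNIV. (f' k x + g' k x) * (P k x - P k 0))" for x
  proof -
    have "f x + g x - (f 0 + g 0) = (f x - f 0) + (g x - g 0)" by simp
    then show ?thesis unfolding * by (simp add: distrib_right sum.distrib)
  qed
  then show ?case using *(1,3)
    by (intro exI[of _ "\<lambda>k x. f' k x + g' k x"]) (auto intro: pfun.add)
next
  case (mult f g)
  then obtain f' g' where *: "\<forall>k. pfun (f' k)" "\<And>x. f x - f 0 = (\<Sum>k\<in>UNIV. f' k x * (P k x - P k 0))"
    "\<forall>k. pfun (g' k)" "\<And>x. g x - g 0 = (\<Sum>k\<in>UNIV. g' k x * (P k x - P k 0))" by blast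
  have fg: "pfun f" by (rule alg_gen_pfun[of "range P"]) (use mult P in auto)
  have "f x * g x - f 0 * g 0 = (\<Sum>k\<in>UNIV. (f x * g' k x + g 0 * f' k x) * (P k x - P k 0))" for x
  proof -
    have "f x * g x - f 0 * g 0 = f x * (g x - g 0) + g 0 * (f x - f 0)" by (simp add: algebra_simps)
    then show ?thesis unfolding *
      by (simp add: distrib_right sum.distrib sum_distrib_left mult.assoc)
  qed
  then show ?case using *(1,3) fg
    by (intro exI[of _ "\<lambda>k x. f x * g' k x + g 0 * f' k x"]) (auto intro!: pfun.add pfun.mult pfun.const)
qed

lemma grad_diff: "pfun f \<Longrightarrow> pfun g \<Longrightarrow> grad (\<lambda>x. f x - g x) x = grad f x - grad g x"
  using grad_add[of f "\<lambda>x. - 1 * g x"] grad_cmult[of g "- 1"]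
  by (simp add: pfun_minus vec_eq_iff)

lemma grad_one_minus_square:
  "pfun b \<Longrightarrow> grad (\<lambda>t. 1 - b t * b t) x = - 2 * b x *s grad b x"
  by (simp add: grad_diff grad_mult grad_const pfun.const pfun.mult vec_eq_iff)

lemma grad_homogeneous:
  assumes "pfun f" "\<And>x. f (t *s x) = t ^ e * f x" "e > 0" "t \<noteq> 0"
  shows "grad f (t *s x) = t ^ (e - 1) *s grad f x"
proof -
  have mat: "mat t *v y = t *s y" for y :: "complex ^ 'a"
    by (simp add: matrix_vector_mult_def mat_def vec_eq_iff if_distrib[of "\<lambda>c. c * _"] cong: if_cong)
  have "(\<lambda>y. f (mat t *v y)) = (\<lambda>y. t ^ e * f y)"
    unfolding mat using assms(2) by simp
  then have "transpose (mat t) *v grad f (mat t *v x) = t ^ e *s grad f x"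
    by (metis grad_cmult grad_compose_linear assms(1))
  then have "t *s grad f (t *s x) = t *s (t ^ (e - 1) *s grad f x)"
    using assms(3) by (simp add: transpose_mat mat power_eq_if)
  then show ?thesis using assms(4) by (simp add: vec.scale_left_imp_eq)
qed

lemma pfun_limit_origin:
  assumes "pfun f" "\<And>t. t \<noteq> 0 \<Longrightarrow> f (t *s x) = poly r t"
  shows "f 0 = poly r 0"
proof -
  obtain p where "\<And>t. f (0 + t *s x) = poly p t" using pfun_line_poly[OF assms(1)] by metis
  then have p: "\<And>t. f (t *s x) = poly p t" by simp
  \<comment> \<open>The factor \<open>[:0, 1:]\<close> covers \<open>t = 0\<close>, where the
    hypothesis says nothing.\<close>
  have "poly ([:0, 1:] * (p - r)) t = 0" for t
    using assms(2)[of t] p by (cases "t = 0") simp_all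
  then have "[:0, 1:] * (p - r) = 0" using poly_all_0_iff_0 by blast
  then have "p = r" by simp
  then show ?thesis using p[of 0] by simp
qed

lemma euler_homogeneous:
  assumes "pfun f" "\<And>t. t \<noteq> 0 \<Longrightarrow> f (t *s x) = t ^ e * f x"
  shows "cdot (grad f x) x = of_nat e * f x"
proof -
  have "((\<lambda>t. f (0 + t *s x)) has_field_derivative cdot (grad f (0 + 1 *s x)) x) (at 1)"
    by (rule has_field_derivative_pfun_line[OF assms(1)])
  then have 1: "((\<lambda>t. f (t *s x)) has_field_derivative cdot (grad f x) x) (at 1)" by simp
  have "((\<lambda>t. t ^ e * f x) has_field_derivative of_nat e * f x) (at 1)"
    by (auto intro!: derivative_eq_intros)
  then have "((\<lambda>t. f (t *s x)) has_field_derivative of_nat e * f x) (at 1)"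
    by (rule has_field_derivative_transform_within_open[of _ _ _ "- {0}"]) (auto simp: assms(2))
  from DERIV_unique[OF 1 this] show ?thesis .
qed

section \<open>Equivariance of gradients and averaging over the group\<close>

context reflection_group begin

definition "invariant q \<longleftrightarrow> pfun q \<and> (\<forall>w\<in>W. \<forall>x. q (cmat w *v x) = q x)"

lemma cmat_transpose_cancel: "w \<in> W \<Longrightarrow> cmat w *v (transpose (cmat w) *v x) = x"
  "w \<in> W \<Longrightarrow> transpose (cmat w) *v (cmat w *v x) = x"
  by (simp_all add: matrix_vector_mul_assoc W_transpose cmat_one flip: cmat_transpose cmat_mult)

lemma cdot_cmat: "w \<in> W \<Longrightarrow> cdot (cmat w *v x) (cmat w *v y) = cdot x y"
  by (simp add: cdot_matrix_left cmat_transpose_cancel)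

lemma invariant_grad:
  assumes "invariant q" "w \<in> W"
  shows "grad q (cmat w *v x) = cmat w *v grad q x"
proof -
  have "(\<lambda>x. q (cmat w *v x)) = q" using assms by (auto simp: invariant_def)
  then have "grad q x = transpose (cmat w) *v grad q (cmat w *v x)"
    using grad_compose_linear[of q "cmat w" x] assms(1) by (simp add: invariant_def)
  then show ?thesis by (simp add: cmat_transpose_cancel assms(2))
qed

lemma invariant_sum_orbit:
  assumes "pfun f"
  shows "invariant (\<lambda>x. \<Sum>w\<in>W. f (cmat w *v x))"
  unfolding invariant_def
proof (intro conjI ballI allI)
  show "pfun (\<lambda>x. \<Sum>w\<in>W. f (cmat w *v x))"
    by (intro pfun_sum pfun_compose[OF assms] pfun_matrix_vector)
  fix v x assume v: "v \<in> W"
  show "(\<Sum>w\<in>W. f (cmat w *v (cmat v *v x))) = (\<Sum>w\<in>W. f (cmat w *v x))"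
  proof (rule sum.reindex_bij_witness[of _ "\<lambda>w. w ** transpose v" "\<lambda>w. w ** v"])
    fix w assume "w \<in> W"
    show "w ** v ** transpose v = w" "w ** transpose v ** v = w"
      by (simp_all add: matrix_mul_assoc[symmetric] W_transpose v)
    show "w ** v \<in> W" "w ** transpose v \<in> W"
      using v \<open>w \<in> W\<close> by (auto intro: refl_prods_mult refl_prods_transpose)
    show "f (cmat (w ** v) *v x) = f (cmat w *v (cmat v *v x))"
      by (simp add: cmat_mult matrix_vector_mul_assoc)
  qed
qed

text \<open>The bump polynomial \<open>e\<close> equals 1 to first order at \<open>x\<close> and vanishes to first order at
  the other points of the orbit of \<open>x\<close>.\<close>

lemma exists_invariant_gradient:
  "\<exists>q. invariant q \<and> grad q x = (\<Sum>w | w \<in> W \<and> cmat w *v x = x. transpose (cmat w) *v v)"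
proof -
  define S where "S = (\<lambda>w. cmat w *v x) ` W - {x}"
  have finS: "finite S" using finite_W by (simp add: S_def)
  have "\<forall>y\<in>S. \<exists>i. y $ i \<noteq> x $ i" by (auto simp: S_def vec_eq_iff)
  then obtain i where i: "\<And>y. y \<in> S \<Longrightarrow> y $ i y \<noteq> x $ i y" by metis
  define b where "b t = (\<Prod>y\<in>S. (1 / (x $ i y - y $ i y)) * (t $ i y - y $ i y))" for t
  have pb: "pfun b" unfolding b_def by (intro pfun_intros)
  have bx: "b x = 1" unfolding b_def by (intro prod.neutral) (use i in \<open>force simp: field_simps\<close>)
  have bS: "b y = 0" if "y \<in> S" for y unfolding b_def using finS that by (intro prod_zero) auto
  \<comment> \<open>Applying \<open>1 - t^2\<close> twice keeps the values 0 and 1 of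
    \<open>b\<close> and makes the gradient vanish at both: \<open>grad e\<close> contains the
    factor \<open>k\<close> and, through \<open>grad k\<close>, the factor \<open>b\<close>, and one
    of the two is 0 at each point of the orbit.\<close>
  define k where "k t = 1 - b t * b t" for t
  define e where "e t = 1 - k t * k t" for t
  have pk: "pfun k" unfolding k_def by (intro pfun_intros pb)
  have pe: "pfun e" unfolding e_def by (intro pfun_intros pk)
  have gk: "grad k t = - 2 * b t *s grad b t" for t
    unfolding k_def by (rule grad_one_minus_square[OF pb])
  have ge: "grad e t = - 2 * k t *s grad k t" for t
    unfolding e_def by (rule grad_one_minus_square[OF pk])
  have e_orbit: "e (cmat w *v x) = (if cmat w *v x = x then 1 else 0)" "grad e (cmat w *v x) = 0"
    if "w \<in> W" for w
  proof -
    have "cmat w *v x = x \<or> cmat w *v x \<in> S" using that by (auto simp: S_def)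
    then show "e (cmat w *v x) = (if cmat w *v x = x then 1 else 0)" "grad e (cmat w *v x) = 0"
      unfolding ge gk using bx bS by (auto simp: e_def k_def S_def)
  qed
  \<comment> \<open>On the orbit \<open>grad f\<close> is \<open>v\<close> at \<open>x\<close> and 0
    elsewhere, so only the stabilizer of \<open>x\<close> contributes to the gradient of the sum
    over \<open>W\<close>.\<close>
  define f where "f t = e t * cdot v t" for t
  have pl: "pfun (\<lambda>t. cdot v t)" by (intro pfun_intros)
  have pf: "pfun f" unfolding f_def by (intro pfun.mult pe pl)
  have gf: "grad f t = e t *s v + cdot v t *s grad e t" for t
    unfolding f_def by (simp add: grad_mult pe pl grad_cdot_const)
  define q where "q t = (\<Sum>w\<in>W. f (cmat w *v t))" for t
  have "invariant q" unfolding q_def by (rule invariant_sum_orbit[OF pf])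
  have "grad q x = (\<Sum>w\<in>W. transpose (cmat w) *v grad f (cmat w *v x))"
    unfolding q_def
    by (simp add: grad_sum pfun_compose[OF pf] pfun_matrix_vector grad_compose_linear pf)
  also have "\<dots> = (\<Sum>w\<in>W. if cmat w *v x = x then transpose (cmat w) *v v else 0)"
    by (rule sum.cong) (auto simp: gf e_orbit)
  also have "\<dots> = (\<Sum>w | w \<in> W \<and> cmat w *v x = x. transpose (cmat w) *v v)"
    using finite_W by (simp add: sum.If_cases Int_def)
  finally show ?thesis using \<open>invariant q\<close> by blast
qed

lemma cmat_refl: "cmat (refl a) *v x = x - (2 * cdot (emb a) x) *s emb a"
proof -
  obtain p q where x: "x = emb p + \<i> *s emb q" by (rule real_imag_parts)
  show ?thesis
    unfolding x cmat_mult_complex refl_vector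
    by (simp add: emb_diff emb_scaleR cdot_simps cdot_emb vec_eq_iff algebra_simps)
qed

text \<open>At a point of the mirror an equivariant vector field is fixed by the reflection, hence
  tangent to the mirror. Determinants whose rows are such fields therefore vanish on the
  mirrors.\<close>

lemma equivariant_orthogonal:
  assumes "a \<in> \<Phi>" "cdot (emb a) x = 0" "u (cmat (refl a) *v x) = cmat (refl a) *v u x"
  shows "cdot (emb a) (u x) = 0"
proof -
  have "cmat (refl a) *v u x = u x" using assms(2,3) by (simp add: cmat_refl)
  then have "(2 * cdot (emb a) (u x)) *s emb a = 0" by (simp add: cmat_refl)
  then have "2 * cdot (emb a) (u x) = 0 \<or> emb a = 0" by (simp only: vec.scale_eq_0_iff)
  then show ?thesis using root_nonzero[OF assms(1)] by (simp add: emb_eq_0_iff)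
qed

lemma det_zero_orthogonal_rows:
  assumes "a \<in> \<Phi>" "\<And>k. cdot (emb a) (M $ k) = 0"
  shows "det (M :: complex ^ 'n ^ 'n) = 0"
proof -
  have "M *v emb a = 0"
    using assms(2) by (simp add: vec_eq_iff matrix_vector_mult_def cdot_def mult.commute)
  then show ?thesis using det_zero_iff_kernel[of M] root_nonzero[OF assms(1)] emb_eq_0_iff by blast
qed

definition "root_product S x = (\<Prod>b\<in>S. cdot (emb b) x)"

lemma pfun_root_product: "pfun (root_product S)"
  unfolding root_product_def[abs_def] by (intro pfun_intros)

text \<open>The product runs over both signs of every root, so \<open>W\<close> permutes its
  factors; over the positive roots alone it would be invariant only up to sign.\<close>

lemma invariant_root_product: "invariant (root_product \<Phi>)"
  unfolding invariant_def
proof (intro conjI ballI allI pfun_root_product)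
  fix w x assume w: "w \<in> W"
  have wt: "transpose w \<in> W" using w by (rule refl_prods_transpose)
  show "root_product \<Phi> (cmat w *v x) = root_product \<Phi> x"
    unfolding root_product_def
  proof (rule prod.reindex_bij_witness[of _ "\<lambda>b. w *v b" "\<lambda>b. transpose w *v b"])
    fix b assume "b \<in> \<Phi>"
    show "w *v (transpose w *v b) = b" "transpose w *v (w *v b) = b"
      by (simp_all add: matrix_vector_mul_assoc W_transpose w)
    show "w *v b \<in> \<Phi>" "transpose w *v b \<in> \<Phi>" using W_root w wt \<open>b \<in> \<Phi>\<close> by blast+
    show "cdot (emb (transpose w *v b)) x = cdot (emb b) (cmat w *v x)"
      by (metis cdot_commute cdot_matrix_left cmat_mult_emb cmat_transpose)
  qed
qed

end

text \<open>The basic invariants in orthonormal coordinates, indexed by the coordinate type so that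
  their gradients form a square matrix.\<close>

locale basic_invariants_real = reflection_group A for A :: "(real ^ 'n::finite) set" +
  fixes P :: "'n \<Rightarrow> complex ^ 'n \<Rightarrow> complex" and d :: "'n \<Rightarrow> nat"
  assumes P_invariant: "invariant (P k)"
    and P_homogeneous: "P k (t *s x) = t ^ d k * P k x"
    and P_generate: "invariant q \<Longrightarrow> q \<in> alg_gen (range P)"
begin

lemma pfun_P: "pfun (P k)"
  using P_invariant by (simp add: invariant_def)

definition "jacm x = (\<chi> k. grad (P k) x)"

definition "jac x = det (jacm x)"

lemma pfun_jac: "pfun jac"
  unfolding jac_def[abs_def] jacm_def by (intro pfun_det) (simp add: pfun_grad pfun_P)

lemma invariant_gradient:
  assumes "invariant q"
  shows "\<exists>g. (\<forall>k. pfun (g k)) \<and> (\<forall>x. grad q x = (\<Sum>k\<in>UNIV. g k x *s grad (P k) x))"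
  by (rule alg_gen_gradient[OF pfun_P P_generate[OF assms]])

text \<open>With a trivial stabilizer every vector is the gradient at \<open>x\<close> of some
  invariant, and the chain rule expresses it by the gradients of the \<open>P k\<close>.\<close>

lemma jac_nonzero:
  assumes "\<And>w. w \<in> W \<Longrightarrow> cmat w *v x = x \<Longrightarrow> w = mat 1"
  shows "jac x \<noteq> 0"
  unfolding jac_def
proof (rule det_nonzero_spanning_rows)
  fix v
  have stab: "{w \<in> W. cmat w *v x = x} = {mat 1}"
    using assms refl_prods.one by (auto simp: cmat_one)
  obtain q where q: "invariant q"
    "grad q x = (\<Sum>w | w \<in> W \<and> cmat w *v x = x. transpose (cmat w) *v v)"
    using exists_invariant_gradient by blast
  have "grad q x = v" unfolding q(2) stab by (simp add: cmat_one transpose_mat)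
  then show "\<exists>g. v = (\<Sum>k\<in>UNIV. g k *s jacm x $ k)"
    using invariant_gradient[OF q(1)] by (auto simp: jacm_def)
qed

lemma jac_regular: "regular x \<Longrightarrow> jac (emb x) \<noteq> 0"
  using stabilizer_regular by (intro jac_nonzero) (auto simp: cmat_mult_emb emb_eq_iff)

lemma exists_jac_nonzero: "\<exists>x. jac x \<noteq> 0"
  using exists_regular jac_regular by blast

lemma grad_P_nonzero: "\<exists>x. grad (P k) x \<noteq> 0"
proof -
  obtain x where x: "jac x \<noteq> 0" using exists_jac_nonzero by blast
  have "grad (P k) x \<noteq> 0"
  proof
    assume "grad (P k) x = 0"
    then have "row k (jacm x) = 0" by (simp add: row_def jacm_def vec_eq_iff)
    from det_zero_row(1)[OF this] show False using x by (simp add: jac_def)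
  qed
  then show ?thesis ..
qed

lemma degree_pos: "d k > 0"
proof (rule ccontr)
  assume "\<not> d k > 0"
  then have "P k x = P k 0" for x using P_homogeneous[of k 0 x] by simp
  then have "P k = (\<lambda>x. P k 0)" by blast
  then have "grad (P k) x = 0" for x using grad_const[of "P k 0" x] by metis
  then show False using grad_P_nonzero by blast
qed

lemma P_zero: "P k 0 = 0"
  using P_homogeneous[of k 0 0] degree_pos[of k] by (simp add: zero_power)

lemma invariant_ideal:
  assumes "invariant q"
  shows "\<exists>g. (\<forall>k. pfun (g k)) \<and> (\<forall>x. q x - q 0 = (\<Sum>k\<in>UNIV. g k x * P k x))"
  using alg_gen_ideal[OF pfun_P P_generate[OF assms]] by (simp add: P_zero)

lemma grad_P_homogeneous: "t \<noteq> 0 \<Longrightarrow> grad (P k) (t *s x) = t ^ (d k - 1) *s grad (P k) x"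
  by (rule grad_homogeneous[OF pfun_P P_homogeneous degree_pos])

definition "N = (\<Sum>k\<in>UNIV. d k - 1)"

lemma jac_homogeneous:
  assumes "t \<noteq> 0"
  shows "jac (t *s x) = t ^ N * jac x"
  unfolding jac_def jacm_def grad_P_homogeneous[OF assms] det_rows_mul N_def power_sum ..

text \<open>\<open>K\<close> is the determinant expressing the gradients of \<open>n\<close> invariants by those of the \<open>P k\<close>. One of
  the invariants is the product of all roots, whose gradient is divisible by \<open>a\<close>; the others are
  chosen with independent gradients at \<open>y\<close>.\<close>

lemma exists_nonvanishing_numerator:
  assumes a: "a \<in> \<Phi>" and y: "\<And>b. b \<in> \<Phi> \<Longrightarrow> b \<bullet> y = 0 \<longleftrightarrow> b = a \<or> b = - a"
  shows "\<exists>K E. pfun K \<and> pfun E \<and> E (emb y) \<noteq> 0 \<and> (\<forall>x. K x * jac x = cdot (emb a) x * E x)"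
proof -
  \<comment> \<open>Row \<open>i0\<close> will carry the gradient of the root product;
    \<open>a $ i0 \<noteq> 0\<close> ensures that \<open>a\<close> and the tangential parts of the
    other axes span.\<close>
  obtain i0 where i0: "a $ i0 \<noteq> 0" using root_nonzero[OF a] by (auto simp: vec_eq_iff)
  have a1: "a \<bullet> a = 1" using root_inner[OF a] .
  have "mat 1 \<noteq> refl a"
  proof
    assume "mat 1 = refl a"
    then have "refl a *v a = a" by (metis matrix_vector_mul_lid)
    then have "a = 0" using a1 by (simp add: refl_vector)
    then show False using root_nonzero[OF a] by blast
  qed
  have stab: "{w \<in> W. cmat w *v emb y = emb y} = {mat 1, refl a}"
  proof
    show "{w \<in> W. cmat w *v emb y = emb y} \<subseteq> {mat 1, refl a}"
      using stabilizer_hyperplane[OF _ _ a y] by (auto simp: cmat_mult_emb emb_eq_iff)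
    show "{mat 1, refl a} \<subseteq> {w \<in> W. cmat w *v emb y = emb y}"
      using root_refl[OF a] refl_prods.one y[OF a] by (auto simp: cmat_mult_emb refl_vector)
  qed
  \<comment> \<open>The sum over the stabilizer \<open>{mat 1, refl a}\<close> leaves twice the
    component of an axis tangent to the mirror.\<close>
  define \<epsilon> :: "'n \<Rightarrow> complex ^ 'n" where "\<epsilon> i = axis i 1 + cmat (refl a) *v axis i 1" for i
  have "\<exists>q. invariant q \<and> grad q (emb y) = \<epsilon> i" for i
    using exists_invariant_gradient[of "emb y" "axis i 1"] \<open>mat 1 \<noteq> refl a\<close>
    unfolding stab \<epsilon>_def by (simp add: cmat_one transpose_mat transpose_refl flip: cmat_transpose)
  then obtain q where q: "\<And>i. invariant (q i)" "\<And>i. grad (q i) (emb y) = \<epsilon> i" by metis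
  define \<psi> where "\<psi> = root_product \<Phi>"
  define h where "h = root_product (\<Phi> - {a, - a})"
  have h: "pfun h" unfolding h_def by (rule pfun_root_product)
  have "a \<noteq> - a"
  proof
    assume "a = - a"
    from arg_cong[OF this, of "\<lambda>v. a \<bullet> v"] show False using a1 by simp
  qed
  have \<psi>: "\<psi> x = (- 1) * (cdot (emb a) x * (cdot (emb a) x * h x))" for x
  proof -
    have "root_product \<Phi> x = root_product {a, - a} x * root_product (\<Phi> - {a, - a}) x"
      unfolding root_product_def
      using prod.subset_diff[of "{a, - a}" \<Phi>] a root_uminus[OF a] finite_roots by (simp add: mult.commute)
    also have "root_product {a, - a} x = - (cdot (emb a) x * cdot (emb a) x)"
      using \<open>a \<noteq> - a\<close> by (simp add: root_product_def emb_uminus cdot_simps)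
    finally show ?thesis by (simp add: \<psi>_def h_def)
  qed
  \<comment> \<open>The quotient of \<open>grad \<psi>\<close> by \<open>cdot (emb a) x\<close>; on
    the mirror it is normal, and nonzero wherever \<open>h\<close> is.\<close>
  define \<rho> where "\<rho> x = (- 1) *s (2 * h x *s emb a + cdot (emb a) x *s grad h x)" for x
  have pl: "pfun (\<lambda>x. cdot (emb a) x)" by (intro pfun_intros)
  have grad_\<psi>: "grad \<psi> x = cdot (emb a) x *s \<rho> x" for x
    unfolding \<psi>[abs_def] \<rho>_def
    by (simp only: grad_cmult grad_mult pl h pfun.mult grad_cdot_const)
      (simp add: vec_eq_iff algebra_simps)
  define Q where "Q i = (if i = i0 then \<psi> else q i)" for i
  have "\<forall>i. \<exists>g. (\<forall>k. pfun (g k)) \<and> (\<forall>x. grad (Q i) x = (\<Sum>k\<in>UNIV. g k x *s grad (P k) x))"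
    using invariant_gradient q(1) invariant_root_product by (auto simp: Q_def \<psi>_def)
  then obtain g where g: "\<And>i k. pfun (g i k)" "\<And>i x. grad (Q i) x = (\<Sum>k\<in>UNIV. g i k x *s grad (P k) x)"
    by metis
  define K where "K x = det (\<chi> i k. g i k x)" for x
  define E where "E x = det (\<chi> i. if i = i0 then \<rho> x else grad (q i) x)" for x
  have "pfun K" unfolding K_def by (intro pfun_det) (simp add: g)
  have "pfun (\<lambda>x. (if i = i0 then \<rho> x else grad (q i) x) $ j)" for i j
  proof (cases "i = i0")
    case True
    then show ?thesis unfolding \<rho>_def by (simp add: pfun_intros h pl pfun_grad)
  next
    case False
    then show ?thesis using q(1) pfun_grad[of "q i" j] by (simp add: invariant_def)
  qed
  then have "pfun E" unfolding E_def by (intro pfun_det) simp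
  have KE: "K x * jac x = cdot (emb a) x * E x" for x
  proof -
    have "K x * jac x = det ((\<chi> i k. g i k x) ** jacm x)" by (simp add: K_def jac_def det_mul)
    also have "(\<chi> i k. g i k x) ** jacm x = (\<chi> i. grad (Q i) x)"
      unfolding g(2) matrix_rows_mult[symmetric] by (simp add: jacm_def)
    also have "(\<chi> i. grad (Q i) x) =
        (\<chi> i. if i = i0 then cdot (emb a) x *s \<rho> x else grad (q i) x)"
      by (simp add: Q_def vec_eq_iff grad_\<psi>)
    also have "det \<dots> = cdot (emb a) x * E x" unfolding E_def by (rule det_row_mul)
    finally show ?thesis .
  qed
  have "h (emb y) \<noteq> 0"
    using y finite_roots by (simp add: h_def root_product_def cdot_emb)
  have cay: "cdot (emb a) (emb y) = 0" using y[OF a] by (simp add: cdot_emb)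
  have "E (emb y) \<noteq> 0"
    unfolding E_def
  proof (rule det_zero_iff_kernel[THEN iffD2], intro allI impI)
    fix x assume "(\<chi> i. if i = i0 then \<rho> (emb y) else grad (q i) (emb y)) *v x = 0"
    then have row: "cdot (if i = i0 then \<rho> (emb y) else \<epsilon> i) x = 0" for i
      by (auto simp: vec_eq_iff matrix_vector_mult_def cdot_def q(2) split: if_splits)
    have "cdot (\<rho> (emb y)) x = - 2 * h (emb y) * cdot (emb a) x"
      by (simp add: \<rho>_def cay cdot_simps)
    then have ax: "cdot (emb a) x = 0" using row[of i0] \<open>h (emb y) \<noteq> 0\<close> by simp
    have x_i: "x $ i = 0" if "i \<noteq> i0" for i
    proof -
      have "cdot (\<epsilon> i) x = 2 * x $ i - 2 * cdot (emb a) (axis i 1) * cdot (emb a) x"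
        unfolding \<epsilon>_def cmat_refl cdot_add_left cdot_diff_left cdot_scale_left cdot_axis by simp
      then show ?thesis using row[of i] that ax by simp
    qed
    have "cdot (emb a) x = (\<Sum>i\<in>UNIV. if i = i0 then emb a $ i0 * x $ i0 else 0)"
      unfolding cdot_def by (rule sum.cong) (auto simp: x_i)
    then have "x $ i0 = 0" using ax i0 by (simp add: emb_def)
    then have "x $ i = 0" for i using x_i by (cases "i = i0") auto
    then show "x = 0" by (simp add: vec_eq_iff)
  qed
  then show ?thesis using \<open>pfun K\<close> \<open>pfun E\<close> KE by blast
qed

text \<open>In \<open>K x * jac x = cdot (emb a) x * E x\<close> the right side has a simple zero
  along the line, since \<open>E\<close> does not vanish at \<open>y\<close>. A double zero of the
  Jacobian cannot divide it.\<close>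

lemma jac_simple_zero:
  assumes a: "a \<in> \<Phi>" "\<And>b. b \<in> \<Phi> \<Longrightarrow> b \<bullet> y = 0 \<longleftrightarrow> b = a \<or> b = - a" and w: "a \<bullet> w \<noteq> 0"
    and p: "\<And>t. jac (emb y + t *s emb w) = poly p t"
  shows "\<not> [:0, 1:]\<^sup>2 dvd p"
proof
  assume "[:0, 1:]\<^sup>2 dvd p"
  then obtain s where s: "p = [:0, 1:]\<^sup>2 * s" ..
  obtain K E where KE: "pfun K" "pfun E" "E (emb y) \<noteq> 0" "\<And>x. K x * jac x = cdot (emb a) x * E x"
    using exists_nonvanishing_numerator[OF a] by blast
  obtain k where k: "\<And>t. K (emb y + t *s emb w) = poly k t" using pfun_line_poly[OF KE(1)] by metis
  obtain e where e: "\<And>t. E (emb y + t *s emb w) = poly e t" using pfun_line_poly[OF KE(2)] by metis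
  define c where "c = complex_of_real (a \<bullet> w)"
  have "poly k t * poly p t = c * t * poly e t" for t
  proof -
    have "cdot (emb a) (emb y + t *s emb w) = c * t"
      using a(2)[OF a(1)] by (simp add: cdot_simps cdot_emb c_def)
    then show ?thesis using KE(4)[of "emb y + t *s emb w"] k e p by simp
  qed
  then have "poly (k * p) t = poly ([:0, 1:] * smult c e) t" for t by (simp add: mult_ac)
  then have "k * p = [:0, 1:] * smult c e" using poly_eq_poly_eq_iff by blast
  then have "[:0, 1:] * (k * [:0, 1:] * s) = [:0, 1:] * smult c e"
    unfolding s power2_eq_square by (simp only: mult_ac)
  then have "k * [:0, 1:] * s = smult c e" by (metis mult_cancel_left pCons_eq_0_iff one_neq_zero)
  then have "poly (smult c e) 0 = 0" by (metis mult_zero_left mult_zero_right poly_mult poly_pCons poly_0 add_0)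
  moreover have "poly e 0 \<noteq> 0" using e[of 0] KE(3) by simp
  ultimately show False using w by (simp add: c_def)
qed

lemma card_roots_Pos: "regular x \<Longrightarrow> card \<Phi> = 2 * card (Pos x)"
proof -
  assume x: "regular x"
  have "\<Phi> = Pos x \<union> uminus ` Pos x"
  proof
    show "\<Phi> \<subseteq> Pos x \<union> uminus ` Pos x"
      using root_Pos_cases[OF x] by (metis UnI1 UnI2 image_eqI minus_minus subsetI)
    show "Pos x \<union> uminus ` Pos x \<subseteq> \<Phi>" by (auto simp: Pos_def intro: root_uminus)
  qed
  moreover have "Pos x \<inter> uminus ` Pos x = {}" by (auto simp: Pos_def)
  moreover have "card (uminus ` Pos x) = card (Pos x)" by (intro card_image) simp
  ultimately show ?thesis using card_Un_disjoint[of "Pos x" "uminus ` Pos x"] finite_Pos by simp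
qed

text \<open>On a generic real line with regular direction \<open>w\<close> the Jacobian has degree
  at least \<open>N\<close>; its zeros are simple and lie where the line crosses a mirror, which
  happens once for each positive root.\<close>

lemma degree_bound: "2 * N \<le> card \<Phi>"
proof -
  obtain w where w: "regular w" using exists_regular by blast
  \<comment> \<open>A vector \<open>u\<close> orthogonal to none of these makes the line through
    \<open>u\<close> in direction \<open>w\<close> avoid the intersections of distinct
    mirrors.\<close>
  define V where "V = (\<lambda>(b, c). (c \<bullet> w) *\<^sub>R b - (b \<bullet> w) *\<^sub>R c) ` {(b, c) \<in> \<Phi> \<times> \<Phi>. b \<noteq> c \<and> b \<noteq> - c}"
  have "finite V" unfolding V_def
    by (rule finite_imageI, rule finite_subset[of _ "\<Phi> \<times> \<Phi>"]) (auto simp: finite_roots)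
  moreover have "0 \<notin> V"
  proof
    assume "0 \<in> V"
    then obtain b c where bc: "b \<in> \<Phi>" "c \<in> \<Phi>" "b \<noteq> c" "b \<noteq> - c" "(c \<bullet> w) *\<^sub>R b = (b \<bullet> w) *\<^sub>R c"
      by (auto simp: V_def)
    have "c \<bullet> w \<noteq> 0" using w bc(2) by (simp add: regular_def)
    then have "b = ((b \<bullet> w) / (c \<bullet> w)) *\<^sub>R c"
      using arg_cong[OF bc(5), of "\<lambda>v. (1 / (c \<bullet> w)) *\<^sub>R v"] by simp
    from roots_parallel[OF bc(2,1) this] show False using bc by blast
  qed
  ultimately obtain u where u: "\<forall>v\<in>V. v \<bullet> u \<noteq> 0" using exists_nonorthogonal by blast
  obtain p where p: "\<And>t. jac (emb u + t *s emb w) = poly p t" using pfun_line_poly[OF pfun_jac] by metis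
  \<comment> \<open>Exchanging the two vectors reverses the polynomial:
    \<open>poly r s = s ^ N * poly p (1 / s)\<close> for nonzero \<open>s\<close>. So
    \<open>jac (emb w) \<noteq> 0\<close> bounds the degree of \<open>p\<close> from below.\<close>
  obtain r where r: "\<And>t. jac (emb w + t *s emb u) = poly r t" using pfun_line_poly[OF pfun_jac] by metis
  have r0: "poly r 0 \<noteq> 0" using r[of 0] jac_regular[OF w] by simp
  have pr: "poly p (1 / s) * s ^ N = poly r s" if "s \<noteq> 0" for s
  proof -
    have "emb w + s *s emb u = s *s (emb u + (1 / s) *s emb w)"
      using that by (simp add: vec_eq_iff field_simps)
    then have "poly r s = s ^ N * jac (emb u + (1 / s) *s emb w)"
      unfolding r[symmetric] by (simp only: jac_homogeneous[OF that])
    then show ?thesis by (simp add: p)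
  qed
  have "p \<noteq> 0"
  proof
    assume "p = 0"
    then have "poly r s = 0" if "s \<noteq> 0" for s using pr[OF that] by simp
    then have "poly ([:0, 1:] * r) s = 0" for s by (cases "s = 0") simp_all
    then have "[:0, 1:] * r = 0" using poly_all_0_iff_0 by blast
    then show False using r0 by simp
  qed
  have "N \<le> degree p"
  proof (rule ccontr)
    assume "\<not> N \<le> degree p"
    then have lt: "degree p < N" by simp
    have "poly ([:0, 1:] * ([:0, 1:] ^ (N - degree p) * reflect_poly p)) s = poly ([:0, 1:] * r) s" for s
    proof (cases "s = 0")
      case False
      have "poly (reflect_poly p) s = s ^ degree p * poly p (1 / s)"
        using False by (simp add: poly_reflect_poly_nz inverse_eq_divide)
      moreover have "s ^ (N - degree p) * s ^ degree p = s ^ N" using lt by (simp flip: power_add)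
      ultimately have "s ^ (N - degree p) * poly (reflect_poly p) s = poly r s"
        using pr[OF False] by (metis mult.assoc mult.commute)
      then show ?thesis by simp
    qed simp
    then have "[:0, 1:] * ([:0, 1:] ^ (N - degree p) * reflect_poly p) = [:0, 1:] * r"
      using poly_eq_poly_eq_iff by blast
    then have "[:0, 1:] ^ (N - degree p) * reflect_poly p = r" by simp
    then have "poly r 0 = poly ([:0, 1:] ^ (N - degree p) * reflect_poly p) 0" by simp
    also have "\<dots> = 0" using lt by (simp add: poly_power zero_power)
    finally show False using r0 by simp
  qed
  have root: "\<exists>b\<in>Pos w. t = complex_of_real (- (b \<bullet> u) / (b \<bullet> w))" if t: "poly p t = 0" for t
  proof -
    have x: "emb u + t *s emb w = emb (u + Re t *\<^sub>R w) + \<i> *s emb (Im t *\<^sub>R w)"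
      by (simp add: emb_def vec_eq_iff complex_eq_iff)
    have jz: "jac (emb (u + Re t *\<^sub>R w) + \<i> *s emb (Im t *\<^sub>R w)) = 0" using t p x by metis
    \<comment> \<open>At a parameter that is not real the imaginary part of the point is a nonzero
      multiple of the regular vector \<open>w\<close>, so its stabilizer is trivial.\<close>
    have "Im t = 0"
    proof (rule ccontr)
      assume "Im t \<noteq> 0"
      have "v = mat 1" if v: "v \<in> W" "cmat v *v (emb (u + Re t *\<^sub>R w) + \<i> *s emb (Im t *\<^sub>R w)) =
          emb (u + Re t *\<^sub>R w) + \<i> *s emb (Im t *\<^sub>R w)" for v
      proof -
        have "v *v (Im t *\<^sub>R w) = Im t *\<^sub>R w"
          using v(2) unfolding cmat_mult_complex emb_complex_eq_iff by blast
        then have "v *v w = w" using \<open>Im t \<noteq> 0\<close> by (simp add: matrix_vector_mult_scaleR)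
        then show ?thesis using stabilizer_regular v(1) w by blast
      qed
      from jac_nonzero[OF this] show False using jz by blast
    qed
    then have "emb (u + Re t *\<^sub>R w) + \<i> *s emb (Im t *\<^sub>R w) = emb (u + Re t *\<^sub>R w)"
      by (simp add: emb_def vec_eq_iff)
    then have "\<not> regular (u + Re t *\<^sub>R w)" using jac_regular[of "u + Re t *\<^sub>R w"] jz by metis
    then obtain b where b: "b \<in> \<Phi>" "b \<bullet> (u + Re t *\<^sub>R w) = 0" by (auto simp: regular_def)
    obtain b' where b': "b' \<in> Pos w" "b' \<bullet> (u + Re t *\<^sub>R w) = 0"
    proof (cases "b \<in> Pos w")
      case False
      then have "- b \<in> Pos w" using root_Pos_cases[OF w b(1)] by blast
      then show thesis using that[of "- b"] b(2) by simp
    qed (use b that in blast)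
    have "b' \<bullet> w > 0" using b'(1) by (simp add: Pos_def)
    then have "Re t = - (b' \<bullet> u) / (b' \<bullet> w)"
      using b'(2) by (simp add: inner_add_right field_simps)
    then show ?thesis using b'(1) \<open>Im t = 0\<close> by (intro bexI[of _ b']) (simp_all add: complex_eq_iff)
  qed
  have simple: "\<not> [:- t, 1:]\<^sup>2 dvd p" if t: "poly p t = 0" for t
  proof
    assume dvd: "[:- t, 1:]\<^sup>2 dvd p"
    obtain b where b: "b \<in> Pos w" "t = complex_of_real (- (b \<bullet> u) / (b \<bullet> w))" using root[OF t] by blast
    define t' where "t' = - (b \<bullet> u) / (b \<bullet> w)"
    have bw: "b \<in> \<Phi>" "b \<bullet> w > 0" using b(1) by (auto simp: Pos_def)
    define y where "y = u + t' *\<^sub>R w"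
    have by0: "b \<bullet> y = 0" using bw by (simp add: y_def t'_def inner_add_right inner_diff_right)
    have y: "c \<bullet> y = 0 \<longleftrightarrow> c = b \<or> c = - b" if c: "c \<in> \<Phi>" for c
    proof (rule iffI, rule ccontr)
      assume cy: "c \<bullet> y = 0" and "\<not> (c = b \<or> c = - b)"
      then have "(b \<bullet> w) *\<^sub>R c - (c \<bullet> w) *\<^sub>R b \<in> V" using c bw by (force simp: V_def)
      then have "((b \<bullet> w) *\<^sub>R c - (c \<bullet> w) *\<^sub>R b) \<bullet> u \<noteq> 0" using u by blast
      moreover have "c \<bullet> u = - t' * (c \<bullet> w)" "b \<bullet> u = - t' * (b \<bullet> w)"
        using cy by0 by (simp_all add: y_def inner_add_right)
      ultimately show False by (simp add: inner_diff_left algebra_simps)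
    qed (use by0 in auto)
    have line: "jac (emb y + s *s emb w) = poly (pcompose p [:t, 1:]) s" for s
    proof -
      have "emb y + s *s emb w = emb u + (t + s) *s emb w"
        unfolding b(2) t'_def[symmetric] by (simp add: y_def emb_add emb_scaleR vec_eq_iff algebra_simps)
      then show ?thesis by (simp only: p poly_pcompose) simp
    qed
    have "[:0, 1:]\<^sup>2 dvd pcompose p [:t, 1:]"
    proof -
      obtain s where "p = [:- t, 1:]\<^sup>2 * s" using dvd ..
      then have "pcompose p [:t, 1:] = pcompose [:- t, 1:] [:t, 1:] ^ 2 * pcompose s [:t, 1:]"
        by (simp only: pcompose_mult power2_eq_square)
      moreover have "pcompose [:- t, 1:] [:t, 1:] = [:0, 1:]" by (simp add: pcompose_pCons)
      ultimately show ?thesis by simp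
    qed
    then show False using jac_simple_zero[OF bw(1) y _ line] bw(2) by simp
  qed
  have "rsquarefree p"
    unfolding rsquarefree_def
  proof (intro conjI allI \<open>p \<noteq> 0\<close>)
    fix t
    show "Polynomial.order t p = 0 \<or> Polynomial.order t p = 1"
    proof (cases "poly p t = 0")
      case True
      then have "\<not> 2 \<le> Polynomial.order t p" using simple[OF True] order_divides[of t 2 p] by blast
      then show ?thesis by linarith
    qed (simp add: order_0I)
  qed
  from complex_poly_decompose_rsquarefree[OF this]
  have "degree p = degree (\<Prod>z | poly p z = 0. [:- z, 1:])"
    using \<open>p \<noteq> 0\<close> by (metis degree_smult_eq leading_coeff_0_iff)
  also have "\<dots> = (\<Sum>z | poly p z = 0. degree [:- z, 1:])" by (intro degree_prod_sum_eq) simp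
  also have "\<dots> = card {z. poly p z = 0}" by simp
  also have "\<dots> \<le> card ((\<lambda>b. complex_of_real (- (b \<bullet> u) / (b \<bullet> w))) ` Pos w)"
    using root finite_Pos by (intro card_mono) auto
  also have "\<dots> \<le> card (Pos w)" by (rule card_image_le[OF finite_Pos])
  finally have "N \<le> card (Pos w)" using \<open>N \<le> degree p\<close> by simp
  then show ?thesis using card_roots_Pos[OF w] by simp
qed

end

section \<open>The pairing of the degrees and the gradient of the top invariant\<close>

lemma det_nonzero_permutation:
  fixes M :: "'a::comm_ring_1 ^ 'n ^ 'n"
  assumes "det M \<noteq> 0"
  shows "\<exists>\<pi>. \<pi> permutes UNIV \<and> (\<forall>i. M $ i $ \<pi> i \<noteq> 0)"
proof -
  obtain \<pi> where "\<pi> \<in> {p. p permutes (UNIV :: 'n set)}" "of_int (sign \<pi>) * (\<Prod>i\<in>UNIV. M $ i $ \<pi> i) \<noteq> 0"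
    using assms unfolding det_def by (rule sum.not_neutral_contains_not_neutral)
  moreover have "M $ i $ \<pi> i \<noteq> 0" for i
  proof
    assume "M $ i $ \<pi> i = 0"
    then have "(\<Prod>i\<in>UNIV. M $ i $ \<pi> i) = 0" using prod.remove[of UNIV i "\<lambda>i. M $ i $ \<pi> i"] by simp
    then show False using calculation by simp
  qed
  ultimately show ?thesis by blast
qed

lemma matrix_vector_mult_sum_right:
  "M *v (\<Sum>k\<in>S. f k) = (\<Sum>k\<in>S. M *v (f k :: 'a::comm_semiring_1 ^ 'n))"
  by (induct S rule: infinite_finite_induct) (simp_all add: matrix_vector_right_distrib)

lemma cis_power_eq_1:
  assumes "m > 0" "cis (- 2 * pi / real m) ^ e = 1"
  shows "m dvd e"
proof -
  define \<theta> where "\<theta> = 2 * pi * real e / real m"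
  have "cis (- \<theta>) = 1" using assms(2) by (simp add: Complex.DeMoivre \<theta>_def mult_ac)
  have "exp (2 * complex_of_real pi * \<i> * of_nat e / of_nat m) = cis \<theta>"
    by (simp add: cis_conv_exp \<theta>_def mult_ac)
  also have "\<dots> = inverse (cis (- \<theta>))" by (simp only: cis_inverse minus_minus)
  also have "\<dots> = 1" using \<open>cis (- \<theta>) = 1\<close> by simp
  finally show ?thesis using complex_root_unity_eq_1[of m e] assms(1) by simp
qed

section \<open>Vanishing at the origin and division by the positive roots\<close>

context reflection_group begin

lemma orthogonal_roots_zero:
  assumes "\<And>a. a \<in> \<Phi> \<Longrightarrow> cdot (emb a) v = 0"
  shows "v = 0"
proof -
  obtain p q where v: "v = emb p + \<i> *s emb q" by (rule real_imag_parts)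
  have "a \<bullet> p = 0 \<and> a \<bullet> q = 0" if "a \<in> \<Phi>" for a
    using assms[OF that] unfolding v by (simp add: cdot_simps cdot_emb complex_eq_iff)
  then have "orthogonal p a" "orthogonal q a" if "a \<in> \<Phi>" for a
    using that by (simp_all add: orthogonal_def inner_commute)
  then have "orthogonal p x" "orthogonal q x" for x
    using orthogonal_to_span[of x \<Phi>] span_roots by simp_all
  from this[of p] this[of q] show ?thesis unfolding v by (simp add: orthogonal_self emb_def vec_eq_iff)
qed

text \<open>The origin lies on all mirrors, and the roots span.\<close>

lemma invariant_grad_zero:
  assumes "invariant q"
  shows "grad q 0 = 0"
proof (rule orthogonal_roots_zero)
  fix a assume a: "a \<in> \<Phi>"
  show "cdot (emb a) (grad q 0) = 0"
    by (rule equivariant_orthogonal[where u = "grad q", OF a cdot_zero_right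
          invariant_grad[OF assms root_refl[OF a]]])
qed

text \<open>Divide by one root at a time. On the mirror of \<open>b\<close> the product over the
  roots already treated is not identically zero, since no two roots in \<open>Pos x0\<close> are
  parallel; so the quotient obtained so far must vanish there.\<close>

lemma root_hyperplane_division:
  assumes "finite S" "S \<subseteq> Pos x0" "pfun f"
    "\<And>a x. a \<in> S \<Longrightarrow> cdot (emb a) x = 0 \<Longrightarrow> f x = 0"
  shows "\<exists>g. pfun g \<and> (\<forall>x. f x = root_product S x * g x)"
  using assms
proof induct
  case empty
  then show ?case by (intro exI[of _ f]) (simp add: root_product_def)
next
  case (insert b S)
  then obtain g where g: "pfun g" "\<And>x. f x = root_product S x * g x" by auto
  have b: "b \<in> \<Phi>" "b \<bullet> x0 > 0" using insert(4) by (auto simp: Pos_def)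
  have cb: "cdot (emb b) (emb b) = 1" using root_inner[OF b(1)] by (simp add: cdot_emb)
  \<comment> \<open>Composition with this projection turns functions on the mirror into polynomial
    functions on the whole space, where there are no zero divisors.\<close>
  define pr where "pr x = x - cdot (emb b) x *s emb b" for x
  have ppr: "pfun (\<lambda>x. pr x $ i)" for i unfolding pr_def by (simp add: pfun_intros)
  have b_pr: "cdot (emb b) (pr x) = 0" for x by (simp add: pr_def cdot_simps cb)
  have "g (pr x) = 0" for x
  proof -
    have ne: "a - (a \<bullet> b) *\<^sub>R b \<noteq> 0" if a: "a \<in> S" for a
    proof
      assume "a - (a \<bullet> b) *\<^sub>R b = 0"
      then have *: "a = (a \<bullet> b) *\<^sub>R b" by simp
      have "a \<in> \<Phi>" "a \<bullet> x0 > 0" using insert(4) a by (auto simp: Pos_def)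
      from roots_parallel[OF b(1) this(1) *] have "a = b" using \<open>a \<bullet> x0 > 0\<close> b(2) by auto
      then show False using insert(2) a by blast
    qed
    have "finite ((\<lambda>a. a - (a \<bullet> b) *\<^sub>R b) ` S)" "0 \<notin> (\<lambda>a. a - (a \<bullet> b) *\<^sub>R b) ` S"
      using insert(1) ne by auto
    then obtain u where u: "\<forall>v\<in>(\<lambda>a. a - (a \<bullet> b) *\<^sub>R b) ` S. v \<bullet> u \<noteq> 0"
      using exists_nonorthogonal by blast
    have "cdot (emb a) (pr (emb u)) \<noteq> 0" if "a \<in> S" for a
    proof -
      have "(a - (a \<bullet> b) *\<^sub>R b) \<bullet> u \<noteq> 0" using u that by blast
      moreover have "cdot (emb a) (pr (emb u)) = complex_of_real ((a - (a \<bullet> b) *\<^sub>R b) \<bullet> u)"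
        by (simp add: pr_def cdot_simps cdot_emb inner_diff_left mult.commute)
      ultimately show ?thesis by (simp only: of_real_eq_0_iff not_False_eq_True)
    qed
    then have nz: "root_product S (pr (emb u)) \<noteq> 0" using insert(1) by (simp add: root_product_def)
    show ?thesis
    proof (rule pfun_no_zero_divisors[of "\<lambda>x. root_product S (pr x)" "\<lambda>x. g (pr x)"])
      show "pfun (\<lambda>x. root_product S (pr x))" by (rule pfun_compose[OF pfun_root_product ppr])
      show "pfun (\<lambda>x. g (pr x))" by (rule pfun_compose[OF g(1) ppr])
      show "root_product S (pr y) * g (pr y) = 0" for y
        using insert(6)[of b "pr y"] b_pr g(2)[of "pr y"] by simp
      show "root_product S (pr (emb u)) \<noteq> 0" by (rule nz)
    qed
  qed
  then have "g x = 0" if "cdot (emb b) x = 0" for x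
    using that by (metis pr_def diff_zero vec.scale_zero_left)
  then obtain h where h: "pfun h" "\<And>x. g x = cdot (emb b) x * h x"
    using pfun_hyperplane_factor[OF g(1) _ cb] by blast
  have "f x = root_product (insert b S) x * h x" for x
    using insert(1,2) by (simp add: g(2) h(2) root_product_def)
  then show ?case using h(1) by blast
qed

end

section \<open>Degree two, Solomon's theorem and the pairing of the degrees\<close>

context basic_invariants_real begin

text \<open>A linear invariant would have a constant gradient, equal to its value 0 at the
  origin.\<close>

lemma degree_ge_2: "d k \<ge> 2"
proof (rule ccontr)
  assume "\<not> d k \<ge> 2"
  then have "d k = 1" using degree_pos[of k] by simp
  have "grad (P k) x = 0" for x
  proof -
    have "grad (P k) 0 $ i = poly [:grad (P k) x $ i:] 0" for i
      by (rule pfun_limit_origin[OF pfun_grad[OF pfun_P]])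
        (simp add: grad_P_homogeneous \<open>d k = 1\<close>)
    then show ?thesis using invariant_grad_zero[OF P_invariant] by (simp add: vec_eq_iff)
  qed
  then show False using grad_P_nonzero by blast
qed

text \<open>The Gram matrix of the gradients for the bilinear \<open>cdot\<close>: without
  conjugation its entries are polynomial, and its determinant is the square of the Jacobian.\<close>

definition "G i j x = cdot (grad (P i) x) (grad (P j) x)"

lemma invariant_G: "invariant (G i j)"
  unfolding invariant_def G_def
  by (intro conjI ballI allI pfun_cdot pfun_grad pfun_P)
    (simp add: invariant_grad P_invariant cdot_cmat)

lemma G_homogeneous: "t \<noteq> 0 \<Longrightarrow> G i j (t *s x) = t ^ (d i - 1 + (d j - 1)) * G i j x"
  by (simp add: G_def grad_P_homogeneous cdot_simps power_add)

lemma jac_combination: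
  assumes "jac x \<noteq> 0"
  shows "\<exists>y. v = (\<Sum>k\<in>UNIV. y $ k *s grad (P k) x)"
    and "(\<Sum>k\<in>UNIV. a k *s grad (P k) x) = (\<Sum>k\<in>UNIV. b k *s grad (P k) x) \<Longrightarrow> a k = b k"
proof -
  have tr: "transpose (jacm x) *v y = (\<Sum>k\<in>UNIV. y $ k *s grad (P k) x)" for y
    by (simp add: vec_eq_iff matrix_vector_mult_def transpose_def jacm_def mult.commute)
  have det: "det (transpose (jacm x)) \<noteq> 0" using assms by (simp add: jac_def)
  then have "surj ((*v) (transpose (jacm x)))"
    unfolding invertible_det_nz[symmetric] invertible_right_inverse matrix_right_invertible_surjective .
  then show "\<exists>y. v = (\<Sum>k\<in>UNIV. y $ k *s grad (P k) x)" unfolding surj_def tr by blast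
  assume "(\<Sum>k\<in>UNIV. a k *s grad (P k) x) = (\<Sum>k\<in>UNIV. b k *s grad (P k) x)"
  then have "transpose (jacm x) *v (\<chi> k. a k - b k) = 0"
    unfolding tr by (simp add: vec.scale_left_diff_distrib sum_subtractf)
  then have "(\<chi> k. a k - b k) = 0" using det det_zero_iff_kernel by blast
  then show "a k = b k" by (simp add: vec_eq_iff)
qed

text \<open>Schur's lemma by hand. The gradient is a linear map commuting with \<open>W\<close>;
  every root is an eigenvector because its reflection negates it, non-orthogonal roots share their
  eigenvalue, and the Coxeter graph is connected.\<close>

lemma degree_2_gradient:
  assumes "d k = 2"
  shows "\<exists>\<mu>. \<forall>x. grad (P k) x = \<mu> *s x"
proof -
  let ?f = "\<lambda>i y. grad (P k) y $ i"
  have pf: "pfun (?f i)" for i by (rule pfun_grad[OF pfun_P])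
  have hf: "?f i (t *s x) = t ^ 1 * ?f i x" if "t \<noteq> 0" for t i x
    using grad_P_homogeneous[OF that, of k x] assms by simp
  \<comment> \<open>A polynomial function homogeneous of degree 1 has a constant gradient, and
    Euler's relation recovers the function from it.\<close>
  define M where "M = (\<chi> i. grad (?f i) 0)"
  have M: "grad (P k) x = M *v x" for x
  proof -
    have "?f i x = (M *v x) $ i" for i
    proof -
      have "grad (?f i) 0 $ j = poly [:grad (?f i) x $ j:] 0" for j
      proof (rule pfun_limit_origin[of "\<lambda>y. grad (?f i) y $ j" x])
        show "pfun (\<lambda>y. grad (?f i) y $ j)" by (rule pfun_grad[OF pf])
        fix t :: complex assume t: "t \<noteq> 0"
        have "grad (?f i) (t *s x) = t ^ (1 - 1) *s grad (?f i) x"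
          by (rule grad_homogeneous[where f = "?f i" and e = 1, OF pf]) (use hf t in simp_all)
        then show "grad (?f i) (t *s x) $ j = poly [:grad (?f i) x $ j:] t" by simp
      qed
      then have "grad (?f i) 0 = grad (?f i) x" by (simp add: vec_eq_iff)
      moreover have "cdot (grad (?f i) x) x = of_nat 1 * ?f i x"
        by (rule euler_homogeneous[OF pf hf])
      ultimately show ?thesis by (simp add: M_def matrix_vector_mult_def cdot_def)
    qed
    then show ?thesis by (simp add: vec_eq_iff)
  qed
  have equiv: "M *v (cmat w *v x) = cmat w *v (M *v x)" if "w \<in> W" for w x
    using invariant_grad[OF P_invariant that, of k x] unfolding M .
  define \<mu> where "\<mu> a = cdot (emb a) (M *v emb a)" for a
  have Ma: "M *v emb a = \<mu> a *s emb a" if a: "a \<in> \<Phi>" for a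
  proof -
    have "cmat (refl a) *v emb a = - emb a"
      using root_inner[OF a] by (simp add: cmat_mult_emb refl_vector emb_uminus scaleR_2)
    then have "M *v (- emb a) = cmat (refl a) *v (M *v emb a)"
      using equiv[OF root_refl[OF a], of "emb a"] by simp
    then have *: "- (M *v emb a) = M *v emb a - (2 * \<mu> a) *s emb a"
      unfolding cmat_refl \<mu>_def matrix_vector_mult_minus_right .
    have "(M *v emb a) $ i = (\<mu> a *s emb a) $ i" for i
    proof -
      have "- (M *v emb a) $ i = (M *v emb a) $ i - 2 * \<mu> a * emb a $ i"
        using arg_cong[OF *, of "\<lambda>v. v $ i"] by simp
      then have "2 * (M *v emb a) $ i = 2 * (\<mu> a * emb a $ i)" by algebra
      then show ?thesis by simp
    qed
    then show ?thesis by (simp add: vec_eq_iff)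
  qed
  have \<mu>_eq: "\<mu> a = \<mu> b" if a: "a \<in> \<Phi>" and b: "b \<in> \<Phi>" and ab: "a \<bullet> b \<noteq> 0" for a b
  proof -
    have "M *v (cmat (refl b) *v emb a) = cmat (refl b) *v (\<mu> a *s emb a)"
      unfolding equiv[OF root_refl[OF b]] Ma[OF a] ..
    then have "\<mu> a *s emb a - (2 * cdot (emb b) (emb a)) *s (\<mu> b *s emb b) =
        \<mu> a *s (emb a - (2 * cdot (emb b) (emb a)) *s emb b)"
      unfolding cmat_refl matrix_vector_mult_diff_distrib vector_scalar_commute Ma[OF a] Ma[OF b] .
    then have "(2 * cdot (emb b) (emb a) * (\<mu> a - \<mu> b)) *s emb b = 0"
      by (simp add: vec_eq_iff algebra_simps)
    then have "2 * cdot (emb b) (emb a) * (\<mu> a - \<mu> b) = 0"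
      using root_nonzero[OF b] by (simp add: emb_eq_0_iff)
    then show ?thesis using ab by (simp add: cdot_emb inner_commute)
  qed
  obtain x0 D where "simple_system A x0 D" using exists_regular exists_simple_system by blast
  then interpret simple_system A x0 D .
  have "D \<noteq> {}" using card_D dim_ge_2 by auto
  then obtain d0 where d0: "d0 \<in> D" by blast
  have "{a \<in> D. \<mu> a = \<mu> d0} = {} \<or> {a \<in> D. \<mu> a = \<mu> d0} = D"
  proof (rule connected_D)
    fix a b assume "a \<in> {a \<in> D. \<mu> a = \<mu> d0}" "b \<in> D - {a \<in> D. \<mu> a = \<mu> d0}"
    then show "a \<bullet> b = 0" using \<mu>_eq[OF D_roots D_roots, of a b] by (cases "a \<bullet> b = 0") auto
  qed auto
  then have \<mu>_D: "\<mu> a = \<mu> d0" if "a \<in> D" for a using d0 that by blast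
  have "span D \<subseteq> {y. M *v emb y = \<mu> d0 *s emb y}"
  proof (rule span_minimal)
    show "D \<subseteq> {y. M *v emb y = \<mu> d0 *s emb y}" using Ma D_roots \<mu>_D by auto
    show "subspace {y. M *v emb y = \<mu> d0 *s emb y}"
      unfolding subspace_def
      by (auto simp: emb_add emb_scaleR matrix_vector_right_distrib vec.scale_right_distrib
          vector_scalar_commute mult.commute) (simp add: emb_def vec_eq_iff matrix_vector_mult_def)
  qed
  then have real: "M *v emb y = \<mu> d0 *s emb y" for y using span_D by auto
  have "M *v x = \<mu> d0 *s x" for x
  proof -
    obtain p q where x: "x = emb p + \<i> *s emb q" by (rule real_imag_parts)
    show ?thesis unfolding x
      by (simp add: matrix_vector_right_distrib vector_scalar_commute real vec.scale_right_distrib mult.commute)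
  qed
  then show ?thesis using M by auto
qed

text \<open>Two gradients proportional at every point would make the Jacobian vanish identically.
  Through the pairing this yields the uniqueness of the highest degree.\<close>

lemma degree_2_unique:
  assumes "d i = 2" "d j = 2"
  shows "i = j"
proof (rule ccontr)
  assume "i \<noteq> j"
  obtain \<mu> \<nu> where \<mu>: "\<And>x. grad (P i) x = \<mu> *s x" and \<nu>: "\<And>x. grad (P j) x = \<nu> *s x"
    using degree_2_gradient assms by metis
  have "\<nu> \<noteq> 0" using grad_P_nonzero[of j] \<nu> by auto
  obtain x where x: "jac x \<noteq> 0" using exists_jac_nonzero by blast
  have "(\<Sum>k\<in>UNIV. (if k = i then \<nu> else 0) *s grad (P k) x) =
      (\<Sum>k\<in>UNIV. (if k = j then \<mu> else 0) *s grad (P k) x)"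
    by (simp add: if_distrib[of "\<lambda>c. c *s _"] \<mu> \<nu> mult.commute cong: if_cong)
  from jac_combination(2)[OF x this, of i] show False using \<open>i \<noteq> j\<close> \<open>\<nu> \<noteq> 0\<close> by simp
qed

text \<open>Solomon's theorem for invariant 1-forms: Cramer's rule expresses the coefficients as
  quotients by the Jacobian, which by its degree is a multiple of the product of the positive
  roots, and this product divides the numerators.\<close>

lemma equivariant_combination:
  assumes N: "card \<Phi> \<le> 2 * N" and pu: "\<And>i. pfun (\<lambda>x. u x $ i)"
    and eq: "\<And>w x. w \<in> W \<Longrightarrow> u (cmat w *v x) = cmat w *v u x"
  shows "\<exists>g. (\<forall>k. invariant (g k)) \<and> (\<forall>x. u x = (\<Sum>k\<in>UNIV. g k x *s grad (P k) x))"
proof -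
  obtain x0 where x0: "regular x0" using exists_regular by blast
  define R where "R = root_product (Pos x0)"
  have pR: "pfun R" unfolding R_def by (rule pfun_root_product)
  have Pos_roots: "a \<in> \<Phi>" if "a \<in> Pos x0" for a using that by (simp add: Pos_def)
  have divide: "\<exists>g. pfun g \<and> (\<forall>x. f x = R x * g x)"
    if "pfun f" "\<And>a x. a \<in> \<Phi> \<Longrightarrow> cdot (emb a) x = 0 \<Longrightarrow> f x = 0" for f
    unfolding R_def by (rule root_hyperplane_division[OF finite_Pos]) (use that Pos_roots in auto)
  have grad_orth: "cdot (emb a) (grad (P k) x) = 0" if "a \<in> \<Phi>" "cdot (emb a) x = 0" for a x k
    by (rule equivariant_orthogonal[where u = "grad (P k)", OF that])
      (rule invariant_grad[OF P_invariant root_refl[OF that(1)]])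
  have u_orth: "cdot (emb a) (u x) = 0" if "a \<in> \<Phi>" "cdot (emb a) x = 0" for a x
    by (rule equivariant_orthogonal[where u = u, OF that]) (rule eq[OF root_refl[OF that(1)]])
  have "jac x = 0" if "a \<in> \<Phi>" "cdot (emb a) x = 0" for a x
    unfolding jac_def by (rule det_zero_orthogonal_rows[OF that(1)]) (use grad_orth that in \<open>simp add: jacm_def\<close>)
  then obtain K where K: "pfun K" "\<And>x. jac x = R x * K x" using divide[OF pfun_jac] by blast
  obtain y where y: "jac y \<noteq> 0" using exists_jac_nonzero by blast
  have card: "card (Pos x0) = N"
    using N degree_bound card_roots_Pos[OF x0] by simp
  have K_const: "K x = K 0" for x
  proof (rule pfun_eqI_off_zeros[OF K(1) pfun.const pfun_jac y])
    fix x assume x: "jac x \<noteq> 0"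
    have "K (t *s x) = poly [:K x:] t" if t: "t \<noteq> 0" for t
    proof -
      have "R (t *s x) = t ^ N * R x"
        by (simp add: R_def root_product_def cdot_simps prod.distrib card)
      then have "t ^ N * R x * K (t *s x) = t ^ N * (R x * K x)"
        using jac_homogeneous[OF t, of x] K(2) by metis
      then show ?thesis using t x K(2)[of x] by simp
    qed
    from pfun_limit_origin[OF K(1) this] show "K x = K 0" by simp
  qed
  have "K 0 \<noteq> 0" using y K(2)[of y] K_const[of y] by auto
  define Num where "Num k x = det (\<chi> i. if i = k then u x else grad (P i) x)" for k x
  have pNum: "pfun (Num k)" for k
  proof -
    have "pfun (\<lambda>x. (if i = k then u x else grad (P i) x) $ j)" for i j
      using pu pfun_grad[OF pfun_P] by (cases "i = k") simp_all
    then show ?thesis unfolding Num_def[abs_def] by (intro pfun_det) simp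
  qed
  have "Num k x = 0" if "a \<in> \<Phi>" "cdot (emb a) x = 0" for k a x
    unfolding Num_def by (rule det_zero_orthogonal_rows[OF that(1)]) (use grad_orth u_orth that in simp)
  then have "\<exists>h. pfun h \<and> (\<forall>x. Num k x = R x * h x)" for k using divide[OF pNum] by blast
  then obtain h where h: "\<And>k. pfun (h k)" "\<And>k x. Num k x = R x * h k x" by metis
  define g where "g k x = (1 / K 0) * h k x" for k x
  have pg: "pfun (g k)" for k unfolding g_def[abs_def] by (intro pfun_intros h)
  have u_g: "u x = (\<Sum>k\<in>UNIV. g k x *s grad (P k) x)" for x
  proof -
    have "u x $ i = (\<Sum>k\<in>UNIV. g k x *s grad (P k) x) $ i" for i
    proof (rule pfun_eqI_off_zeros[OF pu _ pfun_jac y])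
      show "pfun (\<lambda>x. (\<Sum>k\<in>UNIV. g k x *s grad (P k) x) $ i)"
        by (simp, intro pfun_sum pfun.mult pg pfun_grad pfun_P)
      fix x assume x: "jac x \<noteq> 0"
      obtain c where c: "u x = (\<Sum>k\<in>UNIV. c $ k *s grad (P k) x)"
        using jac_combination(1)[OF x] by blast
      have row: "row k (jacm x) = grad (P k) x" for k by (simp add: row_def jacm_def vec_eq_iff)
      have "Num k x = c $ k * jac x" for k
        using cramer_lemma_transpose[of k c "jacm x"] unfolding row c[symmetric] jac_def Num_def .
      then have "R x * h k x = R x * (c $ k * K 0)" for k
        using h(2)[of k x] K(2)[of x] K_const[of x] by (metis mult.assoc mult.commute)
      moreover have "R x \<noteq> 0" using x K(2)[of x] by auto
      ultimately have "h k x = c $ k * K 0" for k by simp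
      then have "g k x = c $ k" for k using \<open>K 0 \<noteq> 0\<close> by (simp add: g_def)
      then show "u x $ i = (\<Sum>k\<in>UNIV. g k x *s grad (P k) x) $ i" using c by simp
    qed
    then show ?thesis by (simp add: vec_eq_iff)
  qed
  have "invariant (g k)" for k
    unfolding invariant_def
  proof (intro conjI ballI allI pg)
    fix w x assume w: "w \<in> W"
    show "g k (cmat w *v x) = g k x"
    proof (rule pfun_eqI_off_zeros[OF _ pg pfun_jac y])
      show "pfun (\<lambda>x. g k (cmat w *v x))" by (rule pfun_compose[OF pg pfun_matrix_vector])
      fix x assume x: "jac x \<noteq> 0"
      \<comment> \<open>Transporting the expansion at \<open>cmat w *v x\<close> back to
        \<open>x\<close> gives a second expansion of \<open>u x\<close>; where the Jacobian is not
        zero, coefficients are unique.\<close>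
      have "(\<Sum>k\<in>UNIV. g k (cmat w *v x) *s (cmat w *v grad (P k) x)) = cmat w *v u x"
        using u_g[of "cmat w *v x"] eq[OF w] by (simp add: invariant_grad[OF P_invariant w])
      then have "cmat w *v (\<Sum>k\<in>UNIV. g k (cmat w *v x) *s grad (P k) x) = cmat w *v u x"
        by (simp add: matrix_vector_mult_sum_right vector_scalar_commute)
      then have "(\<Sum>k\<in>UNIV. g k (cmat w *v x) *s grad (P k) x) = u x"
        using cmat_transpose_cancel(2)[OF w] by metis
      then show "g k (cmat w *v x) = g k x" unfolding u_g[of x] by (rule jac_combination(2)[OF x])
    qed
  qed
  then show ?thesis using u_g by blast
qed

text \<open>Multiplying the regular eigenvector \<open>z\<close> by a primitive \<open>m\<close>-th root of unity stays in its
  orbit, so a nonzero entry of the nonsingular matrix \<open>G(z)\<close> forces \<open>m\<close> to divide its degree.\<close>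

lemma degree_pairing:
  obtains z m \<pi> where "jac z \<noteq> 0" "m > 0" "\<And>i. G i (\<pi> i) z \<noteq> 0"
    "\<And>i. d i + d (\<pi> i) = m + 2" "inj \<pi>" "\<And>k. P k z \<noteq> 0 \<Longrightarrow> m dvd d k" "card \<Phi> \<le> 2 * N"
proof -
  obtain z :: "complex ^ 'n" and m c where z: "m > 0" "c \<in> W" "cmat c *v z = cis (- 2 * pi / real m) *s z"
    "\<And>w. w \<in> W \<Longrightarrow> cmat w *v z = z \<Longrightarrow> w = mat 1" "card \<Phi> \<le> m * CARD('n)"
    using exists_regular_eigenvector by blast
  have jz: "jac z \<noteq> 0" using jac_nonzero z(4) by blast
  define \<zeta> where "\<zeta> = cis (- 2 * pi / real m)"
  have "\<zeta> \<noteq> 0" by (simp add: \<zeta>_def)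
  have dvd: "m dvd e" if "invariant q" "q (\<zeta> *s z) = \<zeta> ^ e * q z" "q z \<noteq> 0" for q e
  proof -
    have "q (\<zeta> *s z) = q z" using that(1) z(2,3) unfolding invariant_def \<zeta>_def by metis
    then have "\<zeta> ^ e = 1" using that(2,3) by simp
    then show ?thesis using cis_power_eq_1[OF z(1)] by (simp add: \<zeta>_def)
  qed
  define M where "M = (\<chi> i j. G i j z)"
  have "M = jacm z ** transpose (jacm z)"
    by (simp add: M_def vec_eq_iff G_def cdot_def matrix_matrix_mult_def transpose_def jacm_def)
  then have "det M \<noteq> 0" using jz by (simp add: det_mul jac_def)
  then obtain \<pi> where \<pi>: "\<pi> permutes UNIV" "\<And>i. M $ i $ \<pi> i \<noteq> 0"
    using det_nonzero_permutation by blast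
  have G\<pi>: "G i (\<pi> i) z \<noteq> 0" for i using \<pi>(2)[of i] by (simp add: M_def)
  define e where "e i = d i - 1 + (d (\<pi> i) - 1)" for i
  have e_ge: "m \<le> e i" for i
  proof -
    have "m dvd e i"
      unfolding e_def by (rule dvd[OF invariant_G G_homogeneous[OF \<open>\<zeta> \<noteq> 0\<close>] G\<pi>])
    moreover have "e i > 0" using degree_ge_2[of i] by (simp add: e_def)
    ultimately show ?thesis by (rule dvd_imp_le)
  qed
  have "(\<Sum>i\<in>UNIV. d (\<pi> i) - 1) = N"
    unfolding N_def using sum.permute[OF \<pi>(1), of "\<lambda>i. d i - 1"] by (simp add: o_def)
  then have sum_e: "(\<Sum>i\<in>UNIV. e i) = 2 * N" by (simp add: e_def sum.distrib N_def)
  \<comment> \<open>Together with \<open>card \<Phi> \<le> m * CARD('n)\<close> this gives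
    \<open>card \<Phi> \<le> 2 * N\<close>, the hypothesis of
    \<open>equivariant_combination\<close>.\<close>
  have lower: "m * CARD('n) \<le> 2 * N"
    using sum_mono[of UNIV "\<lambda>i. m" e] e_ge sum_e by (simp add: mult.commute)
  have e_eq: "e i = m" for i
  proof (rule ccontr)
    assume "e i \<noteq> m"
    then have "m < e i" using e_ge[of i] by simp
    then have "(\<Sum>i\<in>(UNIV :: 'n set). m) < (\<Sum>i\<in>UNIV. e i)"
      using e_ge by (intro sum_strict_mono_ex1) auto
    then show False using sum_e degree_bound z(5) by (simp add: mult.commute)
  qed
  have sum_d: "d i + d (\<pi> i) = m + 2" for i
    using e_eq[of i] degree_ge_2[of i] degree_ge_2[of "\<pi> i"] unfolding e_def by arith
  have "m dvd d k" if "P k z \<noteq> 0" for k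
    by (rule dvd[OF P_invariant P_homogeneous that])
  then show thesis
    using that[of z m \<pi>] jz z(1) G\<pi> sum_d permutes_inj[OF \<pi>(1)] lower z(5) by simp
qed

text \<open>The gradient of the top invariant \<open>P l\<close> is, up to a nonzero factor and the ideal generated
  by the invariants, the Hessian of \<open>P k\<close> applied to the gradient of \<open>P j\<close>, where \<open>j\<close> and \<open>k\<close>
  are paired degrees: the coefficient of \<open>grad (P l)\<close> is found by contracting with the Euler
  field at the regular eigenvector.\<close>

theorem gradient_top_invariant:
  assumes top: "\<And>i. d i \<le> d l"
  shows "\<exists>B H. (\<forall>a b. pfun (B a b)) \<and> (\<forall>k b. pfun (H k b)) \<and>
    (\<forall>x b. grad (P l) x $ b =
      (\<Sum>a\<in>UNIV. grad (P j) x $ a * B a b x) + (\<Sum>k\<in>UNIV. H k b x * P k x))"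
proof -
  obtain z m \<pi> where z: "jac z \<noteq> 0" "m > 0" "\<And>i. G i (\<pi> i) z \<noteq> 0"
    "\<And>i. d i + d (\<pi> i) = m + 2" "inj \<pi>" "\<And>k. P k z \<noteq> 0 \<Longrightarrow> m dvd d k" "card \<Phi> \<le> 2 * N"
    using degree_pairing by blast
  have d_le: "d i \<le> m" for i using z(4)[of i] degree_ge_2[of "\<pi> i"] by linarith
  define k where "k = \<pi> j"
  have djk: "d j + d k = m + 2" using z(4)[of j] by (simp add: k_def)
  \<comment> \<open>If all \<open>P i\<close> vanished at \<open>z\<close>, so would
    \<open>G j k\<close>, which lies in their ideal.\<close>
  obtain i0 where i0: "P i0 z \<noteq> 0"
  proof (rule ccontr)
    assume "\<not> thesis"
    then have "P i z = 0" for i using that by blast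
    moreover obtain g where "\<And>x. G j k x - G j k 0 = (\<Sum>i\<in>UNIV. g i x * P i x)"
      using invariant_ideal[OF invariant_G] by blast
    ultimately have "G j k z = G j k 0" by (metis (no_types, lifting) eq_iff_diff_eq_0 mult_zero_right sum.neutral)
    also have "\<dots> = 0" using invariant_grad_zero[OF P_invariant] by (simp add: G_def cdot_simps)
    finally show False using z(3)[of j] by (simp add: k_def)
  qed
  then have "m dvd d i0" using z(6) by blast
  then have "m \<le> d i0" using degree_pos[of i0] by (simp add: dvd_imp_le)
  then have dl: "d l = m" using top[of i0] d_le[of l] by simp
  have less: "d i < m" if "i \<noteq> l" for i
  proof (rule ccontr)
    assume "\<not> d i < m"
    then have "d i = m" using d_le[of i] by simp
    then have "d (\<pi> i) = 2" "d (\<pi> l) = 2" using z(4)[of i] z(4)[of l] dl by simp_all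
    then have "\<pi> i = \<pi> l" by (rule degree_2_unique)
    then show False using z(5) that by (simp add: inj_eq)
  qed
  have P_z: "P i z = 0" if "i \<noteq> l" for i
    using dvd_imp_le[OF z(6) degree_pos, of i] less[OF that] by (meson leD)
  let ?f = "\<lambda>a y. grad (P k) y $ a"
  have pf: "pfun (?f a)" for a by (rule pfun_grad[OF pfun_P])
  have hf: "?f a (t *s x) = t ^ (d k - 1) * ?f a x" if "t \<noteq> 0" for a t x
    using grad_P_homogeneous[OF that, of k x] by simp
  \<comment> \<open>Its degree is \<open>(d j - 1) + (d k - 2) = m - 1\<close>, that of
    \<open>grad (P l)\<close>, which makes the coefficient of \<open>grad (P l)\<close>
    constant.\<close>
  define S where "S x = (\<Sum>a\<in>UNIV. grad (P j) x $ a *s grad (?f a) x)" for x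
  have pS: "pfun (\<lambda>x. S x $ i)" for i
    unfolding S_def by (simp, intro pfun_sum pfun.mult pfun_grad pf pfun_P)
  have S_hom: "S (t *s x) = t ^ (m - 1) *s S x" if t: "t \<noteq> 0" for t x
  proof -
    have "grad (?f a) (t *s x) = t ^ (d k - 1 - 1) *s grad (?f a) x" for a
      by (rule grad_homogeneous[where f = "?f a" and e = "d k - 1", OF pf])
        (use hf t degree_ge_2[of k] in simp_all)
    moreover have "(d j - 1) + (d k - 1 - 1) = m - 1"
      using djk degree_ge_2[of k] degree_ge_2[of j] by simp
    ultimately show ?thesis
      by (simp add: S_def grad_P_homogeneous[OF t] vec.scale_sum_right mult.assoc mult.left_commute
          flip: power_add) (simp add: mult.commute)
  qed
  have S_eq: "S (cmat w *v x) = cmat w *v S x" if w: "w \<in> W" for w x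
  proof -
    \<comment> \<open>Freezing the gradient of \<open>P j\<close> as a vector \<open>e\<close> turns
      \<open>S\<close> into the gradient of a scalar function, to which the rule for linear
      substitutions applies.\<close>
    define h where "h e y = cdot e (grad (P k) y)" for e y
    have ph: "pfun (h e)" for e unfolding h_def[abs_def] by (intro pfun_cdot pfun.const pfun_grad pfun_P)
    have S_h: "S y = grad (h (grad (P j) y)) y" for y
    proof -
      have "h e = (\<lambda>y. \<Sum>a\<in>UNIV. e $ a * ?f a y)" for e by (simp add: h_def cdot_def fun_eq_iff)
      then have "grad (h e) y = (\<Sum>a\<in>UNIV. e $ a *s grad (?f a) y)" for e
        by (simp add: grad_sum grad_cmult pf pfun.mult pfun.const)
      then show ?thesis by (simp add: S_def)
    qed
    define e where "e = grad (P j) x"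
    have "(\<lambda>y. h (cmat w *v e) (cmat w *v y)) = h e"
      by (simp add: h_def fun_eq_iff invariant_grad[OF P_invariant w] cdot_cmat[OF w])
    then have "grad (h e) x = transpose (cmat w) *v grad (h (cmat w *v e)) (cmat w *v x)"
      using grad_compose_linear[OF ph, of "cmat w *v e" "cmat w" x] by simp
    then have "cmat w *v grad (h e) x = grad (h (cmat w *v e)) (cmat w *v x)"
      by (simp add: cmat_transpose_cancel[OF w])
    then show ?thesis by (simp add: S_h invariant_grad[OF P_invariant w] e_def)
  qed
  have S_euler: "cdot (S x) x = of_nat (d k - 1) * G j k x" for x
  proof -
    have "cdot (grad (?f a) x) x = of_nat (d k - 1) * ?f a x" for a
      by (rule euler_homogeneous[where f = "?f a", OF pf hf])
    then have "cdot (S x) x = (\<Sum>a\<in>UNIV. grad (P j) x $ a * (of_nat (d k - 1) * ?f a x))"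
      by (simp add: S_def cdot_sum_left cdot_simps)
    also have "\<dots> = of_nat (d k - 1) * G j k x"
      by (simp add: G_def cdot_def sum_distrib_left mult_ac)
    finally show ?thesis .
  qed
  obtain g where g: "\<And>i. invariant (g i)" "\<And>x. S x = (\<Sum>i\<in>UNIV. g i x *s grad (P i) x)"
    using equivariant_combination[OF z(7) pS S_eq] by blast
  have pg: "pfun (g i)" for i using g(1) by (simp add: invariant_def)
  obtain y where y: "jac y \<noteq> 0" using exists_jac_nonzero by blast
  have g_hom: "g i (t *s x) = t ^ (m - d i) * g i x" if t: "t \<noteq> 0" and x: "jac x \<noteq> 0" for i t x
  proof -
    have "(\<Sum>i\<in>UNIV. (g i (t *s x) * t ^ (d i - 1)) *s grad (P i) x) =
        (\<Sum>i\<in>UNIV. (t ^ (m - 1) * g i x) *s grad (P i) x)"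
      using S_hom[OF t, of x] unfolding g(2) by (simp add: grad_P_homogeneous[OF t] vec.scale_sum_right)
    from jac_combination(2)[OF x this] have "g i (t *s x) * t ^ (d i - 1) = t ^ (m - 1) * g i x" .
    moreover have "t ^ (m - 1) = t ^ (m - d i) * t ^ (d i - 1)"
      using d_le[of i] degree_pos[of i] by (simp flip: power_add)
    ultimately show ?thesis using t by simp
  qed
  have g_zero: "g i 0 = 0" if "i \<noteq> l" for i
  proof -
    \<comment> \<open>Along the ray through a point \<open>y\<close> with nonzero Jacobian
      \<open>g i\<close> is a monomial of positive degree \<open>m - d i\<close>.\<close>
    have "g i 0 = poly (monom (g i y) (m - d i)) 0"
      by (rule pfun_limit_origin[OF pg, where x = y]) (simp add: g_hom y poly_monom mult.commute)
    then show ?thesis using less[OF that] by (simp add: poly_monom)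
  qed
  define C where "C = g l 0"
  have g_l: "g l x = C" for x
  proof (rule pfun_eqI_off_zeros[OF pg pfun.const pfun_jac y])
    fix x assume x: "jac x \<noteq> 0"
    have "g l 0 = poly [:g l x:] 0"
      by (rule pfun_limit_origin[OF pg, where x = x]) (simp add: g_hom x dl)
    then show "g l x = C" by (simp add: C_def)
  qed
  have "C \<noteq> 0"
  proof
    assume "C = 0"
    \<comment> \<open>At \<open>z\<close> only the term of \<open>P l\<close> could survive the
      Euler contraction, and its coefficient is \<open>C\<close>; but \<open>S_euler\<close> gives
      the value \<open>(d k - 1) * G j k z\<close>, which is not 0.\<close>
    have "cdot (grad (P i) z) z = of_nat (d i) * P i z" for i
      by (rule euler_homogeneous[OF pfun_P P_homogeneous])
    then have "cdot (S z) z = (\<Sum>i\<in>UNIV. g i z * (of_nat (d i) * P i z))"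
      by (simp add: g(2) cdot_sum_left cdot_simps)
    also have "\<dots> = 0"
      using P_z g_l[of z] \<open>C = 0\<close> by (intro sum.neutral) (metis mult_zero_left mult_zero_right)
    finally have "of_nat (d k - 1) * G j k z = 0" by (simp add: S_euler)
    then show False using z(3)[of j] degree_ge_2[of k] by (simp add: k_def)
  qed
  have "\<exists>h. (\<forall>n. pfun (h n)) \<and> (\<forall>x. g i x = (\<Sum>n\<in>UNIV. h n x * P n x))" if "i \<noteq> l" for i
    using invariant_ideal[OF g(1)[of i]] g_zero[OF that] by simp
  then obtain h where h: "\<And>i n. i \<noteq> l \<Longrightarrow> pfun (h i n)"
    "\<And>i x. i \<noteq> l \<Longrightarrow> g i x = (\<Sum>n\<in>UNIV. h i n x * P n x)" by metis
  define B where "B a b x = (1 / C) * grad (?f a) x $ b" for a b x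
  define X where "X n b x = (\<Sum>i\<in>UNIV - {l}. h i n x * grad (P i) x $ b)" for n b x
  define H where "H n b x = (- 1 / C) * X n b x" for n b x
  have "pfun (B a b)" for a b unfolding B_def[abs_def] by (intro pfun.mult pfun.const pfun_grad pf)
  moreover have "pfun (H n b)" for n b
    unfolding H_def[abs_def] X_def by (intro pfun.mult pfun.const pfun_sum pfun_grad pfun_P h) auto
  moreover have "grad (P l) x $ b =
      (\<Sum>a\<in>UNIV. grad (P j) x $ a * B a b x) + (\<Sum>n\<in>UNIV. H n b x * P n x)" for x b
  proof -
    have "S x $ b = C * grad (P l) x $ b + (\<Sum>i\<in>UNIV - {l}. g i x * grad (P i) x $ b)"
      unfolding g(2) using sum.remove[of UNIV l "\<lambda>i. g i x * grad (P i) x $ b"] by (simp add: g_l)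
    also have "(\<Sum>i\<in>UNIV - {l}. g i x * grad (P i) x $ b) =
        (\<Sum>i\<in>UNIV - {l}. \<Sum>n\<in>UNIV. h i n x * grad (P i) x $ b * P n x)"
      by (rule sum.cong) (auto simp: h(2) sum_distrib_left sum_distrib_right mult_ac)
    also have "\<dots> = (\<Sum>n\<in>UNIV. X n b x * P n x)"
      by (subst sum.swap) (simp add: sum_distrib_right X_def)
    also have "\<dots> = - C * (\<Sum>n\<in>UNIV. H n b x * P n x)"
      using \<open>C \<noteq> 0\<close> by (simp add: H_def sum_distrib_left mult.assoc)
    finally have "C * grad (P l) x $ b = S x $ b + C * (\<Sum>n\<in>UNIV. H n b x * P n x)" by simp
    moreover have "S x $ b = C * (\<Sum>a\<in>UNIV. grad (P j) x $ a * B a b x)"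
      using \<open>C \<noteq> 0\<close> by (simp add: S_def B_def sum_distrib_left)
    ultimately have "C * grad (P l) x $ b =
        C * ((\<Sum>a\<in>UNIV. grad (P j) x $ a * B a b x) + (\<Sum>n\<in>UNIV. H n b x * P n x))"
      by (simp add: distrib_left)
    then show ?thesis using \<open>C \<noteq> 0\<close> by simp
  qed
  ultimately show ?thesis by blast
qed

end

section \<open>Polynomials and polynomial functions\<close>

definition monom_at :: "('n \<Rightarrow>\<^sub>0 nat) \<Rightarrow> complex ^ 'n::finite \<Rightarrow> complex" where
  "monom_at m v = (\<Prod>i\<in>UNIV. v $ i ^ Poly_Mapping.lookup m i)"

lemma monom_at_keys: "(\<Prod>i\<in>Poly_Mapping.keys m. v $ i ^ Poly_Mapping.lookup m i) = monom_at m v"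
  unfolding monom_at_def by (rule prod.mono_neutral_left) (simp_all add: in_keys_iff)

lemma monom_at_add: "monom_at (m + n) v = monom_at m v * monom_at n v"
  by (simp add: monom_at_def lookup_add power_add prod.distrib)

lemma pfun_monom_at: "pfun (monom_at m)"
  unfolding monom_at_def[abs_def] by (intro pfun_intros)

lemma cpoly_at_superset:
  assumes "finite S" "Poly_Mapping.keys q \<subseteq> S"
  shows "cpoly_at q v = (\<Sum>m\<in>S. Poly_Mapping.lookup q m * monom_at m v)"
  unfolding cpoly_at_def substitute_def monom_at_keys
  by (rule sum.mono_neutral_left) (use assms in \<open>auto simp: in_keys_iff\<close>)

lemma cpoly_at_keys:
  "cpoly_at q v = (\<Sum>m\<in>Poly_Mapping.keys q. Poly_Mapping.lookup q m * monom_at m v)"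
  by (rule cpoly_at_superset) auto

lemma cpoly_at_single: "cpoly_at (Poly_Mapping.single m c) v = c * monom_at m v"
  by (subst cpoly_at_superset[of "{m}"]) simp_all

lemma cpoly_at_zero: "cpoly_at 0 v = 0"
  by (simp add: cpoly_at_keys)

lemma cpoly_at_add: "cpoly_at (p + q) v = cpoly_at p v + cpoly_at q v"
proof -
  let ?S = "Poly_Mapping.keys p \<union> Poly_Mapping.keys q"
  have "finite ?S" by simp
  moreover have "Poly_Mapping.keys (p + q) \<subseteq> ?S" by (rule keys_add)
  ultimately show ?thesis
    using cpoly_at_superset[of ?S p v] cpoly_at_superset[of ?S q v] cpoly_at_superset[of ?S "p + q" v]
    by (simp add: lookup_add distrib_right sum.distrib)
qed

lemma cpoly_at_sum: "cpoly_at (\<Sum>k\<in>S. f k) v = (\<Sum>k\<in>S. cpoly_at (f k) v)"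
  by (induct S rule: infinite_finite_induct) (simp_all add: cpoly_at_zero cpoly_at_add)

lemma cpoly_at_mult: "cpoly_at (p * q) v = cpoly_at p v * cpoly_at q v"
proof -
  let ?m = "\<lambda>p m. Poly_Mapping.single m (Poly_Mapping.lookup p m)"
  have expand: "(\<Sum>m\<in>Poly_Mapping.keys p. ?m p m) = p" for p :: "'a cpoly"
    by (rule poly_mapping_eqI) (simp add: lookup_sum lookup_single when_def in_keys_iff)
  have "p * q = (\<Sum>m\<in>Poly_Mapping.keys p. ?m p m) * (\<Sum>n\<in>Poly_Mapping.keys q. ?m q n)"
    by (simp only: expand)
  also have "\<dots> = (\<Sum>m\<in>Poly_Mapping.keys p. \<Sum>n\<in>Poly_Mapping.keys q.
      Poly_Mapping.single (m + n) (Poly_Mapping.lookup p m * Poly_Mapping.lookup q n))"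
    by (simp only: sum_product mult_single)
  finally have "cpoly_at (p * q) v = (\<Sum>m\<in>Poly_Mapping.keys p. \<Sum>n\<in>Poly_Mapping.keys q.
      (Poly_Mapping.lookup p m * monom_at m v) * (Poly_Mapping.lookup q n * monom_at n v))"
    by (simp add: cpoly_at_sum cpoly_at_single monom_at_add mult_ac)
  then show ?thesis by (simp only: cpoly_at_keys sum_product)
qed

lemma cpoly_at_const: "cpoly_at (Poly_Mapping.single 0 c) v = c"
  by (simp add: cpoly_at_single monom_at_def)

lemma cpoly_at_one: "cpoly_at 1 v = 1"
  using cpoly_at_const[of 1 v] by simp

lemma cpoly_at_power: "cpoly_at (q ^ k) v = cpoly_at q v ^ k"
  by (induct k) (simp_all add: cpoly_at_one cpoly_at_mult)

lemma cpoly_at_prod: "cpoly_at (\<Prod>k\<in>S. f k) v = (\<Prod>k\<in>S. cpoly_at (f k) v)"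
  by (induct S rule: infinite_finite_induct) (simp_all add: cpoly_at_one cpoly_at_mult)

lemma pfun_cpoly_at: "pfun (cpoly_at q)"
  unfolding cpoly_at_keys[abs_def] by (intro pfun_intros pfun_monom_at)

lemma pfun_imp_cpoly: "pfun f \<Longrightarrow> \<exists>q. f = cpoly_at q"
proof (induct rule: pfun.induct)
  case (const c)
  show ?case by (rule exI[of _ "Poly_Mapping.single 0 c"]) (simp add: fun_eq_iff cpoly_at_const)
next
  case (coord i)
  have "monom_at (Poly_Mapping.single i 1) x = (\<Prod>j\<in>UNIV. if j = i then x $ i else 1)" for x :: "complex ^ 'a"
    unfolding monom_at_def by (rule prod.cong) (auto simp: lookup_single when_def)
  then have "monom_at (Poly_Mapping.single i 1) x = x $ i" for x :: "complex ^ 'a" by simp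
  then show ?case
    by (intro exI[of _ "Poly_Mapping.single (Poly_Mapping.single i 1) 1"])
      (simp add: fun_eq_iff cpoly_at_single)
next
  case (add f g)
  then show ?case by (metis cpoly_at_add)
next
  case (mult f g)
  then show ?case by (metis cpoly_at_mult)
qed

lemma lookup_minus_single:
  "Poly_Mapping.lookup (m - Poly_Mapping.single i (Suc 0)) j =
    (if j = i then Poly_Mapping.lookup m i - 1 else Poly_Mapping.lookup m j)"
  by (simp add: lookup_minus lookup_single when_def)

lemma grad_monom_at:
  "grad (monom_at m) v $ i =
    of_nat (Poly_Mapping.lookup m i) * monom_at (m - Poly_Mapping.single i 1) v"
proof -
  define c where "c = (\<Prod>j\<in>UNIV - {i}. v $ j ^ Poly_Mapping.lookup m j)"
  define k where "k = Poly_Mapping.lookup m i"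
  have line: "monom_at m (v + t *s axis i 1) = (v $ i + t) ^ k * c" for t
  proof -
    have "monom_at m (v + t *s axis i 1) =
        (v + t *s axis i 1) $ i ^ k * (\<Prod>j\<in>UNIV - {i}. (v + t *s axis i 1) $ j ^ Poly_Mapping.lookup m j)"
      unfolding monom_at_def k_def by (rule prod.remove) auto
    also have "(\<Prod>j\<in>UNIV - {i}. (v + t *s axis i 1) $ j ^ Poly_Mapping.lookup m j) = c"
      unfolding c_def by (rule prod.cong) (auto simp: axis_def)
    finally show ?thesis by (simp add: axis_def)
  qed
  have "((\<lambda>t. monom_at m (v + t *s axis i 1)) has_field_derivative
      cdot (grad (monom_at m) (v + 0 *s axis i 1)) (axis i 1)) (at 0)"
    by (rule has_field_derivative_pfun_line[OF pfun_monom_at])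
  then have "((\<lambda>t. (v $ i + t) ^ k * c) has_field_derivative grad (monom_at m) v $ i) (at 0)"
    unfolding line by (simp add: cdot_axis)
  moreover have "((\<lambda>t. (v $ i + t) ^ k * c) has_field_derivative of_nat k * v $ i ^ (k - 1) * c) (at 0)"
    by (auto intro!: derivative_eq_intros)
  ultimately have "grad (monom_at m) v $ i = of_nat k * v $ i ^ (k - 1) * c" by (rule DERIV_unique)
  moreover have "monom_at (m - Poly_Mapping.single i 1) v = v $ i ^ (k - 1) * c"
  proof -
    have "monom_at (m - Poly_Mapping.single i 1) v = v $ i ^ (k - 1) *
        (\<Prod>j\<in>UNIV - {i}. v $ j ^ Poly_Mapping.lookup (m - Poly_Mapping.single i 1) j)"
      unfolding monom_at_def k_def
      by (subst prod.remove[of UNIV i]) (simp_all add: lookup_minus_single)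
    also have "(\<Prod>j\<in>UNIV - {i}. v $ j ^ Poly_Mapping.lookup (m - Poly_Mapping.single i 1) j) = c"
      unfolding c_def by (rule prod.cong) (auto simp: lookup_minus_single)
    finally show ?thesis .
  qed
  ultimately show ?thesis by (simp add: k_def)
qed

lemma cpoly_at_partial_deriv: "cpoly_at (partial_deriv i q) v = grad (cpoly_at q) v $ i"
proof -
  have "grad (cpoly_at q) v =
      (\<Sum>m\<in>Poly_Mapping.keys q. Poly_Mapping.lookup q m *s grad (monom_at m) v)"
    unfolding cpoly_at_keys[abs_def]
    by (simp add: grad_sum grad_cmult pfun.mult pfun.const pfun_monom_at)
  then show ?thesis
    by (simp add: partial_deriv_def cpoly_at_sum cpoly_at_single grad_monom_at mult_ac)
qed

text \<open>Truncated subtraction identifies the exponent \<open>m\<close> only with exponents in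
  which the variable \<open>i\<close> is absent, and those terms carry the factor 0.\<close>

lemma lookup_partial_deriv:
  assumes "Poly_Mapping.lookup m i > 0"
  shows "Poly_Mapping.lookup (partial_deriv i q) (m - Poly_Mapping.single i 1) =
    of_nat (Poly_Mapping.lookup m i) * Poly_Mapping.lookup q m"
proof -
  let ?c = "\<lambda>n. of_nat (Poly_Mapping.lookup n i) * Poly_Mapping.lookup q n"
  have "Poly_Mapping.lookup (partial_deriv i q) (m - Poly_Mapping.single i 1) =
      (\<Sum>n\<in>Poly_Mapping.keys q. if n = m then ?c m else 0)"
    unfolding partial_deriv_def lookup_sum
  proof (rule sum.cong[OF HOL.refl])
    fix n
    show "Poly_Mapping.lookup (Poly_Mapping.single (n - Poly_Mapping.single i 1) (?c n))
        (m - Poly_Mapping.single i 1) = (if n = m then ?c m else 0)"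
    proof (cases "Poly_Mapping.lookup n i = 0")
      case False
      have "n = m" if eq: "n - Poly_Mapping.single i 1 = m - Poly_Mapping.single i 1"
      proof (rule poly_mapping_eqI)
        fix j
        have "Poly_Mapping.lookup (n - Poly_Mapping.single i 1) j =
            Poly_Mapping.lookup (m - Poly_Mapping.single i 1) j" by (simp only: eq)
        then show "Poly_Mapping.lookup n j = Poly_Mapping.lookup m j"
          using False assms by (simp add: lookup_minus_single split: if_splits)
      qed
      then show ?thesis by (auto simp: lookup_single when_def)
    qed (use assms in \<open>auto simp: lookup_single when_def\<close>)
  qed
  also have "\<dots> = ?c m" by (simp add: in_keys_iff)
  finally show ?thesis .
qed

text \<open>Coefficients are recovered by differentiation: the constant one is the value at 0, and
  the others follow by induction on the degree of the monomial, the factors from differentiation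
  being nonzero in characteristic 0.\<close>

lemma cpoly_at_eq_zero:
  assumes "\<And>v :: complex ^ 'n::finite. cpoly_at q v = 0"
  shows "q = 0"
proof -
  have "Poly_Mapping.lookup q m = 0" if "(\<Sum>i\<in>UNIV. Poly_Mapping.lookup m i) = n" for n m
    using that assms
  proof (induct n arbitrary: m q)
    case 0
    then have "m = 0" by (intro poly_mapping_eqI) simp
    have "monom_at k 0 = (if k = 0 then 1 else 0)" for k :: "'n \<Rightarrow>\<^sub>0 nat"
      by (auto simp: monom_at_def poly_mapping_eq_iff fun_eq_iff power_0_left)
    then have "cpoly_at q 0 = Poly_Mapping.lookup q 0"
      by (simp add: cpoly_at_keys if_distrib[of "\<lambda>c. _ * c"] in_keys_iff cong: if_cong)
    then show ?case using 0(2)[of 0] \<open>m = 0\<close> by simp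
  next
    case (Suc n)
    then obtain i where i: "Poly_Mapping.lookup m i > 0" by (metis gr0I nat.distinct(1) sum.neutral)
    let ?m = "m - Poly_Mapping.single i 1"
    have "(\<Sum>j\<in>UNIV. Poly_Mapping.lookup ?m j) =
        (Poly_Mapping.lookup m i - 1) + (\<Sum>j\<in>UNIV - {i}. Poly_Mapping.lookup m j)"
      by (subst sum.remove[of UNIV i]) (simp_all add: lookup_minus_single)
    moreover have "Suc n = Poly_Mapping.lookup m i + (\<Sum>j\<in>UNIV - {i}. Poly_Mapping.lookup m j)"
      unfolding Suc(2)[symmetric] by (rule sum.remove) auto
    ultimately have deg: "(\<Sum>j\<in>UNIV. Poly_Mapping.lookup ?m j) = n" using i by simp
    have "cpoly_at q = (\<lambda>_. 0)" using Suc(3) by blast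
    then have "cpoly_at (partial_deriv i q) v = 0" for v
      by (simp add: cpoly_at_partial_deriv grad_const)
    from Suc(1)[OF deg this] show ?case using i by (simp add: lookup_partial_deriv del: One_nat_def)
  qed
  then show ?thesis by (intro poly_mapping_eqI) simp
qed

lemma cpoly_at_diff: "cpoly_at (p - q) v = cpoly_at p v - cpoly_at q v"
  using cpoly_at_add[of "p - q" q v] by simp

lemma cpoly_eqI: "(\<And>v :: complex ^ 'n::finite. cpoly_at p v = cpoly_at q v) \<Longrightarrow> p = q"
  using cpoly_at_eq_zero[of "p - q"] by (simp add: cpoly_at_diff)

lemma homogeneous_cpoly_at:
  assumes "homogeneous_cpoly q"
  shows "cpoly_at q (t *s v) = t ^ total_degree q * cpoly_at q v"
proof -
  obtain e where e: "\<And>m. m \<in> Poly_Mapping.keys q \<Longrightarrow> monom_degree m = e"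
    using assms by (auto simp: homogeneous_cpoly_def)
  have "monom_at m (t *s v) = t ^ monom_degree m * monom_at m v" for m :: "'a \<Rightarrow>\<^sub>0 nat"
  proof -
    have "monom_degree m = (\<Sum>i\<in>UNIV. Poly_Mapping.lookup m i)"
      unfolding monom_degree_def by (rule sum.mono_neutral_left) (simp_all add: in_keys_iff)
    then show ?thesis by (simp add: monom_at_def power_mult_distrib prod.distrib power_sum)
  qed
  then have *: "cpoly_at q (t *s v) = t ^ e * cpoly_at q v"
    by (simp add: cpoly_at_keys sum_distrib_left e mult_ac)
  show ?thesis
  \<comment> \<open>For the zero polynomial \<open>total_degree\<close> is 0 by convention, and both
    sides vanish.\<close>
  proof (cases "Poly_Mapping.keys q = {}")
    case True
    then show ?thesis by (simp add: cpoly_at_keys)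
  next
    case False
    then obtain m where "m \<in> Poly_Mapping.keys q" by blast
    then have "monom_degree ` Poly_Mapping.keys q = {e}" using e by force
    then show ?thesis using * by (simp add: total_degree_def)
  qed
qed

lemma cpoly_at_subst:
  "cpoly_at (cpoly_subst q f) v = (\<Sum>m\<in>Poly_Mapping.keys q. Poly_Mapping.lookup q m *
    (\<Prod>i\<in>Poly_Mapping.keys m. cpoly_at (f i) v ^ Poly_Mapping.lookup m i))"
  unfolding cpoly_subst_def substitute_def
  by (simp add: cpoly_at_sum cpoly_at_mult cpoly_at_prod cpoly_at_power cpoly_at_const)

section \<open>Substitution and generated algebras at the level of functions\<close>

lemma alg_gen_sum: "(\<And>k. k \<in> S \<Longrightarrow> f k \<in> alg_gen B) \<Longrightarrow> (\<lambda>x. \<Sum>k\<in>S. f k x) \<in> alg_gen B"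
  by (induct S rule: infinite_finite_induct) (auto intro: alg_gen.intros)

lemma alg_gen_prod: "(\<And>k. k \<in> S \<Longrightarrow> f k \<in> alg_gen B) \<Longrightarrow> (\<lambda>x. \<Prod>k\<in>S. f k x) \<in> alg_gen B"
  by (induct S rule: infinite_finite_induct) (auto intro: alg_gen.intros)

lemma alg_gen_power: "f \<in> alg_gen B \<Longrightarrow> (\<lambda>x. f x ^ k) \<in> alg_gen B"
  by (induct k) (auto intro: alg_gen.intros)

lemma alg_gen_subst:
  assumes "cpoly_vars q \<subseteq> I"
  shows "(\<lambda>x. cpoly_at (cpoly_subst q f) (T *v x)) \<in> alg_gen ((\<lambda>k x. cpoly_at (f k) (T *v x)) ` I)"
  unfolding cpoly_at_subst
  by (intro alg_gen_sum alg_gen.mult alg_gen.const alg_gen_prod alg_gen_power alg_gen.gen imageI)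
    (use assms in \<open>auto simp: cpoly_vars_def\<close>)

lemma generator_in_algebra:
  assumes "k \<in> I"
  shows "f k \<in> generated_algebra I f"
proof -
  define q :: "'a cpoly" where "q = Poly_Mapping.single (Poly_Mapping.single k 1) 1"
  have "cpoly_vars q \<subseteq> I" using assms by (simp add: q_def cpoly_vars_def)
  moreover have "cpoly_subst q f = f k"
    by (simp add: q_def cpoly_subst_def substitute_def)
  ultimately show ?thesis unfolding generated_algebra_def by force
qed

section \<open>Orthonormal coordinates on the real form\<close>

text \<open>Stated for an arbitrary positive form \<open>B\<close>, since the inner product that
  matters is the one averaged over the group.\<close>

lemma gram_schmidt:
  fixes B :: "'a::real_vector \<Rightarrow> 'a \<Rightarrow> real"
  assumes linear: "\<And>y. linear (\<lambda>x. B x y)" and sym: "\<And>x y. B x y = B y x"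
    and pos: "\<And>x. x \<noteq> 0 \<Longrightarrow> B x x > 0" and "finite X"
  shows "\<exists>E. finite E \<and> span E = span X \<and> (\<forall>e\<in>E. \<forall>f\<in>E. B e f = (if e = f then 1 else 0))"
  using assms(4)
proof induct
  case empty
  show ?case by (rule exI[of _ "{}"]) simp
next
  case (insert x X)
  then obtain E where E: "finite E" "span E = span X"
    "\<And>e f. e \<in> E \<Longrightarrow> f \<in> E \<Longrightarrow> B e f = (if e = f then 1 else 0)" by blast
  have Badd: "B (y + z) w = B y w + B z w" and Bscale: "B (r *\<^sub>R y) w = r * B y w"
    and Bdiff: "B (y - z) w = B y w - B z w"
    and Bsum: "B (\<Sum>e\<in>S. h e) w = (\<Sum>e\<in>S. B (h e) w)" for y z w r S and h :: "'a \<Rightarrow> 'a"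
    using linear_add[OF linear] linear_scale[OF linear] linear_diff[OF linear] linear_sum[OF linear]
    by auto
  define p where "p = (\<Sum>e\<in>E. B x e *\<^sub>R e)"
  define y where "y = x - p"
  have p: "p \<in> span E" unfolding p_def by (intro span_sum span_scale span_base)
  have "B p f = B x f" if f: "f \<in> E" for f
  proof -
    have "B p f = (\<Sum>e\<in>E. if e = f then B x f else 0)"
      unfolding p_def Bsum Bscale by (rule sum.cong) (auto simp: E(3) f)
    then show ?thesis using f E(1) by simp
  qed
  then have yE: "B y f = 0" if "f \<in> E" for f using that by (simp add: y_def Bdiff)
  show ?case
  proof (cases "y = 0")
    case True
    then have "x \<in> span E" using p by (simp add: y_def)
    then have "span E = span (insert x X)" unfolding E(2) by (simp add: span_redundant)
    then show ?thesis using E(1,3) by blast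
  next
    case False
    define u where "u = (1 / sqrt (B y y)) *\<^sub>R y"
    have sq: "sqrt (B y y) > 0" "sqrt (B y y) * sqrt (B y y) = B y y" using pos[OF False] by simp_all
    have "B u u = (1 / sqrt (B y y)) * ((1 / sqrt (B y y)) * B y y)"
      unfolding u_def Bscale sym[of y "_ *\<^sub>R y"] ..
    then have uu: "B u u = 1" using sq by (simp add: field_simps)
    have uE: "B u f = 0" "B f u = 0" if "f \<in> E" for f
      using yE[OF that] sym[of f u] by (simp_all add: u_def Bscale)
    have "span (insert u E) = span (insert x E)"
    proof
      have "y \<in> span (insert x E)"
        unfolding y_def
        by (rule span_diff) (use p span_mono[of E "insert x E"] in \<open>auto intro: span_base\<close>)
      then have "u \<in> span (insert x E)" unfolding u_def by (rule span_scale)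
      then show "span (insert u E) \<subseteq> span (insert x E)"
        by (intro span_minimal) (auto intro: span_base)
      have "x = sqrt (B y y) *\<^sub>R u + p" using sq by (simp add: u_def y_def)
      moreover have "sqrt (B y y) *\<^sub>R u + p \<in> span (insert u E)"
        by (rule span_add, rule span_scale)
          (use p span_mono[of E "insert u E"] in \<open>auto intro: span_base\<close>)
      ultimately have "x \<in> span (insert u E)" by simp
      then show "span (insert x E) \<subseteq> span (insert u E)"
        by (intro span_minimal) (auto intro: span_base)
    qed
    also have "\<dots> = span (insert x X)"
    proof (rule equalityI; rule span_minimal)
      show "insert x E \<subseteq> span (insert x X)"
        using span_base[of _ E] E(2) span_mono[of X "insert x X"] by (auto intro: span_base)
      show "insert x X \<subseteq> span (insert x E)"
        using span_base[of _ X] E(2) span_mono[of E "insert x E"] by (auto intro: span_base)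
    qed simp_all
    finally have span: "span (insert u E) = span (insert x X)" .
    have "u \<notin> E" using uE(1)[of u] uu by auto
    then have "\<forall>e\<in>insert u E. \<forall>f\<in>insert u E. B e f = (if e = f then 1 else 0)"
      using E(3) uu uE by auto
    then show ?thesis using span E(1) by blast
  qed
qed

lemma real_form_unique:
  assumes "real_form V" "a \<in> V" "b \<in> V" "a + \<i> *s b = 0"
  shows "a = 0" "b = 0"
proof -
  have sub: "0 \<in> V" using assms(1) by (simp add: real_form_def subspace_0)
  from assms(1)[unfolded real_form_def, THEN conjunct2, THEN spec, of 0] obtain p where
    p: "\<And>q. (case q of (a, b) \<Rightarrow> a \<in> V \<and> b \<in> V \<and> 0 = a + \<i> *s b) \<Longrightarrow> q = p"
    by (elim ex1E) blast
  have "(a, b) = p" "(0, 0) = p" using p[of "(a, b)"] p[of "(0, 0)"] assms(2-4) sub by simp_all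
  then show "a = 0" "b = 0" by auto
qed

lemma real_form_decompose:
  assumes "real_form V"
  shows "\<exists>a\<in>V. \<exists>b\<in>V. v = a + \<i> *s b"
proof -
  have "\<exists>!(a, b). a \<in> V \<and> b \<in> V \<and> v = a + \<i> *s b" using assms by (simp add: real_form_def)
  then show ?thesis by (auto simp: Ex1_def)
qed

lemma scaleR_eq_scale: "r *\<^sub>R (v :: complex ^ 'n) = complex_of_real r *s v"
  by (simp add: vec_eq_iff) (simp add: scaleR_conv_of_real)

text \<open>A real orthonormal basis of the real form is a complex basis of the whole space; its
  vectors are the columns of \<open>T\<close>.\<close>

lemma orthonormal_coordinates:
  fixes V :: "(complex ^ 'n::finite) set" and B :: "complex ^ 'n \<Rightarrow> complex ^ 'n \<Rightarrow> real"
  assumes V: "real_form V"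
    and linear: "\<And>y. linear (\<lambda>x. B x y)" and sym: "\<And>x y. B x y = B y x"
    and pos: "\<And>x. x \<noteq> 0 \<Longrightarrow> B x x > 0"
  shows "\<exists>T :: complex ^ 'n ^ 'n. invertible T \<and> (\<forall>v. v \<in> V \<longleftrightarrow> (\<exists>x. v = T *v emb x)) \<and>
    (\<forall>x y. B (T *v emb x) (T *v emb y) = x \<bullet> y)"
proof -
  have Bscale: "B (r *\<^sub>R y) w = r * B y w"
    and Bsum: "B (\<Sum>e\<in>S. h e) w = (\<Sum>e\<in>S. B (h e) w)" for y w r and S :: "'s set" and h
    using linear_scale[OF linear] linear_sum[OF linear] by auto
  have "subspace V" using V by (simp add: real_form_def)
  then obtain X where X: "finite X" "span X = V"
    using basis_subspace_exists by metis
  obtain E where E: "finite E" "span E = V"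
    "\<And>e f. e \<in> E \<Longrightarrow> f \<in> E \<Longrightarrow> B e f = (if e = f then 1 else 0)"
    using gram_schmidt[OF linear sym pos X(1)] X(2) by metis
  have coeff: "B (\<Sum>e\<in>E. c e *\<^sub>R e) f = c f" if f: "f \<in> E" for c f
  proof -
    have "B (\<Sum>e\<in>E. c e *\<^sub>R e) f = (\<Sum>e\<in>E. if e = f then c f else 0)"
      unfolding Bsum Bscale by (rule sum.cong) (auto simp: E(3) f)
    then show ?thesis using f E(1) by simp
  qed
  \<comment> \<open>A complex relation splits into two real combinations in \<open>V\<close>, both
    zero by uniqueness of the decomposition along the real form.\<close>
  have "vec.independent E"
  proof (rule ccontr)
    assume "\<not> vec.independent E"
    then obtain c f where c: "f \<in> E" "c f \<noteq> 0" "(\<Sum>e\<in>E. c e *s e) = 0"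
      using vec.dependent_finite[OF E(1)] by blast
    have inV: "(\<Sum>e\<in>E. r e *\<^sub>R e) \<in> V" for r
      unfolding E(2)[symmetric] by (intro span_sum span_scale span_base)
    have "(\<Sum>e\<in>E. Re (c e) *\<^sub>R e) + \<i> *s (\<Sum>e\<in>E. Im (c e) *\<^sub>R e) = (\<Sum>e\<in>E. c e *s e)"
      by (simp add: vec.scale_sum_right sum.distrib[symmetric] vec_eq_iff complex_eq_iff)
    then have zero: "(\<Sum>e\<in>E. Re (c e) *\<^sub>R e) + \<i> *s (\<Sum>e\<in>E. Im (c e) *\<^sub>R e) = 0"
      unfolding c(3) .
    have "(\<Sum>e\<in>E. Re (c e) *\<^sub>R e) = 0" "(\<Sum>e\<in>E. Im (c e) *\<^sub>R e) = 0"
      by (rule real_form_unique[OF V inV inV zero])+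
    then have "Re (c f) = B 0 f" "Im (c f) = B 0 f"
      using coeff[OF c(1), of "\<lambda>e. Re (c e)"] coeff[OF c(1), of "\<lambda>e. Im (c e)"] by simp_all
    then show False using c(2) Bscale[of 0 0 f] by (simp add: complex_eq_iff)
  qed
  moreover have "vec.span E = UNIV"
  proof -
    have sub: "span E \<subseteq> vec.span E"
    proof (rule span_minimal)
      show "subspace (vec.span E)"
        unfolding subspace_def scaleR_eq_scale by (auto intro: vec.span_zero vec.span_add vec.span_scale)
    qed (auto intro: vec.span_base)
    have "v \<in> vec.span E" for v
    proof -
      obtain a b where "a \<in> V" "b \<in> V" "v = a + \<i> *s b" using real_form_decompose[OF V] by blast
      then show ?thesis using sub E(2) by (auto intro!: vec.span_add vec.span_scale)
    qed
    then show ?thesis by blast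
  qed
  ultimately have "card E = CARD('n)"
    by (metis vec.dim_eq_card vec.dim_UNIV vec_dim_card vec.span_UNIV)
  then obtain b :: "'n \<Rightarrow> complex ^ 'n" where b: "bij_betw b UNIV E"
    using finite_same_card_bij[of "UNIV :: 'n set" E] E(1) by auto
  then have bE: "b i \<in> E" for i by (auto simp: bij_betw_def)
  define T where "T = (\<chi> r i. b i $ r)"
  have T: "T *v y = (\<Sum>i\<in>UNIV. y $ i *s b i)" for y
    by (simp add: T_def vec_eq_iff matrix_vector_mult_def mult.commute)
  have Temb: "T *v emb x = (\<Sum>i\<in>UNIV. x $ i *\<^sub>R b i)" for x
    by (simp add: T emb_def scaleR_eq_scale)
  have Tsum: "(\<Sum>e\<in>E. c e *\<^sub>R e) = (\<Sum>i\<in>UNIV. c (b i) *\<^sub>R b i)" for c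
    using sum.reindex_bij_betw[OF b, of "\<lambda>e. c e *\<^sub>R e"] by simp
  have "surj ((*v) T)"
  proof -
    have "y \<in> range ((*v) T)" for y
    proof -
      have "y \<in> vec.span E" using \<open>vec.span E = UNIV\<close> by simp
      then obtain c where "y = (\<Sum>e\<in>E. c e *s e)" using vec.span_finite[OF E(1)] by auto
      then have "y = T *v (\<chi> i. c (b i))"
        using sum.reindex_bij_betw[OF b, of "\<lambda>e. c e *s e"] by (simp add: T)
      then show ?thesis by blast
    qed
    then show ?thesis by blast
  qed
  then have "invertible T"
    unfolding invertible_right_inverse matrix_right_invertible_surjective .
  moreover have "v \<in> V \<longleftrightarrow> (\<exists>x. v = T *v emb x)" for v
  proof
    assume "v \<in> V"
    then obtain c where "v = (\<Sum>e\<in>E. c e *\<^sub>R e)" using span_finite[OF E(1)] E(2) by auto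
    then have "v = T *v emb (\<chi> i. c (b i))" by (simp add: Tsum Temb)
    then show "\<exists>x. v = T *v emb x" ..
  next
    assume "\<exists>x. v = T *v emb x"
    then show "v \<in> V" unfolding Temb E(2)[symmetric] using bE by (auto intro: span_sum span_scale span_base)
  qed
  moreover have "B (T *v emb x) (T *v emb y) = x \<bullet> y" for x y
  proof -
    have 1: "B (T *v emb x) (b i) = x $ i" for x i
    proof -
      have "B (T *v emb x) (b i) = (\<Sum>j\<in>UNIV. x $ j * B (b j) (b i))"
        unfolding Temb by (simp add: Bsum Bscale)
      also have "\<dots> = (\<Sum>j\<in>UNIV. if j = i then x $ i else 0)"
        using E(3)[OF bE bE] b by (intro sum.cong) (auto simp: bij_betw_def inj_eq)
      finally show ?thesis by simp
    qed
    have "B (T *v emb x) (T *v emb y) = (\<Sum>i\<in>UNIV. x $ i * B (b i) (T *v emb y))"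
      by (subst Temb) (simp add: Bsum Bscale)
    also have "\<dots> = x \<bullet> y" by (simp add: sym[of "b _"] 1 inner_vec_def)
    finally show ?thesis .
  qed
  ultimately show ?thesis by (intro exI[of _ T]) simp
qed

lemma matrix_eq_on_emb:
  fixes M N :: "complex ^ 'n::finite ^ 'n"
  assumes "\<And>x. M *v emb x = N *v emb x"
  shows "M = N"
proof (rule matrix_eq[THEN iffD2], rule allI)
  fix x :: "complex ^ 'n"
  obtain p q where x: "x = emb p + \<i> *s emb q" by (rule real_imag_parts)
  show "M *v x = N *v x"
    unfolding x by (simp add: matrix_vector_right_distrib vector_scalar_commute assms)
qed

text \<open>A reflection that preserves the real form and the inner product is an orthogonal reflection
  in orthonormal coordinates: all displacements are complex, hence real, multiples of one vector.\<close>

lemma reflection_orthonormal: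
  fixes s T :: "complex ^ 'n::finite ^ 'n"
  assumes s: "reflection s" "defined_over V s" and T: "invertible T"
    and V: "\<And>v. v \<in> V \<longleftrightarrow> (\<exists>x. v = T *v emb x)"
    and B: "\<And>x y. B (T *v emb x) (T *v emb y) = x \<bullet> y" and sB: "\<And>x y. B (s *v x) (s *v y) = B x y"
  shows "\<exists>a. norm a = 1 \<and> s ** T = T ** cmat (refl a)"
proof -
  have T_inj: "x = y" if "T *v x = T *v y" for x y
    using that T by (metis invertible_def matrix_vector_mul_assoc matrix_vector_mul_lid)
  have "\<exists>y. s *v (T *v emb x) = T *v emb y" for x
    using s(2) V unfolding defined_over_def by blast
  then obtain \<alpha> where \<alpha>: "\<And>x. s *v (T *v emb x) = T *v emb (\<alpha> x)" by metis
  have iso: "\<alpha> x \<bullet> \<alpha> y = x \<bullet> y" for x y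
    using sB[of "T *v emb x" "T *v emb y"] unfolding \<alpha> B .
  have "\<exists>x. \<alpha> x \<noteq> x"
  proof (rule ccontr)
    assume "\<not> ?thesis"
    then have "s ** T = T"
      by (intro matrix_eq_on_emb) (simp add: matrix_vector_mul_assoc[symmetric] \<alpha>)
    then have "s = mat 1" using T by (metis invertible_def matrix_mul_assoc matrix_mul_rid)
    then show False using s(1) by (simp add: reflection_def)
  qed
  then obtain x0 where x0: "\<alpha> x0 \<noteq> x0" by blast
  define f where "f = \<alpha> x0 - x0"
  have f: "f \<noteq> 0" "f \<bullet> f > 0" using x0 by (simp_all add: f_def)
  define Fix where "Fix = {v. s *v v = v}"
  have sub: "vec.subspace Fix"
    unfolding Fix_def vec.subspace_def
    by (auto simp: matrix_vector_right_distrib vector_scalar_commute)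
  have notin: "T *v emb x0 \<notin> Fix"
    using x0 T_inj[of "emb (\<alpha> x0)" "emb x0"] by (auto simp: Fix_def \<alpha> emb_eq_iff)
  have spanFix: "vec.span Fix = Fix" using sub by (simp add: vec.span_eq_iff)
  have "T *v emb x0 \<notin> vec.span Fix" using notin unfolding spanFix .
  moreover have "vec.dim Fix = CARD('n) - 1" using s(1) by (simp add: Fix_def reflection_def)
  ultimately have "vec.dim (insert (T *v emb x0) Fix) = CARD('n)" by (simp add: vec.dim_insert)
  then have "vec.span (insert (T *v emb x0) Fix) = UNIV"
    by (simp add: vec.dim_eq_full[symmetric] vec.dimension_def card_cart_basis)
  then have decomp: "\<exists>c. T *v emb y - c *s (T *v emb x0) \<in> Fix" for y
    using vec.span_breakdown_eq[of "T *v emb y" "T *v emb x0" Fix] unfolding spanFix by simp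
  have shift: "\<exists>r. \<alpha> y = y + r *\<^sub>R f" for y
  proof -
    obtain c where "T *v emb y - c *s (T *v emb x0) \<in> Fix" using decomp by blast
    then have "s *v (T *v emb y - c *s (T *v emb x0)) = T *v emb y - c *s (T *v emb x0)"
      by (simp add: Fix_def)
    then have "T *v emb (\<alpha> y) - c *s (T *v emb (\<alpha> x0)) = T *v emb y - c *s (T *v emb x0)"
      by (simp add: matrix_vector_mult_diff_distrib vector_scalar_commute \<alpha>)
    then have "T *v (emb (\<alpha> y) - c *s emb (\<alpha> x0)) = T *v (emb y - c *s emb x0)"
      by (simp add: matrix_vector_mult_diff_distrib vector_scalar_commute)
    then have *: "emb (\<alpha> y) - c *s emb (\<alpha> x0) = emb y - c *s emb x0" by (rule T_inj)
    \<comment> \<open>The coefficient \<open>c\<close> may be complex; as all other entries are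
      real, real parts suffice.\<close>
    have "\<alpha> y $ i = (y + Re c *\<^sub>R f) $ i" for i
      using arg_cong[OF *, of "\<lambda>v. Re (v $ i)"] by (simp add: emb_def f_def algebra_simps)
    then show ?thesis by (auto simp: vec_eq_iff)
  qed
  define a where "a = (1 / norm f) *\<^sub>R f"
  have "norm a = 1" using f by (simp add: a_def)
  have "\<alpha> y = refl a *v y" for y
  proof -
    obtain r where r: "\<alpha> y = y + r *\<^sub>R f" using shift by blast
    \<comment> \<open>Equal norms of \<open>y\<close> and \<open>\<alpha> y\<close> give a quadratic
      equation for \<open>r\<close>. Its solution \<open>r = 0\<close> fits the formula too, because
      comparing products with \<open>x0\<close> then shows that \<open>y\<close> is orthogonal to
      \<open>f\<close>.\<close>
    have "r = - 2 * (f \<bullet> y) / (f \<bullet> f)"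
    proof (cases "r = 0")
      case True
      then have "\<alpha> y \<bullet> \<alpha> x0 = y \<bullet> \<alpha> x0" using r by simp
      then have "y \<bullet> f = 0" using iso[of y x0] by (simp add: f_def inner_diff_right)
      then show ?thesis using True by (simp add: inner_commute)
    next
      case False
      have "r * (2 * (f \<bullet> y) + r * (f \<bullet> f)) = 0"
        using iso[of y y] unfolding r by (simp add: inner_add_left inner_add_right inner_commute algebra_simps)
      then have "2 * (f \<bullet> y) + r * (f \<bullet> f) = 0" using False by simp
      then have "r * (f \<bullet> f) = - 2 * (f \<bullet> y)" by linarith
      then show ?thesis using f(2) by (simp add: field_simps)
    qed
    moreover have "(norm f)\<^sup>2 = f \<bullet> f" by (rule power2_norm_eq_inner)
    ultimately show ?thesis
      unfolding r refl_vector a_def by (simp add: power2_eq_square)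
  qed
  then have "s ** T = T ** cmat (refl a)"
    by (intro matrix_eq_on_emb) (simp add: matrix_vector_mul_assoc[symmetric] \<alpha> cmat_mult_emb)
  then show ?thesis using \<open>norm a = 1\<close> by blast
qed

text \<open>Averaging over the finite group gives an invariant inner product; in orthonormal
  coordinates for it the generators become orthogonal reflections \<open>refl a\<close>.\<close>

lemma coxeter_group_coordinates:
  fixes V :: "(complex ^ 'n::finite) set" and W :: "(complex ^ 'n ^ 'n) set"
  assumes V: "real_form V" and W: "coxeter_group V W" "irreducible_rep W" and n: "CARD('n) \<ge> 2"
  shows "\<exists>(T :: complex ^ 'n ^ 'n) A. invertible T \<and> reflection_group A \<and>
    (\<forall>M\<in>refl_prods A. \<exists>w\<in>W. w ** T = T ** cmat M) \<and>
    (\<forall>w\<in>W. \<exists>M\<in>refl_prods A. w ** T = T ** cmat M)"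
proof -
  obtain S where finW: "finite W" and S: "\<And>s. s \<in> S \<Longrightarrow> reflection s" "\<And>s. s \<in> S \<Longrightarrow> defined_over V s"
    and gen: "W = generate general_linear_group S"
    using W(1) by (auto simp: coxeter_group_def)
  have W_one: "mat 1 \<in> W" unfolding gen
    using generate.one[of general_linear_group S] by (simp add: general_linear_group_def)
  have W_mult: "v ** w \<in> W" if "v \<in> W" "w \<in> W" for v w
    using that generate.eng[of v general_linear_group S w] unfolding gen
    by (simp add: general_linear_group_def)
  have W_S: "s \<in> W" if "s \<in> S" for s using generate.incl[OF that] unfolding gen .
  define B where "B x y = (\<Sum>w\<in>W. (w *v x) \<bullet> (w *v y))" for x y
  have sB: "B (s *v x) (s *v y) = B x y" if s: "s \<in> S" for s x y
  proof -
    have inj: "inj_on (\<lambda>w. w ** s) W"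
    proof (rule inj_onI)
      fix v w assume eq: "v ** s = w ** s"
      obtain t where "s ** t = mat 1" using S(1)[OF s] by (auto simp: reflection_def invertible_def)
      then show "v = w" using arg_cong[OF eq, of "\<lambda>u. u ** t"] by (simp add: matrix_mul_assoc[symmetric])
    qed
    have "(\<lambda>w. w ** s) ` W = W"
      by (rule endo_inj_surj[OF finW _ inj]) (use W_mult W_S[OF s] in auto)
    then have "B x y = (\<Sum>w\<in>(\<lambda>w. w ** s) ` W. (w *v x) \<bullet> (w *v y))" by (simp add: B_def)
    also have "\<dots> = B (s *v x) (s *v y)"
      unfolding sum.reindex[OF inj] by (simp add: B_def matrix_vector_mul_assoc)
    finally show ?thesis ..
  qed
  have "\<exists>T :: complex ^ 'n ^ 'n. invertible T \<and> (\<forall>v. v \<in> V \<longleftrightarrow> (\<exists>x. v = T *v emb x)) \<and>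
      (\<forall>x y. B (T *v emb x) (T *v emb y) = x \<bullet> y)"
  proof (rule orthonormal_coordinates[OF V])
    show "linear (\<lambda>x. B x y)" for y
    proof -
      have "w *v (r *\<^sub>R x) = r *\<^sub>R (w *v x)" for w :: "complex ^ 'n ^ 'n" and r x
        by (simp add: scaleR_eq_scale vector_scalar_commute)
      then show ?thesis unfolding B_def
        by (intro linearI)
          (simp_all add: matrix_vector_right_distrib inner_add_left sum.distrib sum_distrib_left)
    qed
    show "B x y = B y x" for x y unfolding B_def by (simp add: inner_commute)
    show "B x x > 0" if "x \<noteq> 0" for x
      unfolding B_def using finW W_one that by (intro sum_pos2[of _ "mat 1"]) auto
  qed
  then obtain T :: "complex ^ 'n ^ 'n" where T: "invertible T" "\<And>v. v \<in> V \<longleftrightarrow> (\<exists>x. v = T *v emb x)"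
    "\<And>x y. B (T *v emb x) (T *v emb y) = x \<bullet> y" by blast
  obtain T' where T': "T ** T' = mat 1" "T' ** T = mat 1" using T(1) by (auto simp: invertible_def)
  have cancel: "M = N" if "T ** M = T ** N" for M N :: "complex ^ 'n ^ 'n"
    using arg_cong[OF that, of "\<lambda>X. T' ** X"] by (simp add: matrix_mul_assoc T')
  have cancel_right: "v = w" if "v ** T = w ** T" for v w :: "complex ^ 'n ^ 'n"
    using arg_cong[OF that, of "\<lambda>X. X ** T'"] by (simp add: matrix_mul_assoc[symmetric] T')
  have refl_S: "\<exists>a. norm a = 1 \<and> s ** T = T ** cmat (refl a)" if "s \<in> S" for s
    by (rule reflection_orthonormal[OF S(1) S(2) T sB]) (use that in simp_all)
  define A where "A = {a. norm a = 1 \<and> (\<exists>s\<in>S. s ** T = T ** cmat (refl a))}"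
  have to_W: "\<exists>w\<in>W. w ** T = T ** cmat M" if "M \<in> refl_prods A" for M
    using that
  proof induct
    case one
    show ?case by (rule bexI[OF _ W_one]) (simp add: cmat_one)
  next
    case (step a M)
    then obtain s w where sw: "s \<in> S" "s ** T = T ** cmat (refl a)" "w \<in> W" "w ** T = T ** cmat M"
      by (auto simp: A_def)
    have "(s ** w) ** T = s ** (T ** cmat M)" by (simp add: sw(4) flip: matrix_mul_assoc)
    also have "\<dots> = T ** cmat (refl a ** M)" by (simp add: sw(2) cmat_mult matrix_mul_assoc)
    finally show ?case using W_mult[OF W_S[OF sw(1)] sw(3)] by blast
  qed
  have from_W: "\<exists>M\<in>refl_prods A. w ** T = T ** cmat M" if "w \<in> W" for w
    using that unfolding gen
  proof induct
    case one
    show ?case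
      by (rule bexI[OF _ refl_prods.one]) (simp add: cmat_one general_linear_group_def)
  next
    case (incl s)
    then show ?case using refl_S[OF incl] refl_prods_refl[of _ A] by (auto simp: A_def)
  next
    case (inv s)
    \<comment> \<open>A generator is conjugate to \<open>refl a\<close>, hence an involution and its
      own inverse.\<close>
    obtain a where a: "norm a = 1" "s ** T = T ** cmat (refl a)" using refl_S[OF inv] by blast
    have "(s ** s) ** T = s ** (T ** cmat (refl a))" by (simp add: a(2) flip: matrix_mul_assoc)
    also have "\<dots> = T ** (cmat (refl a ** refl a))" by (simp add: a(2) cmat_mult matrix_mul_assoc)
    also have "\<dots> = mat 1 ** T" by (simp add: refl_refl a(1) cmat_one)
    finally have ss: "s ** s = mat 1" by (rule cancel_right)
    have "inv\<^bsub>general_linear_group\<^esub> s = s"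
      unfolding m_inv_def
    proof (rule the_equality)
      show "s \<in> carrier general_linear_group \<and> s \<otimes>\<^bsub>general_linear_group\<^esub> s = \<one>\<^bsub>general_linear_group\<^esub> \<and>
          s \<otimes>\<^bsub>general_linear_group\<^esub> s = \<one>\<^bsub>general_linear_group\<^esub>"
        using ss by (auto simp: general_linear_group_def invertible_def)
      fix t assume "t \<in> carrier general_linear_group \<and> s \<otimes>\<^bsub>general_linear_group\<^esub> t = \<one>\<^bsub>general_linear_group\<^esub> \<and>
          t \<otimes>\<^bsub>general_linear_group\<^esub> s = \<one>\<^bsub>general_linear_group\<^esub>"
      then have "s ** t = mat 1" by (simp add: general_linear_group_def)
      then have "s ** (s ** t) = s" by simp
      then show "t = s" by (simp add: matrix_mul_assoc ss)
    qed
    then show ?case using a refl_prods_refl[of a A] inv by (auto simp: A_def)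
  next
    case (eng v w)
    then obtain M N where MN: "M \<in> refl_prods A" "v ** T = T ** cmat M" "N \<in> refl_prods A" "w ** T = T ** cmat N"
      by blast
    have "(v ** w) ** T = v ** (T ** cmat N)" by (simp add: MN(4) flip: matrix_mul_assoc)
    also have "\<dots> = T ** cmat (M ** N)" by (simp add: MN(2) cmat_mult matrix_mul_assoc)
    finally show ?case using refl_prods_mult[OF MN(1,3)]
      by (auto simp: general_linear_group_def)
  qed
  have "reflection_group A"
  proof
    show "norm a = 1" if "a \<in> A" for a using that by (simp add: A_def)
    show "CARD('n) \<ge> 2" by (rule n)
    show "finite (refl_prods A)"
    proof (rule inj_on_finite[of "\<lambda>M. T ** cmat M ** T'"])
      show "inj_on (\<lambda>M. T ** cmat M ** T') (refl_prods A)"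
      proof (rule inj_onI)
        fix M N assume eq: "T ** cmat M ** T' = T ** cmat N ** T'"
        have "T ** cmat M = T ** cmat N"
          using arg_cong[OF eq, of "\<lambda>X. X ** T"] by (simp add: matrix_mul_assoc[symmetric] T')
        then have "cmat M = cmat N" by (rule cancel)
        then show "M = N" by (simp add: cmat_def vec_eq_iff)
      qed
      show "(\<lambda>M. T ** cmat M ** T') ` refl_prods A \<subseteq> W"
      proof (rule image_subsetI)
        fix M assume "M \<in> refl_prods A"
        then obtain w where w: "w \<in> W" "w ** T = T ** cmat M" using to_W by blast
        have "T ** cmat M ** T' = w" unfolding w(2)[symmetric] by (simp add: matrix_mul_assoc[symmetric] T')
        then show "T ** cmat M ** T' \<in> W" using w(1) by simp
      qed
      show "finite W" by (rule finW)
    qed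
    fix U :: "(real ^ 'n) set"
    assume U: "subspace U" and inv: "\<And>a u. a \<in> A \<Longrightarrow> u \<in> U \<Longrightarrow> refl a *v u \<in> U"
    have inv_prods: "M *v u \<in> U" if "M \<in> refl_prods A" "u \<in> U" for M u
      using that(1) by induct (use that(2) inv in \<open>auto simp: matrix_vector_mul_assoc[symmetric]\<close>)
    \<comment> \<open>The complexification of a real invariant subspace, moved to the original
      coordinates, is a complex invariant subspace; so complex irreducibility passes to the real
      form.\<close>
    define UC where "UC = {T *v (emb p + \<i> *s emb q) | p q. p \<in> U \<and> q \<in> U}"
    have "vec.subspace UC"
      unfolding vec.subspace_def
    proof (intro conjI ballI allI)
      have "T *v (emb 0 + \<i> *s emb 0) \<in> UC" using subspace_0[OF U] unfolding UC_def by blast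
      then show "0 \<in> UC" by (simp add: emb_def flip: zero_vec_def)
    next
      fix x y assume "x \<in> UC" "y \<in> UC"
      then obtain p q p' q' where *: "p \<in> U" "q \<in> U" "p' \<in> U" "q' \<in> U"
        "x = T *v (emb p + \<i> *s emb q)" "y = T *v (emb p' + \<i> *s emb q')" by (auto simp: UC_def)
      have "x + y = T *v (emb (p + p') + \<i> *s emb (q + q'))"
        by (simp add: * emb_add vec.scale_right_distrib matrix_vector_right_distrib)
      then show "x + y \<in> UC" using * subspace_add[OF U] unfolding UC_def by blast
    next
      fix c x assume "x \<in> UC"
      then obtain p q where *: "p \<in> U" "q \<in> U" "x = T *v (emb p + \<i> *s emb q)" by (auto simp: UC_def)
      have "c *s (emb p + \<i> *s emb q) =
          emb (Re c *\<^sub>R p - Im c *\<^sub>R q) + \<i> *s emb (Re c *\<^sub>R q + Im c *\<^sub>R p)"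
        by (simp add: emb_def vec_eq_iff complex_eq_iff)
      then have "c *s x = T *v (emb (Re c *\<^sub>R p - Im c *\<^sub>R q) + \<i> *s emb (Re c *\<^sub>R q + Im c *\<^sub>R p))"
        by (metis *(3) vector_scalar_commute)
      then show "c *s x \<in> UC"
        using * subspace_add[OF U] subspace_diff[OF U] subspace_scale[OF U] unfolding UC_def by blast
    qed
    moreover have "w *v u \<in> UC" if wu: "w \<in> W" "u \<in> UC" for w u
    proof -
      obtain p q where *: "p \<in> U" "q \<in> U" "u = T *v (emb p + \<i> *s emb q)"
        using wu(2) by (auto simp: UC_def)
      obtain M where M: "M \<in> refl_prods A" "w ** T = T ** cmat M" using from_W[OF wu(1)] by blast
      have "w *v u = T *v (emb (M *v p) + \<i> *s emb (M *v q))"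
        by (simp add: * matrix_vector_mul_assoc M(2) flip: cmat_mult_complex)
      then show ?thesis using inv_prods[OF M(1)] * unfolding UC_def by blast
    qed
    ultimately have "UC = {0} \<or> UC = UNIV" using W(2) by (simp add: irreducible_rep_def)
    then show "U = {0} \<or> U = UNIV"
    proof
      assume "UC = {0}"
      have "p = 0" if "p \<in> U" for p
      proof -
        have "T *v (emb p + \<i> *s emb 0) \<in> UC" using subspace_0[OF U] that unfolding UC_def by blast
        then have "T *v (emb p + \<i> *s emb 0) = 0" using \<open>UC = {0}\<close> by simp
        then have "emb p + \<i> *s emb 0 = 0"
          by (metis T'(2) matrix_vector_mul_assoc matrix_vector_mul_lid matrix_vector_mult_0_right)
        then show ?thesis by (simp add: emb_def vec_eq_iff)
      qed
      then show ?thesis using subspace_0[OF U] by blast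
    next
      assume all: "UC = UNIV"
      have "x \<in> U" for x
      proof -
        obtain p q where *: "p \<in> U" "q \<in> U" "T *v emb x = T *v (emb p + \<i> *s emb q)"
          using all unfolding UC_def by blast
        then have "emb x + \<i> *s emb 0 = emb p + \<i> *s emb q"
          by (metis T'(2) matrix_vector_mul_assoc matrix_vector_mul_lid add.right_neutral
              emb_eq_0_iff vec.scale_zero_right)
        then show ?thesis using *(1) unfolding emb_complex_eq_iff by simp
      qed
      then show ?thesis by blast
    qed
  qed
  then show ?thesis using T(1) to_W from_W by blast
qed

text \<open>Return to the original coordinates and to formal polynomials: gradients change by the
  transpose of \<open>T\<close>, so the matrix found in orthonormal coordinates is conjugated, and
  polynomials with equal values are equal.\<close>

lemma gradient_top_cpoly:
  fixes p :: "nat \<Rightarrow> 'n::finite cpoly"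
  assumes "real_form V" "coxeter_group V \<W>" "irreducible_rep \<W>" "basic_invariants \<W> p"
    and mono: "mono_on {1..CARD('n)} (\<lambda>k. total_degree (p k))"
    and n: "CARD('n) \<ge> 2" and j: "j \<in> {1..CARD('n)}"
  shows "\<exists>(A :: 'n cpoly ^ 'n ^ 'n) h. \<forall>c. partial_deriv c (p CARD('n)) =
    (\<Sum>e\<in>UNIV. A $ e $ c * partial_deriv e (p j)) + (\<Sum>k\<in>{1..CARD('n)}. h c k * p k)"
proof -
  let ?I = "{1..CARD('n)}"
  obtain T :: "complex ^ 'n ^ 'n" and A where T: "invertible T" and A: "reflection_group A"
    and to_W: "\<And>M. M \<in> refl_prods A \<Longrightarrow> \<exists>w\<in>\<W>. w ** T = T ** cmat M"
    and from_W: "\<And>w. w \<in> \<W> \<Longrightarrow> \<exists>M\<in>refl_prods A. w ** T = T ** cmat M"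
    using coxeter_group_coordinates[OF assms(1-3) n] by blast
  interpret reflection_group A by (rule A)
  obtain T' where T': "T ** T' = mat 1" "T' ** T = mat 1" using T by (auto simp: invertible_def)
  have TT': "T *v (T' *v x) = x" "T' *v (T *v x) = x" for x
    by (simp_all add: matrix_vector_mul_assoc T')
  have hom: "\<And>k. k \<in> ?I \<Longrightarrow> homogeneous_cpoly (p k)" and gen: "generated_algebra ?I p = invariant_ring \<W>"
    using assms(4) by (simp_all add: basic_invariants_def)
  \<comment> \<open>Any numbering serves, since the index type has as many elements as there are
    invariants; the order of the degrees enters only through \<open>l\<close>.\<close>
  obtain b :: "'n \<Rightarrow> nat" where b: "bij_betw b UNIV ?I"
    using finite_same_card_bij[of "UNIV :: 'n set" ?I] by auto
  then have bI: "b i \<in> ?I" for i by (auto simp: bij_betw_def)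
  define P where "P i x = cpoly_at (p (b i)) (T *v x)" for i x
  define d where "d i = total_degree (p (b i))" for i
  have pP: "pfun (P i)" for i
    unfolding P_def[abs_def] by (rule pfun_compose[OF pfun_cpoly_at pfun_matrix_vector])
  have range_P: "range P = (\<lambda>k x. cpoly_at (p k) (T *v x)) ` ?I"
  proof -
    have "range b = ?I" using b by (simp add: bij_betw_def)
    then show ?thesis unfolding P_def[abs_def] by (simp only: image_image flip: \<open>range b = ?I\<close>)
  qed
  interpret basic_invariants_real A P d
  proof
    show "invariant (P k)" for k
      unfolding invariant_def
    proof (intro conjI ballI allI pP)
      fix M x assume "M \<in> refl_prods A"
      then obtain w where w: "w \<in> \<W>" "w ** T = T ** cmat M" using to_W by blast
      have "p (b k) \<in> invariant_ring \<W>" using generator_in_algebra[OF bI] gen by metis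
      then have "cpoly_at (p (b k)) (w *v (T *v x)) = cpoly_at (p (b k)) (T *v x)"
        using w(1) by (simp add: invariant_ring_def)
      then show "P k (cmat M *v x) = P k x" by (simp add: P_def matrix_vector_mul_assoc w(2))
    qed
    show "P k (t *s x) = t ^ d k * P k x" for k t x
      by (simp add: P_def d_def vector_scalar_commute homogeneous_cpoly_at[OF hom[OF bI]])
    fix q assume q: "invariant q"
    have "pfun q" using q by (simp add: invariant_def)
    from pfun_imp_cpoly[OF pfun_compose[OF this pfun_matrix_vector]] obtain Q
      where "(\<lambda>x. q (T' *v x)) = cpoly_at Q" ..
    then have Q: "q (T' *v x) = cpoly_at Q x" for x by (rule fun_cong)
    have "Q \<in> invariant_ring \<W>"
      unfolding invariant_ring_def
    proof (intro CollectI ballI allI)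
      fix w x assume "w \<in> \<W>"
      then obtain M where M: "M \<in> refl_prods A" "w ** T = T ** cmat M" using from_W by blast
      have "w *v x = (w ** T) *v (T' *v x)" by (simp add: TT' flip: matrix_vector_mul_assoc)
      then have "T' *v (w *v x) = cmat M *v (T' *v x)"
        unfolding M(2) by (simp add: TT' flip: matrix_vector_mul_assoc)
      then show "cpoly_at Q (w *v x) = cpoly_at Q x"
        using q M(1) by (simp add: invariant_def flip: Q)
    qed
    then obtain r where r: "cpoly_vars r \<subseteq> ?I" "Q = cpoly_subst r p"
      unfolding gen[symmetric] generated_algebra_def by blast
    have "q x = cpoly_at Q (T *v x)" for x using Q[of "T *v x"] by (simp add: TT')
    then have "q = (\<lambda>x. cpoly_at (cpoly_subst r p) (T *v x))" using r(2) by blast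
    then show "q \<in> alg_gen (range P)" unfolding range_P using alg_gen_subst[OF r(1)] by simp
  qed
  have bij: "\<exists>i. b i = k" if "k \<in> ?I" for k
    using b that unfolding bij_betw_def by (metis imageE)
  obtain l where l: "b l = CARD('n)" using bij[of "CARD('n)"] n by auto
  obtain j' where j': "b j' = j" using bij j by blast
  have "d i \<le> d l" for i
    using monotone_onD[OF mono bI, of "CARD('n)" i] bI[of i] n by (simp add: d_def l)
  from gradient_top_invariant[where j = j', OF this] obtain B H
    where BH': "\<forall>a b. pfun (B a b)" "\<forall>k b. pfun (H k b)"
      "\<forall>x b. grad (P l) x $ b =
        (\<Sum>a\<in>UNIV. grad (P j') x $ a * B a b x) + (\<Sum>k\<in>UNIV. H k b x * P k x)"
    by (elim exE conjE)
  then have BH: "\<And>a b. pfun (B a b)" "\<And>k b. pfun (H k b)"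
    "\<And>x b. grad (P l) x $ b =
      (\<Sum>a\<in>UNIV. grad (P j') x $ a * B a b x) + (\<Sum>k\<in>UNIV. H k b x * P k x)"
    by simp_all
  let ?g = "\<lambda>k y e. cpoly_at (partial_deriv e (p k)) y"
  have gradP: "grad (P i) x $ a = (\<Sum>e\<in>UNIV. T $ e $ a * ?g (b i) (T *v x) e)" for i x a
    unfolding P_def[abs_def] grad_compose_linear[OF pfun_cpoly_at]
    by (simp add: matrix_vector_mult_def transpose_def cpoly_at_partial_deriv)
  have grad_p: "?g k y c = (\<Sum>a\<in>UNIV. T' $ a $ c * grad (P i) (T' *v y) $ a)" if "b i = k" for k y c i
  proof -
    have "grad (P i) (T' *v y) = transpose T *v grad (cpoly_at (p k)) y"
      unfolding P_def[abs_def] grad_compose_linear[OF pfun_cpoly_at] by (simp add: TT' that)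
    then have "transpose T' *v grad (P i) (T' *v y) = grad (cpoly_at (p k)) y"
      by (simp add: matrix_vector_mul_assoc T' transpose_mat flip: matrix_transpose_mul)
    from arg_cong[OF this, of "\<lambda>v. v $ c"] show ?thesis
      by (simp add: matrix_vector_mult_def transpose_def cpoly_at_partial_deriv)
  qed
  \<comment> \<open>The entries of \<open>T ** B ** T'\<close>, with \<open>B\<close> taken at the
    point \<open>T' *v y\<close>.\<close>
  define \<A> where "\<A> e c y = (\<Sum>x\<in>UNIV. T' $ x $ c * (\<Sum>a\<in>UNIV. T $ e $ a * B a x (T' *v y)))" for e c y
  define \<H> where "\<H> c i y = (\<Sum>x\<in>UNIV. T' $ x $ c * H i x (T' *v y))" for c i y
  have "pfun (\<A> e c)" for e c
    unfolding \<A>_def[abs_def] by (intro pfun_sum pfun.mult pfun.const pfun_compose[OF BH(1)] pfun_matrix_vector)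
  then have "\<exists>q. \<A> e c = cpoly_at q" for e c by (rule pfun_imp_cpoly)
  then obtain A' where A': "\<And>e c. \<A> e c = cpoly_at (A' e c)" by metis
  have "pfun (\<H> c i)" for c i
    unfolding \<H>_def[abs_def] by (intro pfun_sum pfun.mult pfun.const pfun_compose[OF BH(2)] pfun_matrix_vector)
  then have "\<exists>q. \<H> c i = cpoly_at q" for c i by (rule pfun_imp_cpoly)
  then obtain H' where H': "\<And>c i. \<H> c i = cpoly_at (H' c i)" by metis
  have "?g (CARD('n)) y c = (\<Sum>e\<in>UNIV. \<A> e c y * ?g j y e) + (\<Sum>i\<in>UNIV. \<H> c i y * cpoly_at (p (b i)) y)" for y c
  proof -
    have "?g (CARD('n)) y c = (\<Sum>x\<in>UNIV. T' $ x $ c * ((\<Sum>a\<in>UNIV. (\<Sum>e\<in>UNIV. T $ e $ a * ?g j y e) * B a x (T' *v y)) +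
        (\<Sum>i\<in>UNIV. H i x (T' *v y) * cpoly_at (p (b i)) y)))"
      unfolding grad_p[OF l] BH(3) unfolding gradP by (simp add: TT' j' P_def)
    also have "\<dots> = (\<Sum>x\<in>UNIV. \<Sum>a\<in>UNIV. \<Sum>e\<in>UNIV. T' $ x $ c * (T $ e $ a * B a x (T' *v y)) * ?g j y e) +
        (\<Sum>x\<in>UNIV. \<Sum>i\<in>UNIV. T' $ x $ c * H i x (T' *v y) * cpoly_at (p (b i)) y)"
      by (simp add: distrib_left sum.distrib sum_distrib_left sum_distrib_right mult_ac)
    also have "(\<Sum>x\<in>UNIV. \<Sum>i\<in>UNIV. T' $ x $ c * H i x (T' *v y) * cpoly_at (p (b i)) y) =
        (\<Sum>i\<in>UNIV. \<H> c i y * cpoly_at (p (b i)) y)"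
      by (subst sum.swap) (simp add: \<H>_def sum_distrib_right)
    also have "(\<Sum>x\<in>UNIV. \<Sum>a\<in>UNIV. \<Sum>e\<in>UNIV. T' $ x $ c * (T $ e $ a * B a x (T' *v y)) * ?g j y e) =
        (\<Sum>x\<in>UNIV. \<Sum>e\<in>UNIV. \<Sum>a\<in>UNIV. T' $ x $ c * (T $ e $ a * B a x (T' *v y)) * ?g j y e)"
      by (intro sum.cong[OF HOL.refl] sum.swap)
    also have "\<dots> = (\<Sum>e\<in>UNIV. \<Sum>x\<in>UNIV. \<Sum>a\<in>UNIV. T' $ x $ c * (T $ e $ a * B a x (T' *v y)) * ?g j y e)"
      by (rule sum.swap)
    also have "\<dots> = (\<Sum>e\<in>UNIV. \<A> e c y * ?g j y e)"
      by (simp add: \<A>_def sum_distrib_left sum_distrib_right)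
    finally show ?thesis .
  qed
  moreover have "(\<Sum>i\<in>UNIV. \<H> c i y * cpoly_at (p (b i)) y) =
      (\<Sum>k\<in>?I. \<H> c (inv_into UNIV b k) y * cpoly_at (p k) y)" for c y
    using sum.reindex_bij_betw[OF b, of "\<lambda>k. \<H> c (inv_into UNIV b k) y * cpoly_at (p k) y"] b
    by (simp add: bij_betw_def)
  ultimately have "cpoly_at (partial_deriv c (p CARD('n))) y =
      cpoly_at ((\<Sum>e\<in>UNIV. A' e c * partial_deriv e (p j)) + (\<Sum>k\<in>?I. H' c (inv_into UNIV b k) * p k)) y" for c y
    by (simp add: cpoly_at_add cpoly_at_sum cpoly_at_mult A' H')
  then have "partial_deriv c (p CARD('n)) =
      (\<Sum>e\<in>UNIV. A' e c * partial_deriv e (p j)) + (\<Sum>k\<in>?I. H' c (inv_into UNIV b k) * p k)" for c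
    by (rule cpoly_eqI)
  then show ?thesis
    by (intro exI[of _ "\<chi> e c. A' e c"] exI[of _ "\<lambda>c k. H' c (inv_into UNIV b k)"]) simp
qed

theorem corollary0p3:
  fixes V\<^sub>R :: "(complex ^ 'n::finite) set"
    and W :: "(complex ^ 'n ^ 'n) set"
    and p :: "nat \<Rightarrow> 'n cpoly"
    and F :: "'n cpoly set"
  assumes "real_form V\<^sub>R"
    and "coxeter_group V\<^sub>R W"
    and "irreducible_rep W"
    and "basic_invariants W p"
    and "mono_on {1..CARD('n)} (\<lambda>k. total_degree (p k))"
    and "F = ideal_generated (p ` {1..CARD('n)})"
  shows "\<forall>j\<in>{1..CARD('n)}. \<exists>A :: 'n cpoly ^ 'n ^ 'n.
           gradient (p CARD('n)) - gradient (p j) v* A \<in> ideal_times_free_module F"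
proof
  fix j assume j: "j \<in> {1..CARD('n)}"
  interpret R: module "(*) :: 'n cpoly \<Rightarrow> 'n cpoly \<Rightarrow> 'n cpoly" by (rule module_times)
  show "\<exists>A :: 'n cpoly ^ 'n ^ 'n. gradient (p CARD('n)) - gradient (p j) v* A \<in> ideal_times_free_module F"
  proof (cases "CARD('n) \<ge> 2")
    case True
    obtain A :: "'n cpoly ^ 'n ^ 'n" and h where Ah: "\<And>c. partial_deriv c (p CARD('n)) =
        (\<Sum>e\<in>UNIV. A $ e $ c * partial_deriv e (p j)) + (\<Sum>k\<in>{1..CARD('n)}. h c k * p k)"
      using gradient_top_cpoly[OF assms(1-5) True j] by blast
    have "(gradient (p CARD('n)) - gradient (p j) v* A) $ c \<in> ideal_generated (p ` {1..CARD('n)})" for c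
    proof -
      have "(gradient (p CARD('n)) - gradient (p j) v* A) $ c = (\<Sum>k\<in>{1..CARD('n)}. h c k * p k)"
        by (simp add: gradient_def vector_matrix_mult_def Ah mult.commute)
      also have "\<dots> \<in> ideal_generated (p ` {1..CARD('n)})"
        unfolding ideal_generated_def by (intro R.span_sum R.span_scale R.span_base imageI)
      finally show ?thesis .
    qed
    then show ?thesis unfolding assms(6) ideal_times_free_module_iff by blast
  next
    case False
    \<comment> \<open>In rank one the top index is the only one, and the identity matrix makes the
      difference zero.\<close>
    then have "j = CARD('n)" using j by auto
    have "(gradient (p CARD('n)) - gradient (p j) v* mat 1) $ c \<in> ideal_generated (p ` {1..CARD('n)})" for c
      unfolding ideal_generated_def \<open>j = CARD('n)\<close> vector_matrix_mul_rid by (simp add: R.span_zero)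
    then show ?thesis unfolding assms(6) ideal_times_free_module_iff by blast
  qed
qed

end
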